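(* Let $(A,\rho_A,[\![\cdot,\cdot]\!]_A)$ and $(B,\rho_B,[\![\cdot,\cdot]\!]_B)$ be Lie algebroids on a smooth manifold $M$, and let $\Phi_0:A\to B$ and $\Phi_1:A\to B$ be homomorphisms of Lie algebroids. If $\Phi:T\mathbb{R}\times A\to B$ is a homotopy joining $\Phi_0$ to $\Phi_1$, then $$h=\int_{\Delta^1}\circ\,\Phi^*:\Omega(B)\longrightarrow\Omega(A)$$ is a chain operator joining $\Phi_0^*:\Omega(B)\to\Omega(A)$ to $\Phi_1^*:\Omega(B)\to\Omega(A)$, i.e. $$h\circ d_B+d_A\circ h=\Phi_1^*-\Phi_0^*.$$
   Context: **Lie algebroids and forms.** A Lie algebroid over $M$ is a triple $(A,\rho_A,[\![\cdot,\cdot]\!]_A)$ with $A\to M$ a real vector bundle, $\rho_A:A\to TM$ a vector bundle homomorphism (the anchor), and $[\![\cdot,\cdot]\!]_A$ an $\mathbb{R}$-Lie algebra bracket on $\Gamma(A)$ with $[\![a,fb]\!]_A=f[\![a,b]\!]_A+\rho_A(a)(f)\,b$. It need not be regular (the anchor need not have constant rank). $\Omega(A)=\bigoplus_{n\ge0}\Omega^n(A)$ with $\Omega^n(A)=\Gamma(\bigwedge^nA^* )$, and $d_A:\Omega^n(A)\to\Omega^{n+1}(A)$ is $$(d_A\eta)(a_1,\dots,a_{n+1})=\sum_{i=1}^{n+1}(-1)^{i+1}(\rho_A\circ a_i)\big(\eta(a_1,\dots\widehat{i}\dots,a_{n+1})\big)+\sum_{i<j}(-1)^{i+j}\eta([\![a_i,a_j]\!]_A,a_1,\dots\widehat{i}\dots\widehat{j}\dots,a_{n+1}),$$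 with $(d_Af)(a)=(\rho_A\circ a)(f)$ for $f\in\Omega^0(A)=C^\infty(M)$. **Homomorphisms.** Let $A$ be a Lie algebroid over a manifold $P$ and $B$ one over a manifold $N$. A homomorphism of Lie algebroids $\Phi:A\to B$ is a vector bundle homomorphism over a smooth map $f:P\to N$ such that $\rho_B\circ\Phi=f_*\circ\rho_A$ and, for all $a,b\in\Gamma(A)$ with decompositions $\Phi\circ a=\sum_if_a^i(\sigma_i\circ f)$, $\Phi\circ b=\sum_jf_b^j(\varepsilon_j\circ f)$, where $f_a^i,f_b^j\in C^\infty(P)$ and $\sigma_i,\varepsilon_j\in\Gamma(B)$, $$\Phi\circ[\![a,b]\!]_A=\sum_{i,j}f_a^if_b^j\big([\![\sigma_i,\varepsilon_j]\!]_B\circ f\big)+\sum_j(\rho_A\circ a)(f_b^j)(\varepsilon_j\circ f)-\sum_i(\rho_A\circ b)(f_a^i)(\sigma_i\circ f).$$ The base map $f$ need not be the identity, even when $P=N$. **Pullback.** For such $\Phi$ and $\eta\in\Omega^n(B)$, $\Phi^*\eta\in\Omega^n(A)$ is given by $(\Phi^*\eta)_x(\nu_1,\dots,\nu_n)=\eta_{f(x)}(\Phi\nu_1,\dots,\Phi\nu_n)$ for $x\in P$, $\nu_i\in A_x$; on functions, $\Phi^*g=g\circ f$. **The Lie algebroid $T\mathbb{R}\times A$.** For $A$ a Lie algebroid over $M$, this is the Cartesian product Lie algebroid over $\mathbb{R}\times M$, with anchor $\mathrm{id}\times\rho_A$ and, for sections $\sigma=(\sigma^1,\sigma^2)$, $\eta=(\eta^1,\eta^2)$,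 bracket whose two components at $(t,x)$ are $$[\sigma^1(\cdot,x),\eta^1(\cdot,x)](t)+(\rho_A\circ\sigma^2)_{(t,x)}(\eta^1(t,\cdot))-(\rho_A\circ\eta^2)_{(t,x)}(\sigma^1(t,\cdot)),$$ $$[\![\sigma^2(t,\cdot),\eta^2(t,\cdot)]\!]_A(x)+\sigma^1_{(t,x)}(\eta^2(\cdot,x))-\eta^1_{(t,x)}(\sigma^2(\cdot,x)),$$ where tangent vectors act on vector-valued functions by directional derivative. **Homotopy.** A homotopy joining two homomorphisms $\Phi_0,\Phi_1:A\to B$ of Lie algebroids is a homomorphism of Lie algebroids $\Phi:T\mathbb{R}\times A\to B$ with $\Phi(\theta_0,\cdot)=\Phi_0$ and $\Phi(\theta_1,\cdot)=\Phi_1$, where $\theta_0\in T_0\mathbb{R}$ and $\theta_1\in T_1\mathbb{R}$ are the null vectors. **Integration.** $\Delta^1=[0,1]$. The operator $\int_{\Delta^1}:\Omega^n(T\mathbb{R}\times A)\to\Omega^{n-1}(A)$ is, for $n\ge1$ and $a_1,\dots,a_{n-1}\in\Gamma(A)$, $$\Big(\int_{\Delta^1}\omega\Big)(a_1,\dots,a_{n-1})=\int_0^1\omega\Big(\tfrac{\partial}{\partial t},a_1,\dots,a_{n-1}\Big)\Big|_{(t,\bullet)}dt\in C^\infty(M),$$ where $\frac{\partial}{\partial t}$ stands for the section $(\frac{\partial}{\partial t},0)$ and $a_i$ for the section $(0,a_i)$, $(t,x)\mapsto(0_t,a_i(x))$, of $T\mathbb{R}\times A$, and $F|_{(t,\bullet)}$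 is the function $x\mapsto F(t,x)$; on $\Omega^0$ the operator $\int_{\Delta^1}$ is zero. *)

theory Defs
  imports "HOL-Analysis.Analysis" "HOL-Library.Function_Algebras"
begin

text \<open>Functions into a real vector space form a real vector space under the pointwise operations.
  This is used for tangent vectors, sections and differential forms.\<close>

instantiation "fun" :: (type, real_vector) real_vector
begin

definition scaleR_fun :: "real \<Rightarrow> ('a \<Rightarrow> 'b) \<Rightarrow> 'a \<Rightarrow> 'b"
  where "scaleR_fun c f = (\<lambda>x. c *\<^sub>R f x)"

instance
  by standard (auto simp: scaleR_fun_def fun_eq_iff scaleR_add_right scaleR_add_left)

end

definition linear_on_subspace :: "'a::real_vector set \<Rightarrow> ('a \<Rightarrow> 'b::real_vector) \<Rightarrow> bool"
  where "linear_on_subspace S f \<longleftrightarrow>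
    (\<forall>u\<in>S. \<forall>v\<in>S. f (u + v) = f u + f v) \<and> (\<forall>c. \<forall>v\<in>S. f (c *\<^sub>R v) = c *\<^sub>R f v)"

text \<open>Model spaces of manifolds and bundles are finite-dimensional normed spaces. The class
  \<open>euclidean_space\<close> is not used for them because it excludes dimension (or rank) zero.\<close>

definition finite_dim :: "'a::real_vector itself \<Rightarrow> bool"
  where "finite_dim _ \<longleftrightarrow> (\<exists>B::'a set. finite B \<and> span B = UNIV)"


section \<open>Smooth manifolds\<close>

text \<open>For finite-dimensional domains and open \<open>S\<close>, the following is the usual notion of a
  \<open>C\<^sup>k\<close> map: iterated directional derivatives up to order \<open>k\<close> exist and are continuous.\<close>

primrec Ck_on ::
  "nat \<Rightarrow> 'a::real_normed_vector set \<Rightarrow> ('a \<Rightarrow> 'b::real_normed_vector) \<Rightarrow> bool"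
where
  "Ck_on 0 S f \<longleftrightarrow> continuous_on S f"
| "Ck_on (Suc k) S f \<longleftrightarrow> (\<forall>x\<in>S. f differentiable (at x)) \<and>
     (\<forall>v. Ck_on k S (\<lambda>x. frechet_derivative f (at x) v))"

definition smooth_on ::
  "'a::real_normed_vector set \<Rightarrow> ('a \<Rightarrow> 'b::real_normed_vector) \<Rightarrow> bool"
  where "smooth_on S f \<longleftrightarrow> (\<forall>k. Ck_on k S f)"

text \<open>A chart is a pair of its domain and its coordinate map; the values of the coordinate map
  outside the domain are irrelevant.\<close>

type_synonym ('m, 'e) chart = "'m set \<times> ('m \<Rightarrow> 'e)"

definition chart_inv :: "('m, 'e) chart \<Rightarrow> 'e \<Rightarrow> 'm"
  where "chart_inv c = inv_into (fst c) (snd c)"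

definition is_chart :: "('m::topological_space, 'e::real_normed_vector) chart \<Rightarrow> bool"
  where "is_chart c \<longleftrightarrow> open (fst c) \<and> open (snd c ` fst c) \<and>
    homeomorphism (fst c) (snd c ` fst c) (snd c) (chart_inv c)"

text \<open>The underlying space of a manifold is a whole type, Hausdorff and second countable by its
  type classes.\<close>

definition smooth_manifold ::
  "('m::{t2_space, second_countable_topology}, 'e::real_normed_vector) chart set \<Rightarrow> bool"
  where "smooth_manifold M \<longleftrightarrow> finite_dim TYPE('e) \<and> (\<Union>c\<in>M. fst c) = UNIV \<and>
    (\<forall>c\<in>M. is_chart c) \<and>
    (\<forall>c\<in>M. \<forall>d\<in>M. smooth_on (snd c ` (fst c \<inter> fst d)) (snd d \<circ> chart_inv c))"

definition chart_at :: "('m, 'e) chart set \<Rightarrow> 'm \<Rightarrow> ('m, 'e) chart"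
  where "chart_at M x = (SOME c. c \<in> M \<and> x \<in> fst c)"

definition smooth_fun_on :: "('m, 'e::real_normed_vector) chart set \<Rightarrow> 'm set \<Rightarrow>
    ('m \<Rightarrow> 'w::real_normed_vector) \<Rightarrow> bool"
  where "smooth_fun_on M W f \<longleftrightarrow>
    (\<forall>c\<in>M. smooth_on (snd c ` (fst c \<inter> W)) (f \<circ> chart_inv c))"

definition smooth_functions :: "('m, 'e::real_normed_vector) chart set \<Rightarrow> ('m \<Rightarrow> real) set"
  where "smooth_functions M = {f. smooth_fun_on M UNIV f}"

definition smooth_map ::
  "('p::topological_space, 'e::real_normed_vector) chart set \<Rightarrow>
   ('n::topological_space, 'd::real_normed_vector) chart set \<Rightarrow> ('p \<Rightarrow> 'n) \<Rightarrow> bool"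
  where "smooth_map P N f \<longleftrightarrow> continuous_on UNIV f \<and>
    (\<forall>c\<in>P. \<forall>d\<in>N. smooth_on (snd c ` (fst c \<inter> f -` fst d)) (snd d \<circ> f \<circ> chart_inv c))"

definition line_times_chart :: "('m, 'e) chart \<Rightarrow> (real \<times> 'm, real \<times> 'e) chart"
  where "line_times_chart c = (UNIV \<times> fst c, \<lambda>(t, x). (t, snd c x))"

definition line_times :: "('m, 'e) chart set \<Rightarrow> (real \<times> 'm, real \<times> 'e) chart set"
  where "line_times M = line_times_chart ` M"


section \<open>Vector bundles\<close>

text \<open>The fibres of a bundle are a family of linear subspaces of one real vector space, which
  serves only as a universe: the smooth structure is given by the local trivializations alone.
  A local trivialization consists of an open set \<open>U\<close> and linear isomorphisms of the
  fibres over \<open>U\<close> with the model fibre \<open>'f\<close>.\<close>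

record ('m, 'v, 'f) vector_bundle =
  fib :: "'m \<Rightarrow> 'v set"
  trivs :: "('m set \<times> ('m \<Rightarrow> 'v \<Rightarrow> 'f)) set"

definition total_space :: "('m, 'v, 'f, 'z) vector_bundle_scheme \<Rightarrow> ('m \<times> 'v) set"
  where "total_space E = Sigma UNIV (fib E)"

definition triv_inv :: "('m, 'v, 'f, 'z) vector_bundle_scheme \<Rightarrow>
    'm set \<times> ('m \<Rightarrow> 'v \<Rightarrow> 'f) \<Rightarrow> 'm \<Rightarrow> 'f \<Rightarrow> 'v"
  where "triv_inv E u x = inv_into (fib E x) (snd u x)"

definition triv_at :: "('m, 'v, 'f, 'z) vector_bundle_scheme \<Rightarrow> 'm \<Rightarrow>
    'm set \<times> ('m \<Rightarrow> 'v \<Rightarrow> 'f)"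
  where "triv_at E x = (SOME u. u \<in> trivs E \<and> x \<in> fst u)"

definition smooth_vector_bundle ::
  "('m::topological_space, 'e::real_normed_vector) chart set \<Rightarrow>
   ('m, 'v::real_vector, 'f::real_normed_vector, 'z) vector_bundle_scheme \<Rightarrow> bool"
  where "smooth_vector_bundle M E \<longleftrightarrow> finite_dim TYPE('f) \<and>
    (\<forall>x. subspace (fib E x)) \<and>
    (\<Union>u\<in>trivs E. fst u) = UNIV \<and>
    (\<forall>u\<in>trivs E. open (fst u) \<and>
      (\<forall>x\<in>fst u. linear_on_subspace (fib E x) (snd u x) \<and>
        bij_betw (snd u x) (fib E x) UNIV)) \<and>
    (\<forall>u\<in>trivs E. \<forall>w\<in>trivs E. \<forall>y.
      smooth_fun_on M (fst u \<inter> fst w) (\<lambda>x. snd w x (triv_inv E u x y)))"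

definition sections :: "('m, 'e::real_normed_vector) chart set \<Rightarrow>
    ('m, 'v, 'f::real_normed_vector, 'z) vector_bundle_scheme \<Rightarrow> ('m \<Rightarrow> 'v) set"
  where "sections M E = {a. (\<forall>x. a x \<in> fib E x) \<and>
    (\<forall>u\<in>trivs E. smooth_fun_on M (fst u) (\<lambda>x. snd u x (a x)))}"

text \<open>Bundle homomorphisms are maps of total spaces.\<close>

definition vb_hom ::
  "('p::topological_space, 'e::real_normed_vector) chart set \<Rightarrow>
   ('p, 'v::real_vector, 'f::real_normed_vector, 'z) vector_bundle_scheme \<Rightarrow>
   ('n::topological_space, 'd::real_normed_vector) chart set \<Rightarrow>
   ('n, 'w::real_vector, 'g::real_normed_vector, 'y) vector_bundle_scheme \<Rightarrow>
   ('p \<Rightarrow> 'n) \<Rightarrow> ('p \<times> 'v \<Rightarrow> 'n \<times> 'w) \<Rightarrow> bool"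
  where "vb_hom P A N B f \<Phi> \<longleftrightarrow> smooth_map P N f \<and>
    (\<forall>x. (\<forall>v\<in>fib A x. fst (\<Phi> (x, v)) = f x \<and> snd (\<Phi> (x, v)) \<in> fib B (f x)) \<and>
      linear_on_subspace (fib A x) (\<lambda>v. snd (\<Phi> (x, v)))) \<and>
    (\<forall>u\<in>trivs A. \<forall>w\<in>trivs B. \<forall>y. smooth_fun_on P (fst u \<inter> f -` fst w)
      (\<lambda>x. snd w (f x) (snd (\<Phi> (x, triv_inv A u x y)))))"

definition base_map :: "('p \<times> 'v::zero \<Rightarrow> 'n \<times> 'w) \<Rightarrow> 'p \<Rightarrow> 'n"
  where "base_map \<Phi> x = fst (\<Phi> (x, 0))"

text \<open>The derivative of a curve in a fibre, a finite-dimensional vector space, computed in linear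
  coordinates.\<close>

definition fibre_derivative :: "('m, 'v, 'f::real_normed_vector, 'z) vector_bundle_scheme \<Rightarrow>
    'm \<Rightarrow> (real \<Rightarrow> 'v) \<Rightarrow> real \<Rightarrow> 'v"
  where "fibre_derivative E x c t = (let u = triv_at E x in
    triv_inv E u x (vector_derivative (\<lambda>s. snd u x (c s)) (at t)))"


section \<open>The tangent bundle\<close>

text \<open>A tangent vector at \<open>x\<close> assigns to every chart of the atlas around \<open>x\<close> a coordinate vector,
  compatibly with the changes of coordinates.\<close>

type_synonym ('m, 'e) tvec = "('m, 'e) chart \<Rightarrow> 'e"

definition tangent_space ::
  "('m, 'e::real_normed_vector) chart set \<Rightarrow> 'm \<Rightarrow> ('m, 'e) tvec set"
  where "tangent_space M x = {\<xi>.
    (\<forall>c\<in>M. \<forall>d\<in>M. x \<in> fst c \<longrightarrow> x \<in> fst d \<longrightarrow>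
      \<xi> d = frechet_derivative (snd d \<circ> chart_inv c) (at (snd c x)) (\<xi> c)) \<and>
    (\<forall>c. \<not> (c \<in> M \<and> x \<in> fst c) \<longrightarrow> \<xi> c = 0)}"

definition tangent_bundle ::
  "('m, 'e::real_normed_vector) chart set \<Rightarrow> ('m, ('m, 'e) tvec, 'e) vector_bundle"
  where "tangent_bundle M =
    \<lparr>fib = tangent_space M, trivs = (\<lambda>c. (fst c, \<lambda>x \<xi>. \<xi> c)) ` M\<rparr>"

text \<open>The tangent vector at \<open>x\<close> with coordinates \<open>w\<close> in the chart \<open>c\<close>.\<close>

definition tangent_of_coords ::
  "('m, 'e::real_normed_vector) chart set \<Rightarrow> 'm \<Rightarrow> ('m, 'e) chart \<Rightarrow> 'e \<Rightarrow> ('m, 'e) tvec"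
  where "tangent_of_coords M x c w = (\<lambda>d. if d \<in> M \<and> x \<in> fst d
    then frechet_derivative (snd d \<circ> chart_inv c) (at (snd c x)) w else 0)"

text \<open>The derivative of a function along a tangent vector.\<close>

definition tangent_apply ::
  "('m, 'e::real_normed_vector) chart set \<Rightarrow> 'm \<Rightarrow> ('m, 'e) tvec \<Rightarrow> ('m \<Rightarrow> real) \<Rightarrow> real"
  where "tangent_apply M x \<xi> g = (let c = chart_at M x in
    frechet_derivative (g \<circ> chart_inv c) (at (snd c x)) (\<xi> c))"

definition tangent_map ::
  "('p, 'e::real_normed_vector) chart set \<Rightarrow> ('n, 'd::real_normed_vector) chart set \<Rightarrow>
   ('p \<Rightarrow> 'n) \<Rightarrow> 'p \<Rightarrow> ('p, 'e) tvec \<Rightarrow> ('n, 'd) tvec"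
  where "tangent_map P N f x \<xi> = (let c = chart_at P x in
    (\<lambda>d. if d \<in> N \<and> f x \<in> fst d
      then frechet_derivative (snd d \<circ> f \<circ> chart_inv c) (at (snd c x)) (\<xi> c) else 0))"


section \<open>Lie algebroids\<close>

text \<open>The field \<open>anchor\<close> is the fibre part \<open>A\<^sub>x \<rightarrow> T\<^sub>xM\<close> of the anchor. The bracket matters only on
  smooth sections.\<close>

record ('m, 'v, 'f, 'e) lie_algebroid = "('m, 'v, 'f) vector_bundle" +
  anchor :: "'m \<Rightarrow> 'v \<Rightarrow> ('m, 'e) tvec"
  brk :: "('m \<Rightarrow> 'v) \<Rightarrow> ('m \<Rightarrow> 'v) \<Rightarrow> ('m \<Rightarrow> 'v)"

definition lie_bracket_on :: "'a::real_vector set \<Rightarrow> ('a \<Rightarrow> 'a \<Rightarrow> 'a) \<Rightarrow> bool"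
  where "lie_bracket_on G br \<longleftrightarrow>
    (\<forall>a\<in>G. \<forall>b\<in>G. br a b \<in> G) \<and>
    (\<forall>a\<in>G. linear_on_subspace G (br a) \<and> linear_on_subspace G (\<lambda>b. br b a)) \<and>
    (\<forall>a\<in>G. br a a = 0) \<and>
    (\<forall>a\<in>G. \<forall>b\<in>G. \<forall>c\<in>G. br a (br b c) + br b (br c a) + br c (br a b) = 0)"

definition is_lie_algebroid ::
  "('m::{t2_space, second_countable_topology}, 'e::real_normed_vector) chart set \<Rightarrow>
   ('m, 'v::real_vector, 'f::real_normed_vector, 'e) lie_algebroid \<Rightarrow> bool"
  where "is_lie_algebroid M A \<longleftrightarrow> smooth_vector_bundle M A \<and>
    vb_hom M A M (tangent_bundle M) id (\<lambda>(x, v). (x, anchor A x v)) \<and>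
    lie_bracket_on (sections M A) (brk A) \<and>
    (\<forall>a\<in>sections M A. \<forall>b\<in>sections M A. \<forall>g\<in>smooth_functions M. \<forall>x.
      brk A a (\<lambda>y. g y *\<^sub>R b y) x =
        g x *\<^sub>R brk A a b x + tangent_apply M x (anchor A x (a x)) g *\<^sub>R b x)"

definition lie_algebroid_hom ::
  "('p::topological_space, 'e::real_normed_vector) chart set \<Rightarrow>
   ('p, 'v::real_vector, 'f::real_normed_vector, 'e) lie_algebroid \<Rightarrow>
   ('n::topological_space, 'd::real_normed_vector) chart set \<Rightarrow>
   ('n, 'w::real_vector, 'g::real_normed_vector, 'd) lie_algebroid \<Rightarrow>
   ('p \<times> 'v \<Rightarrow> 'n \<times> 'w) \<Rightarrow> bool"
  where "lie_algebroid_hom P A N B \<Phi> \<longleftrightarrow> (let f = base_map \<Phi> in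
    vb_hom P A N B f \<Phi> \<and>
    (\<forall>x. \<forall>v\<in>fib A x. anchor B (f x) (snd (\<Phi> (x, v))) = tangent_map P N f x (anchor A x v)) \<and>
    (\<forall>a\<in>sections P A. \<forall>b\<in>sections P A. \<forall>(m::nat) (n::nat) fa \<sigma> fb \<epsilon>.
      (\<forall>i<m. fa i \<in> smooth_functions P \<and> \<sigma> i \<in> sections N B) \<longrightarrow>
      (\<forall>j<n. fb j \<in> smooth_functions P \<and> \<epsilon> j \<in> sections N B) \<longrightarrow>
      (\<forall>x. snd (\<Phi> (x, a x)) = (\<Sum>i<m. fa i x *\<^sub>R \<sigma> i (f x))) \<longrightarrow>
      (\<forall>x. snd (\<Phi> (x, b x)) = (\<Sum>j<n. fb j x *\<^sub>R \<epsilon> j (f x))) \<longrightarrow>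
      (\<forall>x. snd (\<Phi> (x, brk A a b x)) =
        (\<Sum>i<m. \<Sum>j<n. (fa i x * fb j x) *\<^sub>R brk B (\<sigma> i) (\<epsilon> j) (f x))
        + (\<Sum>j<n. tangent_apply P x (anchor A x (a x)) (fb j) *\<^sub>R \<epsilon> j (f x))
        - (\<Sum>i<m. tangent_apply P x (anchor A x (b x)) (fa i) *\<^sub>R \<sigma> i (f x)))))"

text \<open>The Cartesian product \<open>T\<real> \<times> A\<close> over \<open>\<real> \<times> M\<close>, where \<open>T\<^sub>t\<real>\<close> is identified with \<open>\<real>\<close>
  as usual, so that vector fields on \<open>\<real>\<close> are real functions with bracket \<open>u v' - v u'\<close>.\<close>

definition TR_times ::
  "('m, 'e::real_normed_vector) chart set \<Rightarrow>
   ('m, 'v::real_vector, 'f::real_normed_vector, 'e) lie_algebroid \<Rightarrow>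
   (real \<times> 'm, real \<times> 'v, real \<times> 'f, real \<times> 'e) lie_algebroid"
  where "TR_times M A =
    \<lparr>fib = (\<lambda>(t, x). UNIV \<times> fib A x),
     trivs = (\<lambda>u. (UNIV \<times> fst u, \<lambda>(t, x) (s, v). (s, snd u x v))) ` trivs A,
     anchor = (\<lambda>(t, x) (s, v). let c = chart_at M x in
       tangent_of_coords (line_times M) (t, x) (line_times_chart c) (s, anchor A x v c)),
     brk = (\<lambda>\<sigma> \<eta>. let \<sigma>1 = (\<lambda>p. fst (\<sigma> p)); \<sigma>2 = (\<lambda>p. snd (\<sigma> p));
                      \<eta>1 = (\<lambda>p. fst (\<eta> p)); \<eta>2 = (\<lambda>p. snd (\<eta> p)) in
       (\<lambda>(t, x).
         (\<sigma>1 (t, x) * deriv (\<lambda>s. \<eta>1 (s, x)) t - \<eta>1 (t, x) * deriv (\<lambda>s. \<sigma>1 (s, x)) t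
            + tangent_apply M x (anchor A x (\<sigma>2 (t, x))) (\<lambda>y. \<eta>1 (t, y))
            - tangent_apply M x (anchor A x (\<eta>2 (t, x))) (\<lambda>y. \<sigma>1 (t, y)),
          brk A (\<lambda>y. \<sigma>2 (t, y)) (\<lambda>y. \<eta>2 (t, y)) x
            + \<sigma>1 (t, x) *\<^sub>R fibre_derivative A x (\<lambda>s. \<eta>2 (s, x)) t
            - \<eta>1 (t, x) *\<^sub>R fibre_derivative A x (\<lambda>s. \<sigma>2 (s, x)) t)))\<rparr>"

definition lie_homotopy ::
  "('m::topological_space, 'e::real_normed_vector) chart set \<Rightarrow>
   ('m, 'v::real_vector, 'f::real_normed_vector, 'e) lie_algebroid \<Rightarrow>
   ('n::topological_space, 'd::real_normed_vector) chart set \<Rightarrow>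
   ('n, 'w::real_vector, 'g::real_normed_vector, 'd) lie_algebroid \<Rightarrow>
   ('m \<times> 'v \<Rightarrow> 'n \<times> 'w) \<Rightarrow> ('m \<times> 'v \<Rightarrow> 'n \<times> 'w) \<Rightarrow>
   ((real \<times> 'm) \<times> (real \<times> 'v) \<Rightarrow> 'n \<times> 'w) \<Rightarrow> bool"
  where "lie_homotopy M A N B \<Phi>0 \<Phi>1 \<Phi> \<longleftrightarrow>
    lie_algebroid_hom (line_times M) (TR_times M A) N B \<Phi> \<and>
    (\<forall>(x, v)\<in>total_space A. \<Phi> ((0, x), (0, v)) = \<Phi>0 (x, v) \<and> \<Phi> ((1, x), (0, v)) = \<Phi>1 (x, v))"


section \<open>Differential forms\<close>

text \<open>A possibly inhomogeneous form takes a point and a list of fibre elements at this point. Its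
  component of degree \<open>n\<close> is its restriction to lists of length \<open>n\<close>. Forms vanish by convention on
  lists containing elements outside the fibre, so that equality of forms is equality of functions.\<close>

type_synonym ('m, 'v) form = "'m \<Rightarrow> 'v list \<Rightarrow> real"

definition Omega_n :: "('m, 'e::real_normed_vector) chart set \<Rightarrow>
    ('m, 'v::real_vector, 'f::real_normed_vector, 'z) vector_bundle_scheme \<Rightarrow>
    nat \<Rightarrow> ('m, 'v) form set"
  where "Omega_n M E n = {\<eta>.
    (\<forall>x vs. \<not> (length vs = n \<and> set vs \<subseteq> fib E x) \<longrightarrow> \<eta> x vs = 0) \<and>
    (\<forall>x vs. \<forall>i<n. length vs = n \<and> set vs \<subseteq> fib E x \<longrightarrow>
      linear_on_subspace (fib E x) (\<lambda>v. \<eta> x (vs[i := v]))) \<and>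
    (\<forall>x vs. \<forall>i<n. \<forall>j<n. length vs = n \<and> set vs \<subseteq> fib E x \<and> i \<noteq> j \<and> vs ! i = vs ! j \<longrightarrow>
      \<eta> x vs = 0) \<and>
    (\<forall>u\<in>trivs E. \<forall>ys. length ys = n \<longrightarrow>
      smooth_fun_on M (fst u) (\<lambda>x. \<eta> x (map (triv_inv E u x) ys)))}"

definition component :: "nat \<Rightarrow> ('m, 'v) form \<Rightarrow> ('m, 'v) form"
  where "component n \<eta> = (\<lambda>x vs. if length vs = n then \<eta> x vs else 0)"

definition Omega :: "('m, 'e::real_normed_vector) chart set \<Rightarrow>
    ('m, 'v::real_vector, 'f::real_normed_vector, 'z) vector_bundle_scheme \<Rightarrow>
    ('m, 'v) form set"
  where "Omega M E =
    {\<eta>. (\<forall>n. component n \<eta> \<in> Omega_n M E n) \<and> finite {n. component n \<eta> \<noteq> 0}}"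

definition omit :: "nat \<Rightarrow> 'a list \<Rightarrow> 'a list"
  where "omit i xs = take i xs @ drop (Suc i) xs"

definition eval_form :: "('m, 'v) form \<Rightarrow> ('m \<Rightarrow> 'v) list \<Rightarrow> 'm \<Rightarrow> real"
  where "eval_form \<eta> as x = \<eta> x (map (\<lambda>a. a x) as)"

text \<open>Positions in lists start at \<open>0\<close>, which turns the sign \<open>(-1)\<^sup>i\<^sup>+\<^sup>1\<close> into \<open>(-1)\<^sup>i\<close> and does not affect
  \<open>(-1)\<^sup>i\<^sup>+\<^sup>j\<close>. Since \<open>i < j\<close>, omitting \<open>j\<close> first keeps \<open>i\<close> in place.\<close>

definition koszul :: "('m, 'e::real_normed_vector) chart set \<Rightarrow>
    ('m, 'v::real_vector, 'f, 'e) lie_algebroid \<Rightarrow>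
    ('m, 'v) form \<Rightarrow> ('m \<Rightarrow> 'v) list \<Rightarrow> 'm \<Rightarrow> real"
  where "koszul M A \<eta> as x =
    (\<Sum>i<length as. (-1) ^ i * tangent_apply M x (anchor A x ((as ! i) x)) (eval_form \<eta> (omit i as)))
    + (\<Sum>j<length as. \<Sum>i<j. (-1) ^ (i + j) *
        eval_form \<eta> (brk A (as ! i) (as ! j) # omit i (omit j as)) x)"

text \<open>The differential of all degrees at once: the formula for the value on \<open>n + 1\<close> sections involves
  only the component of degree \<open>n\<close>, and the result has no component of degree \<open>0\<close>.\<close>

definition ext_deriv :: "('m, 'e::real_normed_vector) chart set \<Rightarrow>
    ('m, 'v::real_vector, 'f::real_normed_vector, 'e) lie_algebroid \<Rightarrow>
    ('m, 'v) form \<Rightarrow> ('m, 'v) form"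
  where "ext_deriv M A \<eta> = (THE \<omega>. \<omega> \<in> Omega M A \<and> component 0 \<omega> = 0 \<and>
    (\<forall>as. as \<noteq> [] \<and> set as \<subseteq> sections M A \<longrightarrow> eval_form \<omega> as = koszul M A \<eta> as))"

definition pullback :: "('p, 'v::real_vector, 'f, 'z) vector_bundle_scheme \<Rightarrow>
    ('p \<times> 'v \<Rightarrow> 'n \<times> 'w) \<Rightarrow> ('n, 'w) form \<Rightarrow> ('p, 'v) form"
  where "pullback A \<Phi> \<eta> = (\<lambda>x vs. if set vs \<subseteq> fib A x
    then \<eta> (base_map \<Phi> x) (map (\<lambda>v. snd (\<Phi> (x, v))) vs) else 0)"

text \<open>Integration over the interval lowers the degree by one; it ignores the component of degree
  \<open>0\<close>, since only values on non-empty lists enter.\<close>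

definition integrate_interval :: "('m, 'v::real_vector, 'f, 'z) vector_bundle_scheme \<Rightarrow>
    (real \<times> 'm, real \<times> 'v) form \<Rightarrow> ('m, 'v) form"
  where "integrate_interval A \<omega> = (\<lambda>x vs. if set vs \<subseteq> fib A x
    then integral {0..1} (\<lambda>t. \<omega> (t, x) ((1, 0) # map (\<lambda>v. (0, v)) vs)) else 0)"

text \<open>A chain operator joining the cochain maps \<open>F0\<close> and \<open>F1\<close> from \<open>(C, dC)\<close> to \<open>(D, dD)\<close>.\<close>

definition chain_operator :: "'c::real_vector set \<Rightarrow> ('c \<Rightarrow> 'c) \<Rightarrow>
    'd::real_vector set \<Rightarrow> ('d \<Rightarrow> 'd) \<Rightarrow> ('c \<Rightarrow> 'd) \<Rightarrow> ('c \<Rightarrow> 'd) \<Rightarrow> ('c \<Rightarrow> 'd) \<Rightarrow> bool"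
  where "chain_operator C dC D dD F0 F1 h \<longleftrightarrow> h \<in> C \<rightarrow> D \<and> linear_on_subspace C h \<and>
    (\<forall>\<eta>\<in>C. h (dC \<eta>) + dD (h \<eta>) = F1 \<eta> - F0 \<eta>)"

end

theory Submission
  imports Defs
begin

text \<open>Write \<open>\<omega> = \<Phi>\<^sup>*\<eta>\<close>, a form on \<open>T\<real> \<times> A\<close>. Pullback commutes with the Koszul formula, so
  \<open>\<Phi>\<^sup>*(d\<^sub>B\<eta>)\<close> evaluated on \<open>\<partial>/\<partial>t, a\<^sub>1, \<dots>, a\<^sub>n\<close> is the Koszul expression of \<open>\<omega>\<close> on these sections. As
  \<open>\<partial>/\<partial>t\<close> commutes with sections that do not depend on \<open>t\<close>, Cartan's formula
  \<open>\<iota> d = L - d \<iota>\<close> along \<open>\<partial>/\<partial>t\<close> turns this into the \<open>t\<close>-derivative of \<open>\<omega>(a\<^sub>1, \<dots>, a\<^sub>n)\<close> minus \<open>d\<^sub>A\<close> of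
    the slice
  of \<open>\<iota>\<omega>\<close> at time \<open>t\<close>. Integration over \<open>[0,1]\<close> gives \<open>\<Phi>\<^sub>1\<^sup>*\<eta> - \<Phi>\<^sub>0\<^sup>*\<eta> - d\<^sub>A(h\<eta>)\<close>.

  Compatibility of pullback and differential is checked at one point \<open>p\<close>. A bump function makes
  \<open>\<Phi> \<circ> s\<close> a combination of pulled back global sections \<open>\<epsilon>\<^sub>k\<close> of \<open>B\<close>; freezing its coefficients at
  \<open>p\<close> gives a section of \<open>B\<close>, and the error terms of the Leibniz rule cancel those in the bracket
  condition for homomorphisms.\<close>

section \<open>Finite-dimensional normed spaces\<close>

text \<open>The differential is a description (\<open>THE\<close>), so nothing can be computed with
  it until the Koszul expression is known to come from a form: it has to be linear over smooth
  functions in every slot, alternating, determined by values at a point, and smooth. Cartan's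
  formula serves here as well, as a recursion on the degree. On \<open>TR_times M A\<close> no
  differential is formed; the Koszul expression itself is used there, on lifts of sections of
  \<open>A\<close> and on the time direction, whose brackets are explicit.

  The base map is arbitrary, so \<Phi> takes a section to a section along the base map and in
  general not to a section of \<open>B\<close>. For this reason forms are evaluated on sections
  along maps.

  Model spaces are finite-dimensional normed spaces, possibly of dimension zero, and smoothness is
  defined by directional derivatives. Expanding vectors over a finite system with continuous
  coordinate functionals makes the chain rule, integrals with parameters and the evaluation of forms
  on varying sections accessible to induction.\<close>

definition coord_system ::
  "nat \<Rightarrow> (nat \<Rightarrow> 'a::real_normed_vector) \<Rightarrow> (nat \<Rightarrow> 'a \<Rightarrow> real) \<Rightarrow> bool"
  where "coord_system r e \<kappa> \<longleftrightarrow> (\<forall>i<r. bounded_linear (\<kappa> i)) \<and> (\<forall>v. v = (\<Sum>i<r. \<kappa> i v *\<^sub>R e i))"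

lemma coord_systemD:
  assumes "coord_system r e \<kappa>"
  shows "i < r \<Longrightarrow> bounded_linear (\<kappa> i)" and "(\<Sum>i<r. \<kappa> i v *\<^sub>R e i) = v"
  using assms unfolding coord_system_def by metis+

text \<open>The box over one more vector is the image of the product of an interval with the smaller
  box under a continuous map. Compactness of real intervals is the only source of compactness here,
  since nothing is known yet about the topology of \<open>'a\<close>.\<close>

lemma compact_coord_box:
  fixes e :: "'i \<Rightarrow> 'a::real_normed_vector"
  assumes "finite B"
  shows "compact {(\<Sum>b\<in>B. c b *\<^sub>R e b) |c. \<forall>b\<in>B. \<bar>c b\<bar> \<le> K}"
  using assms
proof (induction B)
  case empty
  have "{(\<Sum>b\<in>{}. c b *\<^sub>R e b) |c. \<forall>b\<in>{}. \<bar>c b\<bar> \<le> K} = {0::'a}" by auto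
  then show ?case by simp
next
  case (insert a B)
  let ?S = "{(\<Sum>b\<in>B. c b *\<^sub>R e b) |c. \<forall>b\<in>B. \<bar>c b\<bar> \<le> K}"
  let ?T = "{(\<Sum>b\<in>insert a B. c b *\<^sub>R e b) |c. \<forall>b\<in>insert a B. \<bar>c b\<bar> \<le> K}"
  have "?T = (\<lambda>(t, s). t *\<^sub>R e a + s) ` ({-K..K} \<times> ?S)"
  proof (intro equalityI subsetI)
    fix x assume "x \<in> ?T"
    then obtain c where "x = (\<Sum>b\<in>insert a B. c b *\<^sub>R e b)" "\<forall>b\<in>insert a B. \<bar>c b\<bar> \<le> K" by blast
    then show "x \<in> (\<lambda>(t, s). t *\<^sub>R e a + s) ` ({-K..K} \<times> ?S)"
      using insert.hyps by (intro image_eqI[where x = "(c a, \<Sum>b\<in>B. c b *\<^sub>R e b)"])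
        (auto simp: abs_le_iff)
  next
    fix x assume "x \<in> (\<lambda>(t, s). t *\<^sub>R e a + s) ` ({-K..K} \<times> ?S)"
    then obtain t c where x: "x = t *\<^sub>R e a + (\<Sum>b\<in>B. c b *\<^sub>R e b)" "\<bar>t\<bar> \<le> K" "\<forall>b\<in>B. \<bar>c b\<bar> \<le> K"
      by (auto simp: abs_le_iff)
    have "(\<Sum>b\<in>B. (c(a := t)) b *\<^sub>R e b) = (\<Sum>b\<in>B. c b *\<^sub>R e b)"
      using insert.hyps by (intro sum.cong) auto
    then have "x = (\<Sum>b\<in>insert a B. (c(a := t)) b *\<^sub>R e b)" using x insert.hyps by simp
    then show "x \<in> ?T" using x(2,3) by (intro CollectI exI[of _ "c(a := t)"]) auto
  qed
  moreover have "compact ((\<lambda>(t, s). t *\<^sub>R e a + s) ` ({-K..K} \<times> ?S))"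
    by (intro compact_continuous_image compact_Times insert.IH compact_Icc)
      (auto intro!: continuous_intros simp: split_beta)
  ultimately show ?case by simp
qed

text \<open>In the induction step the new vector \<open>a\<close> has a positive distance from the
  span of \<open>B\<close>: the infimum over a compact box of combinations is attained, and
  combinations of large norm are at least as far from \<open>a\<close> as 0 is. The distance bounds
  the coefficient of \<open>a\<close>, and subtracting its term bounds the other
  coefficients.\<close>

lemma coefficients_bounded:
  fixes B :: "'a::real_normed_vector set"
  assumes "finite B" "independent B"
  shows "\<exists>C>0. \<forall>c. \<forall>b\<in>B. \<bar>c b\<bar> \<le> C * norm (\<Sum>b\<in>B. c b *\<^sub>R b)"
  using assms
proof (induction B)
  case empty
  then show ?case by (auto intro: exI[of _ 1])
next
  case (insert a B)
  then obtain C where C: "C > 0" "\<And>c b. b \<in> B \<Longrightarrow> \<bar>c b\<bar> \<le> C * norm (\<Sum>b\<in>B. c b *\<^sub>R b)"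
    by (metis dependent_mono subset_insertI)
  have aB: "a \<notin> span B" using insert.prems insert.hyps by (simp add: independent_insert)
  \<comment> \<open>By the induction hypothesis every combination of norm at most
    \<open>2 * norm a\<close> has coefficients bounded by \<open>K\<close>. All other combinations
    are farther than \<open>norm a\<close> from \<open>a\<close>.\<close>
  define K where "K = C * (2 * norm a)"
  let ?S = "{(\<Sum>b\<in>B. c b *\<^sub>R b) |c. \<forall>b\<in>B. \<bar>c b\<bar> \<le> K}"
  have span_sum: "(\<Sum>b\<in>B. c b *\<^sub>R b) \<in> span B" for c
    by (intro span_sum span_scale span_base)
  have "\<exists>d>0. \<forall>c. d \<le> norm (a - (\<Sum>b\<in>B. c b *\<^sub>R b))"
  proof -
    have cS: "compact ?S" using compact_coord_box[OF insert.hyps(1), of "\<lambda>b. b"] .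
    have "0 \<in> ?S" using C(1) unfolding K_def by (intro CollectI exI[of _ "\<lambda>_. 0"]) auto
    then obtain s where s: "s \<in> ?S" "\<And>y. y \<in> ?S \<Longrightarrow> norm (a - s) \<le> norm (a - y)"
    proof -
      have "?S \<noteq> {}" using \<open>0 \<in> ?S\<close> by blast
      moreover have "continuous_on ?S (\<lambda>s. norm (a - s))" by (intro continuous_intros)
      ultimately have "\<exists>s\<in>?S. \<forall>y\<in>?S. norm (a - s) \<le> norm (a - y)"
        by (rule continuous_attains_inf[OF cS])
      then show thesis using that by blast
    qed
    have "a \<noteq> s" using s(1) aB span_sum by auto
    moreover have "a \<noteq> 0" using aB span_zero by auto
    moreover have "min (norm (a - s)) (norm a) \<le> norm (a - (\<Sum>b\<in>B. c b *\<^sub>R b))" for c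
    proof (cases "norm (\<Sum>b\<in>B. c b *\<^sub>R b) \<le> 2 * norm a")
      case True
      then have "(\<Sum>b\<in>B. c b *\<^sub>R b) \<in> ?S"
        unfolding K_def using C(2)[of _ c] mult_left_mono[OF True less_imp_le[OF C(1)]] by fastforce
      then show ?thesis using s(2) by (simp add: min.coboundedI1)
    next
      case False
      have "norm (\<Sum>b\<in>B. c b *\<^sub>R b) - norm a \<le> norm (a - (\<Sum>b\<in>B. c b *\<^sub>R b))"
        by (metis norm_minus_commute norm_triangle_ineq2)
      then show ?thesis using False by linarith
    qed
    ultimately show ?thesis by (intro exI[of _ "min (norm (a - s)) (norm a)"]) auto
  qed
  then obtain d where d: "d > 0" "\<And>c. d \<le> norm (a - (\<Sum>b\<in>B. c b *\<^sub>R b))" by blast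
  have 1: "\<bar>c a\<bar> * d \<le> norm (\<Sum>b\<in>insert a B. c b *\<^sub>R b)" for c
  proof (cases "c a = 0")
    case True then show ?thesis by simp
  next
    case False
    have "(\<Sum>b\<in>insert a B. c b *\<^sub>R b) = c a *\<^sub>R (a - (\<Sum>b\<in>B. (- c b / c a) *\<^sub>R b))"
      using False insert.hyps by (simp add: scaleR_diff_right scaleR_add_right scaleR_sum_right
        sum_negf)
    then show ?thesis using d(2)[of "\<lambda>b. - c b / c a"] by (simp add: mult_left_mono)
  qed
  have 2: "\<bar>c b\<bar> \<le> C * (1 + norm a / d) * norm (\<Sum>b\<in>insert a B. c b *\<^sub>R b)" if "b \<in> B" for b c
  proof -
    let ?n = "norm (\<Sum>b\<in>insert a B. c b *\<^sub>R b)"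
    have "norm (\<Sum>b\<in>B. c b *\<^sub>R b) = norm ((\<Sum>b\<in>insert a B. c b *\<^sub>R b) - c a *\<^sub>R a)"
      using insert.hyps by simp
    also have "\<dots> \<le> ?n + \<bar>c a\<bar> * norm a" by (metis norm_scaleR norm_triangle_ineq4)
    also have "\<dots> \<le> ?n + ?n / d * norm a"
      using 1[of c] d(1) by (intro add_left_mono mult_right_mono) (auto simp: field_simps)
    finally have "C * norm (\<Sum>b\<in>B. c b *\<^sub>R b) \<le> C * (?n + ?n / d * norm a)"
      using C(1) by (intro mult_left_mono) auto
    with C(2)[OF that, of c] show ?thesis by (simp add: algebra_simps)
  qed
  let ?D = "C * (1 + norm a / d) + 1 / d"
  have "0 < ?D" using C(1) d(1) by (intro add_nonneg_pos) auto
  moreover have "\<bar>c b\<bar> \<le> ?D * norm (\<Sum>b\<in>insert a B. c b *\<^sub>R b)" if "b \<in> insert a B" for b c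
  proof -
    let ?n = "norm (\<Sum>b\<in>insert a B. c b *\<^sub>R b)"
    have p: "0 \<le> C * (1 + norm a / d) * ?n" "0 \<le> 1 / d * ?n"
      using C(1) d(1) by (auto intro!: mult_nonneg_nonneg)
    consider "b = a" | "b \<in> B" using \<open>b \<in> insert a B\<close> by blast
    then have "\<bar>c b\<bar> \<le> C * (1 + norm a / d) * ?n + 1 / d * ?n"
    proof cases
      case 1
      have "\<bar>c a\<bar> \<le> 1 / d * ?n" using \<open>\<And>c. \<bar>c a\<bar> * d \<le> _ c\<close>[of c] d(1) by (simp add: field_simps)
      then have "\<bar>c a\<bar> \<le> C * (1 + norm a / d) * ?n + 1 / d * ?n" using p(1) by linarith
      then show ?thesis unfolding \<open>b = a\<close> .
    next
      case b: 2
      from 2[OF b, of c] p(2) show ?thesis by linarith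
    qed
    then show ?thesis by (simp add: algebra_simps)
  qed
  ultimately show ?case by blast
qed

text \<open>A spanning set is thinned to an independent one, whose coordinates are continuous by
  \<open>coefficients_bounded\<close>. \<open>coord_system\<close> asks only for a continuous
  expansion of every vector and admits \<open>r = 0\<close> in dimension zero.\<close>

lemma coord_system_exists:
  assumes "finite_dim TYPE('a::real_normed_vector)"
  obtains r and e :: "nat \<Rightarrow> 'a::real_normed_vector" and \<kappa> where "coord_system r e \<kappa>"
proof -
  obtain B0 :: "'a set" where B0: "finite B0" "span B0 = UNIV" using assms unfolding finite_dim_def
    by blast
  obtain B where B: "B \<subseteq> B0" "independent B" "span B0 \<subseteq> span B"
    using maximal_independent_subset[of B0] by (metis span_mono span_span)
  then have fB: "finite B" and sB: "span B = UNIV" using B0 finite_subset by blast+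
  obtain C where C: "C > 0" "\<And>c b. b \<in> B \<Longrightarrow> \<bar>c b\<bar> \<le> C * norm (\<Sum>b\<in>B. c b *\<^sub>R b)"
    using coefficients_bounded[OF fB B(2)] by blast
  have rep: "(\<Sum>b\<in>B. representation B v b *\<^sub>R b) = v" for v
    using sum_representation_eq[OF B(2) _ fB order_refl] sB by simp
  have bl: "bounded_linear (\<lambda>v. representation B v b)" if "b \<in> B" for b
  proof (rule bounded_linear_intro[where K = C])
    show "norm (representation B x b) \<le> norm x * C" for x
      using C(2)[OF that, of "representation B x"] by (simp add: rep mult.commute)
  qed (use B(2) sB in \<open>auto simp: representation_add representation_scale\<close>)
  obtain h where h: "bij_betw h {..<card B} B"
    using ex_bij_betw_nat_finite[OF fB] by (auto simp: atLeast0LessThan)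
  have "coord_system (card B) h (\<lambda>i v. representation B v (h i))"
    unfolding coord_system_def
  proof (intro conjI allI impI)
    show "bounded_linear (\<lambda>v. representation B v (h i))" if "i < card B" for i
      using bl h that by (auto simp: bij_betw_def)
    show "v = (\<Sum>i<card B. representation B v (h i) *\<^sub>R h i)" for v
      using rep[of v] sum.reindex_bij_betw[OF h, of "\<lambda>b. representation B v b *\<^sub>R b"] by simp
  qed
  then show thesis by (rule that)
qed

text \<open>The cube is closed because the coordinates are continuous, and it lies in the compact
  box of combinations with bounded coefficients. Cubes of this kind will carry the bump
  functions.\<close>

lemma compact_coord_cube:
  assumes "coord_system r e \<kappa>"
  shows "compact {v. \<forall>i<r. \<bar>\<kappa> i v\<bar> \<le> K}"
proof -
  have "compact {(\<Sum>i\<in>{..<r}. c i *\<^sub>R e i) |c. \<forall>i\<in>{..<r}. \<bar>c i\<bar> \<le> K}"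
    by (rule compact_coord_box) simp
  moreover have "closed {v. \<forall>i<r. \<bar>\<kappa> i v\<bar> \<le> K}"
  proof -
    have "{v. \<forall>i<r. \<bar>\<kappa> i v\<bar> \<le> K} = (\<Inter>i\<in>{..<r}. {v. \<bar>\<kappa> i v\<bar> \<le> K})" by auto
    moreover have "closed {v. \<bar>\<kappa> i v\<bar> \<le> K}" if "i < r" for i
      using coord_systemD(1)[OF assms that]
      by (intro closed_Collect_le continuous_intros linear_continuous_on) auto
    ultimately show ?thesis by (auto intro!: closed_INT)
  qed
  moreover have "{v. \<forall>i<r. \<bar>\<kappa> i v\<bar> \<le> K} \<subseteq> {(\<Sum>i\<in>{..<r}. c i *\<^sub>R e i) |c. \<forall>i\<in>{..<r}. \<bar>c i\<bar> \<le> K}"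
  proof
    fix v assume "v \<in> {v. \<forall>i<r. \<bar>\<kappa> i v\<bar> \<le> K}"
    then show "v \<in> {(\<Sum>i\<in>{..<r}. c i *\<^sub>R e i) |c. \<forall>i\<in>{..<r}. \<bar>c i\<bar> \<le> K}"
      by (intro CollectI exI[of _ "\<lambda>i. \<kappa> i v"]) (simp add: coord_systemD(2)[OF assms])
  qed
  ultimately show ?thesis
    using compact_Int_closed[of "{(\<Sum>i\<in>{..<r}. c i *\<^sub>R e i) |c. \<forall>i\<in>{..<r}. \<bar>c i\<bar> \<le> K}"
        "{v. \<forall>i<r. \<bar>\<kappa> i v\<bar> \<le> K}"]
    by (subst Int_absorb1[symmetric]) assumption+
qed

lemma finite_dim_prod:
  assumes "finite_dim TYPE('a::real_normed_vector)" "finite_dim TYPE('b::real_normed_vector)"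
  shows "finite_dim TYPE('a \<times> 'b)"
proof -
  obtain S :: "'a set" and T :: "'b set" where S: "finite S" "span S = UNIV" "finite T"
    "span T = UNIV"
    using assms unfolding finite_dim_def by blast
  have "span (S \<times> {0} \<union> {0} \<times> T) = UNIV"
  proof -
    have l: "linear (\<lambda>x::'a. (x, 0::'b))" "linear (\<lambda>y::'b. (0::'a, y))"
      by (auto intro!: linearI)
    have "(x, y) \<in> span (S \<times> {0} \<union> {0} \<times> T)" for x y
    proof -
      have "(x, 0::'b) \<in> span ((\<lambda>x. (x, 0)) ` S)"
        unfolding linear_span_image[OF l(1)] S(2) by (rule rangeI)
      moreover have "(0::'a, y) \<in> span ((\<lambda>y. (0, y)) ` T)"
        unfolding linear_span_image[OF l(2)] S(4) by (rule rangeI)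
      moreover have "span ((\<lambda>x. (x, 0)) ` S) \<subseteq> span (S \<times> {0} \<union> {0} \<times> T)"
        "span ((\<lambda>y. (0, y)) ` T) \<subseteq> span (S \<times> {0} \<union> {0} \<times> T)"
        by (intro span_mono; auto)+
      ultimately have "(x, 0) \<in> span (S \<times> {0} \<union> {0} \<times> T)" "(0, y) \<in> span (S \<times> {0} \<union> {0} \<times> T)"
        by blast+
      then show ?thesis using span_add[of "(x, 0)" _ "(0, y)"] by simp
    qed
    then show ?thesis by auto
  qed
  moreover have "finite (S \<times> {0} \<union> {0} \<times> T)" using S by simp
  ultimately show ?thesis unfolding finite_dim_def by blast
qed

lemma finite_dim_real: "finite_dim TYPE(real)"
proof -
  have "x \<in> span {1}" for x :: real
    using span_scale[OF span_base[of "1::real" "{1}"], of x] by simp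
  then have "span {1::real} = UNIV" by blast
  then show ?thesis unfolding finite_dim_def by blast
qed

section \<open>Calculus of smooth maps\<close>

lemma frechet_derivativeI:
  assumes "(f has_derivative f') (at x)"
  shows "frechet_derivative f (at x) = f'"
  using frechet_derivative_at[OF assms] by simp

lemma Ck_on_continuous: "Ck_on k S f \<Longrightarrow> continuous_on S f"
  by (cases k) (auto simp: continuous_at_imp_continuous_on differentiable_imp_continuous_within)

lemma Ck_on_differentiable: "Ck_on (Suc k) S f \<Longrightarrow> x \<in> S \<Longrightarrow> f differentiable (at x)"
  by simp

lemma Ck_on_Suc_imp: "Ck_on (Suc k) S f \<Longrightarrow> Ck_on k S f"
proof (induction k arbitrary: f)
  case 0
  then show ?case using Ck_on_continuous[of "Suc 0"] by simp
next
  case (Suc k)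
  then show ?case by (metis Ck_on.simps(2))
qed

lemma Ck_on_subset: "Ck_on k S f \<Longrightarrow> T \<subseteq> S \<Longrightarrow> Ck_on k T f"
  by (induction k arbitrary: f) (auto intro: continuous_on_subset)

text \<open>Openness of \<open>S\<close> matters because \<open>frechet_derivative\<close> at a
  point refers to a full neighbourhood of it.\<close>

lemma Ck_on_cong:
  assumes "open S" "\<And>x. x \<in> S \<Longrightarrow> f x = g x" "Ck_on k S f"
  shows "Ck_on k S g"
  using assms(2,3)
proof (induction k arbitrary: f g)
  case 0
  then show ?case using continuous_on_cong by (metis Ck_on.simps(1))
next
  case (Suc k)
  have d: "(g has_derivative frechet_derivative f (at x)) (at x)" if "x \<in> S" for x
    using Suc.prems that assms(1)
    by (meson Ck_on.simps(2) frechet_derivative_works has_derivative_transform_within_open)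
  have "Ck_on k S (\<lambda>x. frechet_derivative g (at x) v)" for v
  proof (rule Suc.IH)
    show "Ck_on k S (\<lambda>x. frechet_derivative f (at x) v)" using Suc.prems by simp
  qed (simp add: frechet_derivativeI[OF d])
  then show ?case using d by (auto simp: differentiable_def)
qed

lemma Ck_on_local:
  assumes "\<And>x. x \<in> S \<Longrightarrow> \<exists>U. open U \<and> x \<in> U \<and> Ck_on k U f"
  shows "Ck_on k S f"
  using assms
proof (induction k arbitrary: f)
  case 0
  then show ?case
    by (metis Ck_on.simps(1) continuous_at_imp_continuous_on continuous_on_eq_continuous_at)
next
  case (Suc k)
  then show ?case by (metis Ck_on.simps(2))
qed

lemma Ck_on_const: "Ck_on k S (\<lambda>x. c)"
  by (induction k arbitrary: c) auto


text \<open>Lets a derivative be supplied by an explicit formula instead of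
  \<open>frechet_derivative\<close>; the proofs for sums, products, inverses and compositions all go
  through it.\<close>

lemma Ck_on_SucI:
  assumes "open S" "\<And>x. x \<in> S \<Longrightarrow> (f has_derivative f' x) (at x)" "\<And>v. Ck_on k S (\<lambda>x. f' x v)"
  shows "Ck_on (Suc k) S f"
proof -
  have "Ck_on k S (\<lambda>x. frechet_derivative f (at x) v)" for v
    by (rule Ck_on_cong[OF assms(1) _ assms(3)[of v]]) (simp add: frechet_derivativeI[OF assms(2)])
  then show ?thesis using assms(2) by (auto simp: differentiable_def)
qed

lemma Ck_on_SucD:
  assumes "Ck_on (Suc k) S f" "x \<in> S"
  shows "(f has_derivative frechet_derivative f (at x)) (at x)"
  using assms by (simp add: frechet_derivative_works)

lemma Ck_on_linear_compose:
  assumes "open S" "bounded_linear L" "Ck_on k S f"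
  shows "Ck_on k S (\<lambda>x. L (f x))"
  using assms(3)
proof (induction k arbitrary: f)
  case 0
  then show ?case using assms(2) by (simp add: bounded_linear.continuous_on)
next
  case (Suc k)
  show ?case
  proof (rule Ck_on_SucI[OF assms(1)])
    show "((\<lambda>x. L (f x)) has_derivative (\<lambda>v. L (frechet_derivative f (at x) v))) (at x)" if "x \<in> S"
      for x
      by (rule bounded_linear.has_derivative[OF assms(2) Ck_on_SucD[OF Suc.prems that]])
  qed (use Suc in simp)
qed

lemma Ck_on_bounded_linear:
  assumes "open S" "bounded_linear L"
  shows "Ck_on k S L"
proof (cases k)
  case 0
  then show ?thesis using assms by (simp add: linear_continuous_on)
next
  case (Suc n)
  show ?thesis unfolding Suc
    by (rule Ck_on_SucI[OF assms(1) bounded_linear_imp_has_derivative[OF assms(2)] Ck_on_const])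
qed

lemma Ck_on_add:
  assumes "open S" "Ck_on k S f" "Ck_on k S g"
  shows "Ck_on k S (\<lambda>x. f x + g x)"
  using assms(2,3)
proof (induction k arbitrary: f g)
  case 0
  then show ?case by (simp add: continuous_on_add)
next
  case (Suc k)
  show ?case
    by (rule Ck_on_SucI[OF assms(1) has_derivative_add[OF Ck_on_SucD[OF Suc.prems(1)] Ck_on_SucD[OF
      Suc.prems(2)]]])
      (use Suc in simp_all)
qed

lemma Ck_on_scaleR:
  fixes c :: "'a::real_normed_vector \<Rightarrow> real"
  assumes "open S" "Ck_on k S c" "Ck_on k S g"
  shows "Ck_on k S (\<lambda>x. c x *\<^sub>R g x)"
  using assms(2,3)
proof (induction k arbitrary: c g)
  case 0
  then show ?case by (simp add: continuous_on_scaleR)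
next
  case (Suc k)
  have mono: "Ck_on k S c" "Ck_on k S g" using Suc.prems Ck_on_Suc_imp by blast+
  show ?case
  proof (rule Ck_on_SucI[OF assms(1) has_derivative_scaleR[OF Ck_on_SucD[OF Suc.prems(1)]
    Ck_on_SucD[OF Suc.prems(2)]]])
    show "Ck_on k S (\<lambda>x. c x *\<^sub>R frechet_derivative g (at x) v + frechet_derivative c (at x) v *\<^sub>R g
      x)" for v
      using Suc.prems by (intro Ck_on_add[OF assms(1)] Suc.IH mono) simp_all
  qed
qed

text \<open>The derivative of the inverse contains the inverse itself, whose regularity of one order
  less is the induction hypothesis.\<close>

lemma Ck_on_inverse:
  fixes f :: "'a::real_normed_vector \<Rightarrow> real"
  assumes "open S" "Ck_on k S f" "\<And>x. x \<in> S \<Longrightarrow> f x \<noteq> 0"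
  shows "Ck_on k S (\<lambda>x. inverse (f x))"
  using assms(2)
proof (induction k)
  case 0
  then show ?case using assms(3) by (simp add: continuous_on_inverse)
next
  case (Suc k)
  have i: "Ck_on k S (\<lambda>x. inverse (f x))" by (rule Suc.IH[OF Ck_on_Suc_imp[OF Suc.prems]])
  show ?case
  proof (rule Ck_on_SucI[OF assms(1)])
    show "((\<lambda>x. inverse (f x)) has_derivative
        (\<lambda>v. - (inverse (f x) * frechet_derivative f (at x) v * inverse (f x)))) (at x)" if "x \<in>
          S" for x
      by (rule Deriv.has_derivative_inverse[OF assms(3)[OF that] Ck_on_SucD[OF Suc.prems that]])
    fix v
    have "Ck_on k S (\<lambda>x. frechet_derivative f (at x) v)" using Suc.prems by simp
    then have "Ck_on k S (\<lambda>x. frechet_derivative f (at x) v *\<^sub>R inverse (f x))"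
      using i by (rule Ck_on_scaleR[OF assms(1)])
    with i have "Ck_on k S (\<lambda>x. inverse (f x) *\<^sub>R (frechet_derivative f (at x) v *\<^sub>R inverse
      (f x)))"
      by (rule Ck_on_scaleR[OF assms(1)])
    with Ck_on_const have "Ck_on k S (\<lambda>x. (-1) *\<^sub>R (inverse (f x) *\<^sub>R (frechet_derivative f (at x) v
      *\<^sub>R inverse (f x))))"
      by (rule Ck_on_scaleR[OF assms(1)])
    then show "Ck_on k S (\<lambda>x. - (inverse (f x) * frechet_derivative f (at x) v * inverse (f x)))"
      by (simp add: mult.assoc)
  qed
qed

lemma Ck_on_sum:
  assumes "open S" "\<And>i. i \<in> I \<Longrightarrow> Ck_on k S (f i)"
  shows "Ck_on k S (\<lambda>x. \<Sum>i\<in>I. f i x)"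
  using assms(2)
  by (induction I rule: infinite_finite_induct) (auto intro: Ck_on_const Ck_on_add[OF assms(1)])

text \<open>The derivative of the composition evaluates the derivative of \<open>f\<close> on a
  vector that moves with the point. Expanding this vector in coordinates leaves derivatives of
  \<open>f\<close> in the fixed directions \<open>e i\<close>, composed with \<open>g\<close>, times
  scalar functions; to these the induction hypothesis applies.\<close>

lemma Ck_on_compose:
  fixes g :: "'a::real_normed_vector \<Rightarrow> 'b::real_normed_vector"
  assumes "finite_dim TYPE('b)" "open S" "open T" "Ck_on k T f" "Ck_on k S g" "g ` S \<subseteq> T"
  shows "Ck_on k S (\<lambda>x. f (g x))"
proof -
  obtain r and e :: "nat \<Rightarrow> 'b" and \<kappa> where cs: "coord_system r e \<kappa>"
    using coord_system_exists[OF assms(1)] .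
  show ?thesis
    using assms(4,5)
  proof (induction k arbitrary: f)
    case 0
    then show ?case using continuous_on_compose2[of T f S g] assms(6) by simp
  next
    case (Suc k)
    show ?case
    proof (rule Ck_on_SucI[OF assms(2)])
      fix x assume x: "x \<in> S"
      let ?Dg = "frechet_derivative g (at x)" and ?Df = "frechet_derivative f (at (g x))"
      have f: "(f has_derivative ?Df) (at (g x))"
        using x assms(6) by (intro Ck_on_SucD[OF Suc.prems(1)]) auto
      have "((\<lambda>x. f (g x)) has_derivative (\<lambda>v. ?Df (?Dg v))) (at x)"
        using has_derivative_compose[OF Ck_on_SucD[OF Suc.prems(2) x] f] .
      moreover have "(\<lambda>v. ?Df (?Dg v)) = (\<lambda>v. \<Sum>i<r. \<kappa> i (?Dg v) *\<^sub>R ?Df (e i))"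
      proof
        fix v
        let ?w = "?Dg v"
        have l: "linear ?Df" using has_derivative_linear[OF f] .
        have "?Df ?w = ?Df (\<Sum>i<r. \<kappa> i ?w *\<^sub>R e i)" by (simp add: coord_systemD(2)[OF cs])
        also have "\<dots> = (\<Sum>i<r. \<kappa> i ?w *\<^sub>R ?Df (e i))" by (simp add: linear_sum[OF l] linear_cmul[OF
          l])
        finally show "?Df ?w = (\<Sum>i<r. \<kappa> i ?w *\<^sub>R ?Df (e i))" .
      qed
      ultimately show "((\<lambda>x. f (g x)) has_derivative (\<lambda>v. \<Sum>i<r. \<kappa> i (?Dg v) *\<^sub>R ?Df (e i))) (at x)"
        by (rule back_subst[of "\<lambda>F. ((\<lambda>x. f (g x)) has_derivative F) (at x)"])
    next
      fix v
      show "Ck_on k S (\<lambda>x. \<Sum>i<r. \<kappa> i (frechet_derivative g (at x) v) *\<^sub>R frechet_derivative f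
        (at (g x)) (e i))"
      proof (intro Ck_on_sum[OF assms(2)] Ck_on_scaleR[OF assms(2)])
        fix i assume "i \<in> {..<r}"
        then show "Ck_on k S (\<lambda>x. \<kappa> i (frechet_derivative g (at x) v))"
          using Suc.prems(2) by (intro Ck_on_linear_compose[OF assms(2) coord_systemD(1)[OF cs]])
            auto
        have "Ck_on k S g" using Suc.prems(2) Ck_on_Suc_imp by blast
        then show "Ck_on k S (\<lambda>x. frechet_derivative f (at (g x)) (e i))"
          using Suc.prems(1) by (intro Suc.IH) simp
      qed
    qed
  qed
qed

lemma smooth_onD: "smooth_on S f \<Longrightarrow> Ck_on k S f"
  by (simp add: smooth_on_def)

lemma smooth_on_subset: "smooth_on S f \<Longrightarrow> T \<subseteq> S \<Longrightarrow> smooth_on T f"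
  unfolding smooth_on_def using Ck_on_subset by blast

lemma smooth_on_cong:
  "open S \<Longrightarrow> (\<And>x. x \<in> S \<Longrightarrow> f x = g x) \<Longrightarrow> smooth_on S f \<Longrightarrow> smooth_on S g"
  unfolding smooth_on_def using Ck_on_cong by blast

lemma smooth_on_local:
  assumes "\<And>x. x \<in> S \<Longrightarrow> \<exists>U. open U \<and> x \<in> U \<and> smooth_on U f"
  shows "smooth_on S f"
  unfolding smooth_on_def using assms by (meson Ck_on_local smooth_onD)

lemma smooth_on_differentiable:
  assumes "smooth_on S f" "x \<in> S"
  shows "f differentiable (at x)"
  using Ck_on_differentiable[OF smooth_onD[OF assms(1)] assms(2)] .

lemma smooth_on_continuous: "smooth_on S f \<Longrightarrow> continuous_on S f"
  using Ck_on_continuous smooth_onD by blast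

lemma smooth_on_frechet_derivative:
  "smooth_on S f \<Longrightarrow> smooth_on S (\<lambda>x. frechet_derivative f (at x) v)"
  unfolding smooth_on_def by (metis Ck_on.simps(2))

lemma smooth_on_const: "smooth_on S (\<lambda>x. c)"
  by (simp add: smooth_on_def Ck_on_const)

lemma smooth_on_bounded_linear: "open S \<Longrightarrow> bounded_linear L \<Longrightarrow> smooth_on S L"
  by (simp add: smooth_on_def Ck_on_bounded_linear)

lemma smooth_on_linear_compose:
  "open S \<Longrightarrow> bounded_linear L \<Longrightarrow> smooth_on S f \<Longrightarrow> smooth_on S (\<lambda>x. L (f x))"
  by (simp add: smooth_on_def Ck_on_linear_compose)

lemma smooth_on_add:
  "open S \<Longrightarrow> smooth_on S f \<Longrightarrow> smooth_on S g \<Longrightarrow> smooth_on S (\<lambda>x. f x + g x)"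
  by (simp add: smooth_on_def Ck_on_add)

lemma smooth_on_scaleR:
  fixes c :: "'a::real_normed_vector \<Rightarrow> real"
  shows "open S \<Longrightarrow> smooth_on S c \<Longrightarrow> smooth_on S g \<Longrightarrow> smooth_on S (\<lambda>x. c x *\<^sub>R g x)"
  by (simp add: smooth_on_def Ck_on_scaleR)

lemma smooth_on_sum:
  "open S \<Longrightarrow> (\<And>i. i \<in> I \<Longrightarrow> smooth_on S (f i)) \<Longrightarrow> smooth_on S (\<lambda>x. \<Sum>i\<in>I. f i x)"
  by (simp add: smooth_on_def Ck_on_sum)

lemma smooth_on_compose:
  fixes g :: "'a::real_normed_vector \<Rightarrow> 'b::real_normed_vector"
  assumes "finite_dim TYPE('b)" "open S" "open T" "smooth_on T f" "smooth_on S g" "g ` S \<subseteq> T"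
  shows "smooth_on S (\<lambda>x. f (g x))"
  unfolding smooth_on_def
  using Ck_on_compose[OF assms(1-3) smooth_onD[OF assms(4)] smooth_onD[OF assms(5)] assms(6)]
    by blast

section \<open>Bump functions on normed spaces\<close>

text \<open>For \<open>n = 0\<close> this is the classical function that is flat at 0. The powers of
  the inverse are included because the family is then closed under differentiation, up to linear
  combinations.\<close>

definition flat_exp :: "nat \<Rightarrow> real \<Rightarrow> real"
  where "flat_exp n t = (if t > 0 then inverse t ^ n * exp (- inverse t) else 0)"

lemma flat_exp_has_derivative:
  "(flat_exp n has_real_derivative (flat_exp (n + 2) t - real n * flat_exp (n + 1) t)) (at t)"
proof -
  consider "t > 0" | "t < 0" | "t = 0" by linarith
  then show ?thesis
  proof cases
    case 1
    have "((\<lambda>t. inverse t ^ n * exp (- inverse t)) has_real_derivative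
        (flat_exp (n + 2) t - real n * flat_exp (n + 1) t)) (at t)"
    proof -
      have d: "((\<lambda>t. inverse t) has_real_derivative - (inverse t * inverse t)) (at t)"
        using DERIV_inverse[of t] 1 by (simp add: power2_eq_square)
      from DERIV_mult[OF DERIV_power[OF d, of n] DERIV_fun_exp[OF DERIV_minus[OF d]]] show ?thesis
        by (rule DERIV_cong) (use 1 in \<open>cases n; simp add: flat_exp_def algebra_simps\<close>)
    qed
    then show ?thesis
      by (rule has_field_derivative_transform_within_open[where S = "{0<..}"])
        (use 1 in \<open>auto simp: flat_exp_def\<close>)
  next
    case 2
    have "((\<lambda>t. 0) has_real_derivative (flat_exp (n + 2) t - real n * flat_exp (n + 1) t)) (at t)"
      using 2 by (simp add: flat_exp_def)
    then show ?thesis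
      by (rule has_field_derivative_transform_within_open[where S = "{..<0}"])
        (use 2 in \<open>auto simp: flat_exp_def\<close>)
  next
    case 3
    \<comment> \<open>At 0 the difference quotient from the right is a power of the inverse divided
      by an exponential of the inverse, hence tends to 0. From the left it is identically 0.\<close>
    have "((\<lambda>h. inverse h ^ Suc n / exp (inverse h)) \<longlongrightarrow> 0) (at_right (0::real))"
      by (rule filterlim_compose[OF tendsto_power_div_exp_0 filterlim_inverse_at_top_right])
    then have "((\<lambda>h. flat_exp n h / h) \<longlongrightarrow> 0) (at_right 0)"
    proof (rule Lim_transform_eventually)
      show "\<forall>\<^sub>F h in at_right 0. inverse h ^ Suc n / exp (inverse h) = flat_exp n h / h"
        using eventually_at_right_less[of "0::real"]
        by eventually_elim (simp add: flat_exp_def exp_minus field_simps)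
    qed
    moreover have "((\<lambda>h. flat_exp n h / h) \<longlongrightarrow> 0) (at_left 0)"
    proof (rule Lim_transform_eventually)
      show "((\<lambda>h::real. 0::real) \<longlongrightarrow> 0) (at_left 0)" by simp
      show "\<forall>\<^sub>F h in at_left 0. 0 = flat_exp n h / h"
        by (simp add: eventually_at_filter flat_exp_def)
    qed
    ultimately have "((\<lambda>h. flat_exp n h / h) \<longlongrightarrow> 0) (at 0)"
      by (simp add: filterlim_at_split)
    then show ?thesis using 3 by (simp add: DERIV_def flat_exp_def)
  qed
qed

text \<open>The induction on the order runs over all \<open>n\<close> at once, since differentiation
  raises the index.\<close>

lemma smooth_flat_exp: "smooth_on UNIV (flat_exp n)"
proof -
  have "\<forall>n. Ck_on k UNIV (flat_exp n)" for k
  proof (induction k)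
    case 0
    have "continuous_on UNIV (flat_exp n)" for n
      using flat_exp_has_derivative by (intro DERIV_continuous_on) blast
    then show ?case by simp
  next
    case (Suc k)
    have "Ck_on (Suc k) UNIV (flat_exp n)" for n
    proof (rule Ck_on_SucI)
      show "(flat_exp n has_derivative
          (\<lambda>v. v *\<^sub>R (flat_exp (n + 2) t + (- real n) *\<^sub>R flat_exp (n + 1) t))) (at t)" for t
        using flat_exp_has_derivative[of n t] by (simp add: has_field_derivative_def
          mult_commute_abs)
      show "Ck_on k UNIV (\<lambda>t. v *\<^sub>R (flat_exp (n + 2) t + (- real n) *\<^sub>R flat_exp (n + 1) t))" for v
        by (rule Ck_on_scaleR[OF open_UNIV Ck_on_const
              Ck_on_add[OF open_UNIV Suc[rule_format] Ck_on_scaleR[OF open_UNIV Ck_on_const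
                Suc[rule_format]]]])
    qed simp
    then show ?case by blast
  qed
  then show ?thesis by (simp add: smooth_on_def)
qed

definition unit_step :: "real \<Rightarrow> real"
  where "unit_step t = flat_exp 0 t * inverse (flat_exp 0 t + flat_exp 0 (1 - t))"

lemma unit_step_simps: "t \<le> 0 \<Longrightarrow> unit_step t = 0" "t \<ge> 1 \<Longrightarrow> unit_step t = 1"
  by (auto simp: unit_step_def flat_exp_def)

lemma smooth_flat_exp_affine: "smooth_on UNIV (\<lambda>t. flat_exp n (c + d *\<^sub>R t))"
proof (rule smooth_on_compose[OF finite_dim_real open_UNIV open_UNIV smooth_flat_exp])
  show "smooth_on UNIV (\<lambda>t. c + d *\<^sub>R t)"
    by (rule smooth_on_add[OF open_UNIV smooth_on_const
          smooth_on_bounded_linear[OF open_UNIV bounded_linear_scaleR_right]])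
qed simp

lemma smooth_unit_step: "smooth_on UNIV unit_step"
proof -
  have "smooth_on UNIV (\<lambda>t. inverse (flat_exp 0 t + flat_exp 0 (1 + (-1) *\<^sub>R t)))"
  proof -
    have s: "smooth_on UNIV (\<lambda>t. flat_exp 0 t + flat_exp 0 (1 + (-1) *\<^sub>R t))"
      by (rule smooth_on_add[OF open_UNIV smooth_flat_exp smooth_flat_exp_affine])
    \<comment> \<open>The numbers \<open>t\<close> and \<open>1 - t\<close> are never both
      nonpositive, so one of the two summands is positive and the other is nonnegative.\<close>
    have ne: "flat_exp 0 t + flat_exp 0 (1 + (-1) *\<^sub>R t) \<noteq> 0" for t
    proof -
      have "t > 0 \<or> 1 - t > 0" by linarith
      then have "flat_exp 0 t + flat_exp 0 (1 - t) > 0"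
        by (auto simp: flat_exp_def add_pos_pos)
      then show ?thesis by simp
    qed
    show ?thesis unfolding smooth_on_def
      using Ck_on_inverse[OF open_UNIV smooth_onD[OF s] ne] by blast
  qed
  from smooth_on_scaleR[OF open_UNIV smooth_flat_exp[of 0] this]
  show ?thesis by (simp add: unit_step_def[abs_def])
qed

lemma smooth_on_prod:
  fixes f :: "'i \<Rightarrow> 'a::real_normed_vector \<Rightarrow> real"
  assumes "open S" "\<And>i. i \<in> I \<Longrightarrow> smooth_on S (f i)"
  shows "smooth_on S (\<lambda>x. \<Prod>i\<in>I. f i x)"
  using assms(2)
proof (induction I rule: infinite_finite_induct)
  case (insert i I)
  have "smooth_on S (\<lambda>x. f i x *\<^sub>R (\<Prod>i\<in>I. f i x))"
    by (rule smooth_on_scaleR[OF assms(1)]) (use insert in auto)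
  then show ?case using insert by simp
qed (simp_all add: smooth_on_const)

definition plateau :: "real \<Rightarrow> real"
  where "plateau t = unit_step (2 - t) * unit_step (2 + t)"

lemma plateau_simps: "\<bar>t\<bar> \<le> 1 \<Longrightarrow> plateau t = 1" "\<bar>t\<bar> \<ge> 2 \<Longrightarrow> plateau t = 0"
  by (cases "t \<ge> 0"; simp add: plateau_def unit_step_simps)+

lemma smooth_plateau: "smooth_on UNIV plateau"
proof -
  have aff: "smooth_on UNIV (\<lambda>t. unit_step (2 + d *\<^sub>R t))" for d
  proof (rule smooth_on_compose[OF finite_dim_real open_UNIV open_UNIV smooth_unit_step])
    show "smooth_on UNIV (\<lambda>t. 2 + d *\<^sub>R t)"
      by (rule smooth_on_add[OF open_UNIV smooth_on_const
            smooth_on_bounded_linear[OF open_UNIV bounded_linear_scaleR_right]])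
  qed simp
  from smooth_on_scaleR[OF open_UNIV aff[of "-1"] aff[of 1]]
  show ?thesis unfolding plateau_def by simp
qed

text \<open>A product of one-variable plateaus in the coordinates vanishes outside a coordinate
  cube. For \<open>r = 0\<close> the empty product is 1 and the cube is the whole space.\<close>

lemma bump_exists:
  fixes x :: "'a::real_normed_vector"
  assumes "finite_dim TYPE('a)" "open U" "x \<in> U"
  obtains \<phi> :: "'a \<Rightarrow> real" and K V where "smooth_on UNIV \<phi>" "compact K" "K \<subseteq> U"
    "\<And>y. y \<notin> K \<Longrightarrow> \<phi> y = 0" "open V" "x \<in> V" "\<And>y. y \<in> V \<Longrightarrow> \<phi> y = 1"
proof -
  obtain r and e :: "nat \<Rightarrow> 'a" and \<kappa> where cs: "coord_system r e \<kappa>"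
    using coord_system_exists[OF assms(1)] .
  obtain d where d: "d > 0" "ball x d \<subseteq> U" using assms(2,3) open_contains_ball by blast
  \<comment> \<open>A vector in the cube of half-width \<open>2 * \<epsilon>\<close> has norm at
    most \<open>2 * \<epsilon> * (\<Sum>i<r. norm (e i))\<close>, which is less than
    \<open>d\<close>. The summand 1 keeps the denominator positive.\<close>
  define \<epsilon> where "\<epsilon> = d / (2 * (1 + (\<Sum>i<r. norm (e i))))"
  have s0: "0 \<le> (\<Sum>i<r. norm (e i))" by (simp add: sum_nonneg)
  have \<epsilon>: "\<epsilon> > 0" unfolding \<epsilon>_def using d(1) s0 by (intro divide_pos_pos) auto
  define \<phi> where "\<phi> y = (\<Prod>i<r. plateau (\<kappa> i (y - x) / \<epsilon>))" for y
  define K where "K = (+) x ` {v. \<forall>i<r. \<bar>\<kappa> i v\<bar> \<le> 2 * \<epsilon>}"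
  define V where "V = (\<Inter>i\<in>{..<r}. {y. \<bar>\<kappa> i (y - x)\<bar> < \<epsilon>})"
  note bl = coord_systemD(1)[OF cs]
  show thesis
  proof (rule that)
    show "smooth_on UNIV \<phi>"
      unfolding \<phi>_def
    proof (rule smooth_on_prod[OF open_UNIV])
      fix i assume "i \<in> {..<r}"
      then have i: "bounded_linear (\<kappa> i)" using bl by simp
      have "smooth_on UNIV (\<lambda>y. \<kappa> i y / \<epsilon> + (- \<kappa> i x / \<epsilon>))"
        by (rule smooth_on_add[OF open_UNIV smooth_on_bounded_linear[OF open_UNIV
              bounded_linear_compose[OF bounded_linear_divide i]] smooth_on_const])
      then have "smooth_on UNIV (\<lambda>y. \<kappa> i (y - x) / \<epsilon>)"
        by (simp add: linear_diff[OF bounded_linear.linear[OF i]] diff_divide_distrib)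
      then show "smooth_on UNIV (\<lambda>y. plateau (\<kappa> i (y - x) / \<epsilon>))"
        by (rule smooth_on_compose[OF finite_dim_real open_UNIV open_UNIV smooth_plateau]) simp
    qed
    show "compact K" unfolding K_def
      by (rule compact_translation[OF compact_coord_cube[OF cs]])
    show "K \<subseteq> U"
    proof
      fix y assume "y \<in> K"
      then obtain v where y: "y = x + v" and v: "\<And>i. i < r \<Longrightarrow> \<bar>\<kappa> i v\<bar> \<le> 2 * \<epsilon>" unfolding K_def
        by blast
      have "norm v = norm (\<Sum>i<r. \<kappa> i v *\<^sub>R e i)" by (simp add: coord_systemD(2)[OF cs])
      also have "\<dots> \<le> (\<Sum>i<r. 2 * \<epsilon> * norm (e i))"
        by (rule sum_norm_le) (use v in \<open>auto intro!: mult_right_mono\<close>)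
      also have "\<dots> = 2 * \<epsilon> * (\<Sum>i<r. norm (e i))" by (simp add: sum_distrib_left)
      also have "\<dots> < 2 * \<epsilon> * (1 + (\<Sum>i<r. norm (e i)))" using \<epsilon> by simp
      also have "\<dots> = d"
      proof -
        have "2 * (d / (2 * (1 + s))) * (1 + s) = d" if "0 \<le> s" for s :: real
          using that by (simp add: field_simps)
        then show ?thesis unfolding \<epsilon>_def using s0 .
      qed
      finally show "y \<in> U" using d(2) y by (auto simp: dist_norm)
    qed
    show "\<phi> y = 0" if "y \<notin> K" for y
    proof -
      have "y - x \<notin> {v. \<forall>i<r. \<bar>\<kappa> i v\<bar> \<le> 2 * \<epsilon>}"
        using that unfolding K_def by (metis (no_types, lifting) add_diff_cancel_left'
          diff_add_cancel add.commute image_eqI)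
      then obtain i where i: "i < r" "2 * \<epsilon> < \<bar>\<kappa> i (y - x)\<bar>" by (auto simp: not_le)
      then have "\<bar>\<kappa> i (y - x) / \<epsilon>\<bar> \<ge> 2" using \<epsilon> by (simp add: field_simps)
      then have "plateau (\<kappa> i (y - x) / \<epsilon>) = 0" by (rule plateau_simps(2))
      then show ?thesis unfolding \<phi>_def using i(1) by (intro prod_zero) auto
    qed
    show "open V" unfolding V_def
    proof (intro open_INT ballI)
      fix i assume "i \<in> {..<r}"
      then have "continuous_on UNIV (\<lambda>y. \<kappa> i (y - x))"
        using bl[of i] by (intro bounded_linear.continuous_on[of "\<kappa> i"] continuous_intros) auto
      then show "open {y. \<bar>\<kappa> i (y - x)\<bar> < \<epsilon>}"
        by (intro open_Collect_less continuous_intros)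
    qed simp
    show "x \<in> V" unfolding V_def using \<epsilon> by (auto simp: linear_0[OF bounded_linear.linear[OF bl]])
    show "\<phi> y = 1" if "y \<in> V" for y
      unfolding \<phi>_def
    proof (intro prod.neutral ballI plateau_simps(1))
      fix i assume "i \<in> {..<r}"
      then have "\<bar>\<kappa> i (y - x)\<bar> < \<epsilon>" using that unfolding V_def by blast
      then show "\<bar>\<kappa> i (y - x) / \<epsilon>\<bar> \<le> 1" using \<epsilon> by (simp add: field_simps)
    qed
  qed
qed

section \<open>Integrals depending on parameters\<close>

text \<open>Continuity of the partial derivatives is uniform in \<open>t\<close> by compactness of
  the interval, and it becomes uniform in the direction by expansion in coordinates; the mean value
  inequality then controls the remainder. The second claim reduces an arbitrary direction to the
  \<open>e i\<close>, as an induction on the order requires.\<close>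

lemma integral_has_derivative:
  fixes F :: "real \<times> 'a::real_normed_vector \<Rightarrow> real"
  assumes "coord_system r e \<kappa>" "open S" "Ck_on (Suc 0) (UNIV \<times> S) F" "x \<in> S"
  shows "((\<lambda>x. integral {0..1} (\<lambda>t. F (t, x))) has_derivative
    (\<lambda>h. integral {0..1} (\<lambda>t. frechet_derivative F (at (t, x)) (0, h)))) (at x)"
    and "integral {0..1} (\<lambda>t. frechet_derivative F (at (t, x)) (0, h)) =
      (\<Sum>i<r. \<kappa> i h *\<^sub>R integral {0..1} (\<lambda>t. frechet_derivative F (at (t, x)) (0, e i)))"
proof -
  define G where "G i y t = frechet_derivative F (at (t, y)) (0, e i)" for i y t
  define D where "D y t h = frechet_derivative F (at (t, y)) (0, h)" for y t h
  note bl = coord_systemD(1)[OF assms(1)]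
  have DF: "(F has_derivative frechet_derivative F (at (t, y))) (at (t, y))" if "y \<in> S" for t y
    by (rule Ck_on_SucD[OF assms(3)]) (use that in simp)
  have DG: "D y t h = (\<Sum>i<r. \<kappa> i h *\<^sub>R G i y t)" if "y \<in> S" for y t h
  proof -
    have l: "linear (\<lambda>h. frechet_derivative F (at (t, y)) (0, h))"
    proof -
      have "linear (\<lambda>h::'a. (0::real, h))" by (auto intro!: linearI)
      from linear_compose[OF this has_derivative_linear[OF DF[OF that]]] show ?thesis
        by (simp add: o_def)
    qed
    have "D y t h = D y t (\<Sum>i<r. \<kappa> i h *\<^sub>R e i)" by (simp add: coord_systemD(2)[OF assms(1)])
    also have "\<dots> = (\<Sum>i<r. \<kappa> i h *\<^sub>R G i y t)"
      unfolding D_def G_def linear_sum[OF l] linear_cmul[OF l] ..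
    finally show ?thesis .
  qed
  have contG: "continuous_on (S \<times> {0..1}) (\<lambda>(y, t). G i y t)" for i
  proof -
    have "continuous_on (UNIV \<times> S) (\<lambda>p. frechet_derivative F (at p) (0, e i))"
      using assms(3) by simp
    moreover have "continuous_on (S \<times> {0..1}) (\<lambda>p. (snd p, fst p))" by (intro continuous_intros)
    ultimately have "continuous_on (S \<times> {0..1}) (\<lambda>p. frechet_derivative F (at (snd p, fst p))
      (0, e i))"
      by (rule continuous_on_compose2) auto
    then show ?thesis unfolding G_def by (simp add: split_beta)
  qed
  have contGt: "continuous_on {0..1} (G i y)" if "y \<in> S" for i y
  proof -
    have "continuous_on {0..1} (\<lambda>t. (y, t))" by (intro continuous_intros)
    from continuous_on_compose2[OF contG this, of i] show ?thesis using that by auto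
  qed
  have contF: "continuous_on {0..1} (\<lambda>t. F (t, y))" if "y \<in> S" for y
  proof -
    have "continuous_on {0..1} (\<lambda>t. (t, y))" by (intro continuous_intros)
    from continuous_on_compose2[OF Ck_on_continuous[OF assms(3)] this] show ?thesis using that
      by auto
  qed
  have contD: "continuous_on {0..1} (\<lambda>t. D x t h)" for h
    unfolding DG[OF assms(4)] using contGt[OF assms(4)] by (intro continuous_intros) auto
  let ?f' = "\<lambda>h. \<Sum>i<r. \<kappa> i h *\<^sub>R integral {0..1} (G i x)"
  have f': "?f' h = integral {0..1} (\<lambda>t. D x t h)" for h
    unfolding DG[OF assms(4)] using contGt[OF assms(4)]
    by (subst integral_sum) (auto intro!: integrable_continuous_interval continuous_intros)
  have "((\<lambda>x. integral {0..1} (\<lambda>t. F (t, x))) has_derivative ?f') (at x)"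
    unfolding has_derivative_at_alt
  proof (intro conjI allI impI)
    show "bounded_linear ?f'"
      by (intro bounded_linear_sum bounded_linear_compose[OF bounded_linear_scaleR_left bl]) simp
  next
    fix \<epsilon> :: real assume \<epsilon>: "\<epsilon> > 0"
    \<comment> \<open>\<open>C * norm h\<close> bounds the sum of the absolute values of the
      coordinates of \<open>h\<close>. Adding 1 in \<open>\<eta>\<close> avoids a division by
      zero.\<close>
    define C where "C = (\<Sum>i<r. onorm (\<kappa> i))"
    have C0: "C \<ge> 0" unfolding C_def by (intro sum_nonneg onorm_pos_le bl) simp
    define \<eta> where "\<eta> = \<epsilon> / (C + 1)"
    have \<eta>: "\<eta> > 0" using \<epsilon> C0 by (simp add: \<eta>_def)
    \<comment> \<open>One function collects the variation of all partial derivatives, so that a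
      single neighbourhood of \<open>x\<close> serves every \<open>i\<close> and every
      \<open>t\<close>.\<close>
    define g where "g = (\<lambda>(y, t). \<Sum>i<r. \<bar>G i y t - G i x t\<bar>)"
    have "continuous_on (S \<times> {0..1}) g"
    proof -
      have "continuous_on (S \<times> {0..1}) (\<lambda>p. G i x (snd p))" for i
        by (rule continuous_on_compose2[OF contGt[OF assms(4)]]) (auto intro!: continuous_intros)
      then show ?thesis unfolding g_def split_beta
        using contG by (intro continuous_intros) (auto simp: split_beta)
    qed
    then obtain X0 where X0: "x \<in> X0" "open X0"
      "\<forall>y\<in>X0 \<inter> S. \<forall>t\<in>{0..1}. dist (g (y, t)) (g (x, t)) \<le> \<eta>"
      by (rule continuous_on_prod_compactE[OF _ compact_Icc assms(4) \<eta>])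
    have "open (X0 \<inter> S)" "x \<in> X0 \<inter> S" using X0(1,2) assms(2,4) by auto
    then obtain \<delta> where \<delta>: "\<delta> > 0" "ball x \<delta> \<subseteq> X0 \<inter> S" by (rule openE)
    have diff: "\<bar>D y t h - D x t h\<bar> \<le> \<epsilon> * norm h" if y: "y \<in> ball x \<delta>" and t: "t \<in> {0..1}" for y t h
    proof -
      have yS: "y \<in> S" "y \<in> X0" using y \<delta>(2) by auto
      have "dist (g (y, t)) (g (x, t)) \<le> \<eta>" using X0(3) yS t by blast
      moreover have "g (x, t) = 0" by (simp add: g_def)
      ultimately have "g (y, t) \<le> \<eta>" by (simp add: dist_norm)
      moreover have "\<bar>G i y t - G i x t\<bar> \<le> g (y, t)" if "i < r" for i
        unfolding g_def using that by (auto intro!: member_le_sum)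
      ultimately have Gi: "\<bar>G i y t - G i x t\<bar> \<le> \<eta>" if "i < r" for i using that by fastforce
      have "D y t h - D x t h = (\<Sum>i<r. \<kappa> i h * (G i y t - G i x t))"
        unfolding DG[OF yS(1)] DG[OF assms(4)] by (simp add: sum_subtractf right_diff_distrib)
      also have "\<bar>\<dots>\<bar> \<le> (\<Sum>i<r. onorm (\<kappa> i) * norm h * \<eta>)"
      proof (rule order_trans[OF sum_abs], rule sum_mono)
        fix i assume i: "i \<in> {..<r}"
        have "\<bar>\<kappa> i h\<bar> \<le> onorm (\<kappa> i) * norm h" using onorm[OF bl, of i h] i by simp
        then show "\<bar>\<kappa> i h * (G i y t - G i x t)\<bar> \<le> onorm (\<kappa> i) * norm h * \<eta>"
          unfolding abs_mult using Gi[of i] i by (intro mult_mono) auto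
      qed
      also have "\<dots> = C * \<eta> * norm h" unfolding C_def by (simp add: sum_distrib_left
        sum_distrib_right ac_simps)
      also have "C * \<eta> \<le> \<epsilon>" unfolding \<eta>_def using C0 \<epsilon> by (simp add: field_simps)
      finally show ?thesis by (simp add: mult_right_mono)
    qed
    have "norm (integral {0..1} (\<lambda>t. F (t, y)) - integral {0..1} (\<lambda>t. F (t, x)) - ?f' (y - x))
        \<le> \<epsilon> * norm (y - x)" if y: "norm (y - x) < \<delta>" for y
    proof -
      have yb: "y \<in> ball x \<delta>" using y by (simp add: dist_norm norm_minus_commute)
      then have yS: "y \<in> S" using \<delta>(2) by blast
      have pt: "norm (F (t, y) - F (t, x) - D x t (y - x)) \<le> \<epsilon> * norm (y - x)" if t: "t \<in> {0..1}"
        for t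
      proof -
        \<comment> \<open>Subtracting the linear part at \<open>x\<close> leaves a function whose
          derivative has norm at most \<open>\<epsilon>\<close> on the whole ball.\<close>
        have "norm ((\<lambda>z. F (t, z) - D x t z) y - (\<lambda>z. F (t, z) - D x t z) x) \<le> \<epsilon> * norm (y - x)"
        proof (rule differentiable_bound[where S = "ball x \<delta>" and f' = "\<lambda>z h. D z t h - D x t h"])
          fix z assume z: "z \<in> ball x \<delta>"
          then have zS: "z \<in> S" using \<delta>(2) by blast
          have "((\<lambda>z. F (t, z)) has_derivative (\<lambda>h. D z t h)) (at z)"
          proof -
            have "((\<lambda>z. (t, z)) has_derivative (\<lambda>h. (0, h))) (at z)"
              by (intro has_derivative_Pair has_derivative_const has_derivative_ident)
            from has_derivative_compose[OF this DF[OF zS, of t]] show ?thesis unfolding D_def .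
          qed
          moreover have "bounded_linear (\<lambda>h. D x t h)"
            unfolding DG[OF assms(4)]
            by (intro bounded_linear_sum bounded_linear_compose[OF bounded_linear_scaleR_left bl])
              simp
          ultimately show "((\<lambda>z. F (t, z) - D x t z) has_derivative (\<lambda>h. D z t h - D x t h))
            (at z within ball x \<delta>)"
            by (intro has_derivative_at_withinI[OF has_derivative_diff]
              bounded_linear_imp_has_derivative)
          show "onorm (\<lambda>h. D z t h - D x t h) \<le> \<epsilon>"
            using diff[OF z t] \<epsilon> by (intro onorm_bound) auto
        qed (use yb \<delta>(1) in auto)
        moreover have "D x t y - D x t x = D x t (y - x)"
          unfolding DG[OF assms(4)] by (simp add: sum_subtractf[symmetric]
            left_diff_distrib[symmetric]
              linear_diff[OF bounded_linear.linear[OF bl]])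
        ultimately show ?thesis by (simp add: algebra_simps)
      qed
      have "integral {0..1} (\<lambda>t. F (t, y)) - integral {0..1} (\<lambda>t. F (t, x)) - ?f' (y - x)
          = integral {0..1} (\<lambda>t. F (t, y) - F (t, x) - D x t (y - x))"
        unfolding f' using contF[OF yS] contF[OF assms(4)] contD
        by (simp add: integral_diff integrable_continuous_interval continuous_on_diff)
      also have "norm \<dots> \<le> \<epsilon> * norm (y - x) * (1 - 0)"
        by (rule integral_bound)
          (use pt contF[OF yS] contF[OF assms(4)] contD in \<open>auto intro!: continuous_intros\<close>)
      finally show ?thesis by simp
    qed
    then show "\<exists>d>0. \<forall>y. norm (y - x) < d \<longrightarrow>
        norm (integral {0..1} (\<lambda>t. F (t, y)) - integral {0..1} (\<lambda>t. F (t, x)) - ?f' (y - x)) \<le> \<epsilon> *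
          norm (y - x)"
      using \<delta>(1) by blast
  qed
  then show "((\<lambda>x. integral {0..1} (\<lambda>t. F (t, x))) has_derivative
      (\<lambda>h. integral {0..1} (\<lambda>t. frechet_derivative F (at (t, x)) (0, h)))) (at x)"
    unfolding f' unfolding D_def .
  show "integral {0..1} (\<lambda>t. frechet_derivative F (at (t, x)) (0, h)) =
      (\<Sum>i<r. \<kappa> i h *\<^sub>R integral {0..1} (\<lambda>t. frechet_derivative F (at (t, x)) (0, e i)))"
    using f'[of h] unfolding D_def G_def by simp
qed

lemma Ck_on_le: "Ck_on m S f \<Longrightarrow> k \<le> m \<Longrightarrow> Ck_on k S f"
  by (induction m) (auto simp: le_Suc_eq dest: Ck_on_Suc_imp simp del: Ck_on.simps(2))

text \<open>The derivative of the integral is a finite sum of integrals of the partial derivatives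
  in the directions \<open>(0, e i)\<close>, to which the induction hypothesis applies.\<close>

lemma Ck_on_integral:
  fixes F :: "real \<times> 'a::real_normed_vector \<Rightarrow> real"
  assumes "finite_dim TYPE('a)" "open S" "Ck_on k (UNIV \<times> S) F"
  shows "Ck_on k S (\<lambda>x. integral {0..1} (\<lambda>t. F (t, x)))"
proof -
  obtain r and e :: "nat \<Rightarrow> 'a" and \<kappa> where cs: "coord_system r e \<kappa>"
    using coord_system_exists[OF assms(1)] .
  show ?thesis
    using assms(3)
  proof (induction k arbitrary: F)
    case 0
    have "continuous_on (S \<times> {0..1}) (\<lambda>p. (snd p, fst p))" by (intro continuous_intros)
    with Ck_on_continuous[OF 0] have "continuous_on (S \<times> {0..1}) (\<lambda>p. F (snd p, fst p))"
      by (rule continuous_on_compose2) auto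
    then have "continuous_on (S \<times> cbox 0 1) (\<lambda>(x, t). F (t, x))" by (simp add: split_beta)
    from integral_continuous_on_param[OF this] show ?case by simp
  next
    case (Suc k)
    have C1: "Ck_on (Suc 0) (UNIV \<times> S) F" by (rule Ck_on_le[OF Suc.prems]) simp
    show ?case
    proof (rule Ck_on_SucI[OF assms(2) integral_has_derivative(1)[OF cs assms(2) C1]])
      fix v
      have "Ck_on k S (\<lambda>x. \<Sum>i<r. \<kappa> i v *\<^sub>R integral {0..1} (\<lambda>t. frechet_derivative F (at (t, x))
        (0, e i)))"
        by (rule Ck_on_sum[OF assms(2)], rule Ck_on_scaleR[OF assms(2) Ck_on_const], rule Suc.IH)
          (use Suc.prems in simp)
      then show "Ck_on k S (\<lambda>x. integral {0..1} (\<lambda>t. frechet_derivative F (at (t, x)) (0, v)))"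
        by (rule Ck_on_cong[OF assms(2), rotated]) (simp add: integral_has_derivative(2)[OF cs
          assms(2) C1, of _ v])
    qed
  qed
qed

section \<open>Smooth functions on manifolds\<close>

lemma smooth_on_Pair:
  assumes "open S" "smooth_on S f" "smooth_on S g"
  shows "smooth_on S (\<lambda>x. (f x, g x))"
proof -
  have "smooth_on S (\<lambda>x. (f x, 0) + (0, g x))"
    by (rule smooth_on_add[OF assms(1)
          smooth_on_linear_compose[OF assms(1) bounded_linear_Pair[OF bounded_linear_ident
            bounded_linear_zero] assms(2)]
          smooth_on_linear_compose[OF assms(1) bounded_linear_Pair[OF bounded_linear_zero
            bounded_linear_ident] assms(3)]])
  then show ?thesis by simp
qed

lemma is_chartD:
  assumes "is_chart c"
  shows "open (fst c)" "open (snd c ` fst c)" "continuous_on (fst c) (snd c)"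
    "continuous_on (snd c ` fst c) (chart_inv c)"
    "x \<in> fst c \<Longrightarrow> chart_inv c (snd c x) = x"
    "y \<in> snd c ` fst c \<Longrightarrow> snd c (chart_inv c y) = y"
    "y \<in> snd c ` fst c \<Longrightarrow> chart_inv c y \<in> fst c"
  using assms unfolding is_chart_def homeomorphism_def by auto

lemma chart_image_eq:
  assumes "is_chart c"
  shows "snd c ` (fst c \<inter> W) = snd c ` fst c \<inter> chart_inv c -` W"
  using is_chartD(5,6,7)[OF assms] by (auto intro!: rev_image_eqI)

lemma open_chart_image:
  assumes "is_chart c" "open W"
  shows "open (snd c ` (fst c \<inter> W))"
  unfolding chart_image_eq[OF assms(1)]
  by (rule continuous_open_preimage[OF is_chartD(4)[OF assms(1)] is_chartD(2)[OF assms(1)]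
    assms(2)])

lemma smooth_manifoldD:
  fixes M :: "('m::{t2_space, second_countable_topology}, 'e::real_normed_vector) chart set"
  assumes "smooth_manifold M"
  shows "finite_dim TYPE('e)" "\<exists>c\<in>M. x \<in> fst c" "c \<in> M \<Longrightarrow> is_chart c"
    "c \<in> M \<Longrightarrow> d \<in> M \<Longrightarrow> smooth_on (snd c ` (fst c \<inter> fst d)) (snd d \<circ> chart_inv c)"
  using assms unfolding smooth_manifold_def by auto

lemma chart_at:
  assumes "smooth_manifold M"
  shows "chart_at M x \<in> M" "x \<in> fst (chart_at M x)"
  using someI_ex[of "\<lambda>c. c \<in> M \<and> x \<in> fst c"] smooth_manifoldD(2)[OF assms, of x]
  unfolding chart_at_def by blast+

lemma smooth_fun_onD:
  "smooth_fun_on M W f \<Longrightarrow> c \<in> M \<Longrightarrow> smooth_on (snd c ` (fst c \<inter> W)) (\<lambda>y. f (chart_inv c y))"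
  by (simp add: smooth_fun_on_def o_def)

lemma smooth_fun_onI:
  "(\<And>c. c \<in> M \<Longrightarrow> smooth_on (snd c ` (fst c \<inter> W)) (\<lambda>y. f (chart_inv c y))) \<Longrightarrow> smooth_fun_on M W f"
  by (simp add: smooth_fun_on_def o_def)

lemma smooth_fun_on_subset: "smooth_fun_on M W f \<Longrightarrow> V \<subseteq> W \<Longrightarrow> smooth_fun_on M V f"
  unfolding smooth_fun_on_def by (meson smooth_on_subset image_mono Int_mono order_refl)

lemma smooth_functions_iff: "f \<in> smooth_functions M \<longleftrightarrow> smooth_fun_on M UNIV f"
  by (simp add: smooth_functions_def)

context
  fixes M :: "('m::{t2_space, second_countable_topology}, 'e::real_normed_vector) chart set"
  assumes M: "smooth_manifold M"
begin

lemma smooth_fun_on_cong: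
  assumes "open W" "\<And>x. x \<in> W \<Longrightarrow> f x = g x" "smooth_fun_on M W f"
  shows "smooth_fun_on M W g"
proof (rule smooth_fun_onI)
  fix c assume c: "c \<in> M"
  note ch = smooth_manifoldD(3)[OF M c]
  show "smooth_on (snd c ` (fst c \<inter> W)) (\<lambda>y. g (chart_inv c y))"
  proof (rule smooth_on_cong[OF open_chart_image[OF ch assms(1)] _ smooth_fun_onD[OF assms(3) c]])
    show "f (chart_inv c y) = g (chart_inv c y)" if "y \<in> snd c ` (fst c \<inter> W)" for y
      using that assms(2) unfolding chart_image_eq[OF ch] by blast
  qed
qed

lemma smooth_fun_on_local:
  assumes "\<And>x. x \<in> W \<Longrightarrow> \<exists>V. open V \<and> x \<in> V \<and> smooth_fun_on M V f"
  shows "smooth_fun_on M W f"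
proof (rule smooth_fun_onI)
  fix c assume c: "c \<in> M"
  note ch = smooth_manifoldD(3)[OF M c]
  show "smooth_on (snd c ` (fst c \<inter> W)) (\<lambda>y. f (chart_inv c y))"
  proof (rule smooth_on_local)
    fix y assume "y \<in> snd c ` (fst c \<inter> W)"
    then obtain x where x: "x \<in> fst c" "x \<in> W" "y = snd c x" by blast
    then obtain V where V: "open V" "x \<in> V" "smooth_fun_on M V f" using assms by blast
    then show "\<exists>U. open U \<and> y \<in> U \<and> smooth_on U (\<lambda>y. f (chart_inv c y))"
      using open_chart_image[OF ch V(1)] smooth_fun_onD[OF V(3) c] x by blast
  qed
qed

lemma smooth_fun_on_const: "smooth_fun_on M W (\<lambda>x. k)"
  by (rule smooth_fun_onI) (rule smooth_on_const)

lemma smooth_fun_on_add: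
  "open W \<Longrightarrow> smooth_fun_on M W f \<Longrightarrow> smooth_fun_on M W g \<Longrightarrow> smooth_fun_on M W (\<lambda>x. f x + g x)"
  by (rule smooth_fun_onI)
    (rule smooth_on_add[OF open_chart_image[OF smooth_manifoldD(3)[OF M]] smooth_fun_onD
      smooth_fun_onD])

lemma smooth_fun_on_scaleR:
  fixes k :: "'m \<Rightarrow> real"
  shows "open W \<Longrightarrow> smooth_fun_on M W k \<Longrightarrow> smooth_fun_on M W g \<Longrightarrow> smooth_fun_on M W (\<lambda>x. k x *\<^sub>R g x)"
  by (rule smooth_fun_onI)
    (rule smooth_on_scaleR[OF open_chart_image[OF smooth_manifoldD(3)[OF M]] smooth_fun_onD
      smooth_fun_onD])

lemma smooth_fun_on_mult:
  fixes k g :: "'m \<Rightarrow> real"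
  shows "open W \<Longrightarrow> smooth_fun_on M W k \<Longrightarrow> smooth_fun_on M W g \<Longrightarrow> smooth_fun_on M W (\<lambda>x. k x * g x)"
  using smooth_fun_on_scaleR[of W k g] by simp

lemma smooth_fun_on_linear_compose:
  assumes "open W" "bounded_linear L" "smooth_fun_on M W f"
  shows "smooth_fun_on M W (\<lambda>x. L (f x))"
  by (rule smooth_fun_onI)
    (rule smooth_on_linear_compose[OF open_chart_image[OF smooth_manifoldD(3)[OF M] assms(1)]
      assms(2)
        smooth_fun_onD[OF assms(3)]])

lemma smooth_fun_on_sum:
  assumes "open W" "\<And>i. i \<in> I \<Longrightarrow> smooth_fun_on M W (f i)"
  shows "smooth_fun_on M W (\<lambda>x. \<Sum>i\<in>I. f i x)"
  using assms(2)
  by (induction I rule: infinite_finite_induct)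
    (auto intro: smooth_fun_on_const smooth_fun_on_add[OF assms(1)])

text \<open>In any other chart the function is the given local expression composed with a smooth
  transition map, so one chart around \<open>W\<close> decides.\<close>

lemma smooth_fun_on_chart:
  assumes "c \<in> M" "open W" "W \<subseteq> fst c" "smooth_on (snd c ` (fst c \<inter> W)) (\<lambda>y. f (chart_inv c y))"
  shows "smooth_fun_on M W f"
proof (rule smooth_fun_onI)
  fix d assume d: "d \<in> M"
  note cc = smooth_manifoldD(3)[OF M assms(1)] and cd = smooth_manifoldD(3)[OF M d]
  note Wc = subsetD[OF assms(3)]
  show "smooth_on (snd d ` (fst d \<inter> W)) (\<lambda>y. f (chart_inv d y))"
  proof (rule smooth_on_cong[OF open_chart_image[OF cd assms(2)]])
    show "smooth_on (snd d ` (fst d \<inter> W)) (\<lambda>y. f (chart_inv c (snd c (chart_inv d y))))"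
    proof (rule smooth_on_compose[OF smooth_manifoldD(1)[OF M] open_chart_image[OF cd assms(2)]
          open_chart_image[OF cc assms(2)] assms(4)])
      show "smooth_on (snd d ` (fst d \<inter> W)) (\<lambda>y. snd c (chart_inv d y))"
        using smooth_on_subset[OF smooth_manifoldD(4)[OF M d assms(1)], of "snd d ` (fst d \<inter> W)"]
          assms(3)
        by (auto simp: o_def)
      show "(\<lambda>y. snd c (chart_inv d y)) ` (snd d ` (fst d \<inter> W)) \<subseteq> snd c ` (fst c \<inter> W)"
        using Wc is_chartD(5)[OF cd] by auto
    qed
    show "f (chart_inv c (snd c (chart_inv d y))) = f (chart_inv d y)" if "y \<in> snd d ` (fst d \<inter> W)"
      for y
      using that Wc is_chartD(5)[OF cc] unfolding chart_image_eq[OF cd] by auto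
  qed
qed

lemma smooth_fun_on_differentiable:
  assumes "smooth_fun_on M W f" "x \<in> W" "c \<in> M" "x \<in> fst c"
  shows "(\<lambda>y. f (chart_inv c y)) differentiable (at (snd c x))"
  using smooth_on_differentiable[OF smooth_fun_onD[OF assms(1,3)]] assms(2,4) by blast

text \<open>A bump in a chart is extended by zero. The set \<open>K\<close> is compact, hence closed
  in a Hausdorff space; the chart domain and the complement of \<open>K\<close> are then open sets
  that cover the manifold, and the extension is smooth on each of them.\<close>

lemma bump_function:
  assumes "open W" "x \<in> W"
  obtains \<theta> K V where "\<theta> \<in> smooth_functions M" "closed K" "K \<subseteq> W" "\<And>y. y \<notin> K \<Longrightarrow> \<theta> y = 0"
    "open V" "x \<in> V" "\<And>y. y \<in> V \<Longrightarrow> \<theta> y = 1"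
proof -
  let ?c = "chart_at M x"
  note c = chart_at[OF M, of x]
  note ch = smooth_manifoldD(3)[OF M c(1)]
  let ?U = "snd ?c ` (fst ?c \<inter> W)"
  have oU: "open ?U" by (rule open_chart_image[OF ch assms(1)])
  obtain \<phi> :: "'e \<Rightarrow> real" and K0 V0 where b: "smooth_on UNIV \<phi>" "compact K0" "K0 \<subseteq> ?U"
    "\<And>y. y \<notin> K0 \<Longrightarrow> \<phi> y = 0" "open V0" "snd ?c x \<in> V0" "\<And>y. y \<in> V0 \<Longrightarrow> \<phi> y = 1"
    using bump_exists[OF smooth_manifoldD(1)[OF M] oU] c(2) assms(2) by blast
  define \<theta> where "\<theta> y = (if y \<in> fst ?c then \<phi> (snd ?c y) else 0)" for y
  define K where "K = chart_inv ?c ` K0"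
  have KW: "K \<subseteq> fst ?c \<inter> W"
    using b(3) is_chartD(7)[OF ch] unfolding K_def chart_image_eq[OF ch] by blast
  have "compact K" unfolding K_def
    by (rule compact_continuous_image[OF continuous_on_subset[OF is_chartD(4)[OF ch]] b(2)])
      (use b(3) in blast)
  then have clK: "closed K" by (rule compact_imp_closed)
  have zero: "\<theta> y = 0" if "y \<notin> K" for y
  proof (cases "y \<in> fst ?c")
    case True
    have "snd ?c y \<notin> K0" using that is_chartD(5)[OF ch True] unfolding K_def by (metis imageI)
    then show ?thesis using b(4) by (simp add: \<theta>_def)
  qed (simp add: \<theta>_def)
  have "smooth_fun_on M UNIV \<theta>"
  proof (rule smooth_fun_on_local)
    fix y
    show "\<exists>V. open V \<and> y \<in> V \<and> smooth_fun_on M V \<theta>"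
    proof (cases "y \<in> K")
      case True
      have "smooth_fun_on M (fst ?c) \<theta>"
      proof (rule smooth_fun_on_chart[OF c(1) is_chartD(1)[OF ch] order_refl], unfold Int_absorb)
        show "smooth_on (snd ?c ` fst ?c) (\<lambda>y. \<theta> (chart_inv ?c y))"
          by (rule smooth_on_cong[OF is_chartD(2)[OF ch] _ smooth_on_subset[OF b(1) subset_UNIV]])
            (simp add: \<theta>_def is_chartD(6,7)[OF ch])
      qed
      then show ?thesis using True KW is_chartD(1)[OF ch] by blast
    next
      case False
      have "smooth_fun_on M (- K) \<theta>"
        by (rule smooth_fun_on_cong[OF _ _ smooth_fun_on_const[of _ 0]]) (use clK zero in auto)
      then show ?thesis using False clK by blast
    qed
  qed
  moreover have "open (fst ?c \<inter> snd ?c -` V0)"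
    by (rule continuous_open_preimage[OF is_chartD(3,1)[OF ch] b(5)])
  ultimately show thesis
    using that[of \<theta> K "fst ?c \<inter> snd ?c -` V0"] clK KW zero b(6,7) c(2)
    by (auto simp: smooth_functions_iff \<theta>_def)
qed

text \<open>Outside \<open>W\<close> the values of \<open>g\<close> are arbitrary but multiplied by
  zero. The sets \<open>W \<inter> U\<close> and \<open>- K\<close> are open and cover
  \<open>U\<close>.\<close>

lemma smooth_fun_on_extend_zero:
  fixes \<theta> :: "'m \<Rightarrow> real" and g :: "'m \<Rightarrow> 'w::real_normed_vector"
  assumes "\<theta> \<in> smooth_functions M" "closed K" "K \<subseteq> W" "\<And>y. y \<notin> K \<Longrightarrow> \<theta> y = 0"
    "open W" "open U" "smooth_fun_on M (W \<inter> U) g"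
  shows "smooth_fun_on M U (\<lambda>x. \<theta> x *\<^sub>R g x)"
proof (rule smooth_fun_on_local)
  fix x assume x: "x \<in> U"
  show "\<exists>V. open V \<and> x \<in> V \<and> smooth_fun_on M V (\<lambda>x. \<theta> x *\<^sub>R g x)"
  proof (cases "x \<in> K")
    case True
    have o: "open (W \<inter> U)" using assms(5,6) by blast
    have "smooth_fun_on M (W \<inter> U) \<theta>"
      using smooth_fun_on_subset assms(1) unfolding smooth_functions_iff by blast
    from smooth_fun_on_scaleR[OF o this assms(7)] show ?thesis using o x True assms(3) by blast
  next
    case False
    have "smooth_fun_on M (- K) (\<lambda>x. \<theta> x *\<^sub>R g x)"
      by (rule smooth_fun_on_cong[OF _ _ smooth_fun_on_const[of _ 0]]) (use assms(2,4) in auto)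
    then show ?thesis using False assms(2) by blast
  qed
qed

end

lemma smooth_fun_on_compose:
  assumes P: "smooth_manifold P" and N: "smooth_manifold N" and f: "smooth_map P N f"
    and g: "smooth_fun_on N W g" and W: "open W" and V: "open V" "f ` V \<subseteq> W"
  shows "smooth_fun_on P V (\<lambda>x. g (f x))"
proof (rule smooth_fun_on_local[OF P])
  fix x assume x: "x \<in> V"
  let ?c = "chart_at P x" and ?d = "chart_at N (f x)"
  note c = chart_at[OF P, of x] and d = chart_at[OF N, of "f x"]
  note cc = smooth_manifoldD(3)[OF P c(1)] and cd = smooth_manifoldD(3)[OF N d(1)]
  have contf: "continuous_on UNIV f" using f unfolding smooth_map_def by blast
  let ?U = "V \<inter> (fst ?c \<inter> f -` fst ?d)"
  have oU: "open ?U"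
    using continuous_open_preimage[OF contf open_UNIV is_chartD(1)[OF cd]] is_chartD(1)[OF cc] V(1)
    by (auto intro!: open_Int)
  have "smooth_fun_on P ?U (\<lambda>x. g (f x))"
  proof (rule smooth_fun_on_chart[OF P c(1) oU])
    have sub: "snd ?c ` (fst ?c \<inter> ?U) \<subseteq> snd ?c ` (fst ?c \<inter> f -` fst ?d)" by blast
    have "smooth_on (snd ?c ` (fst ?c \<inter> f -` fst ?d)) (snd ?d \<circ> f \<circ> chart_inv ?c)"
      using f c(1) d(1) unfolding smooth_map_def by blast
    then have s: "smooth_on (snd ?c ` (fst ?c \<inter> ?U)) (\<lambda>y. snd ?d (f (chart_inv ?c y)))"
      using smooth_on_subset[OF _ sub] by (simp add: o_def)
    have im: "(\<lambda>y. snd ?d (f (chart_inv ?c y))) ` (snd ?c ` (fst ?c \<inter> ?U)) \<subseteq> snd ?d ` (fst ?d \<inter> W)"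
      using is_chartD(5)[OF cc] V(2) by auto
    show "smooth_on (snd ?c ` (fst ?c \<inter> ?U)) (\<lambda>y. g (f (chart_inv ?c y)))"
    proof (rule smooth_on_cong[OF open_chart_image[OF cc oU] _
          smooth_on_compose[OF smooth_manifoldD(1)[OF N] open_chart_image[OF cc oU]
            open_chart_image[OF cd W] smooth_fun_onD[OF g d(1)] s im]])
      fix y assume "y \<in> snd ?c ` (fst ?c \<inter> ?U)"
      then show "g (chart_inv ?d (snd ?d (f (chart_inv ?c y)))) = g (f (chart_inv ?c y))"
        unfolding chart_image_eq[OF cc] using is_chartD(5)[OF cd] by auto
    qed
  qed blast
  then show "\<exists>V. open V \<and> x \<in> V \<and> smooth_fun_on P V (\<lambda>x. g (f x))"
    using oU x c(2) d(2) by blast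
qed

lemma smooth_map_id:
  assumes "smooth_manifold M"
  shows "smooth_map M M id"
  using smooth_manifoldD(4)[OF assms] by (simp add: smooth_map_def vimage_def continuous_on_id)

section \<open>Derivations along tangent vectors\<close>

lemma tangent_apply_eq:
  "tangent_apply M x \<xi> g = frechet_derivative (\<lambda>y. g (chart_inv (chart_at M x) y))
     (at (snd (chart_at M x) x)) (\<xi> (chart_at M x))"
  by (simp add: tangent_apply_def Let_def o_def)

context
  fixes M :: "('m::{t2_space, second_countable_topology}, 'e::real_normed_vector) chart set" and W
    :: "'m set" and x
  assumes M: "smooth_manifold M" and W: "open W" "x \<in> W"
begin

lemma has_derivative_in_chart:
  assumes "smooth_fun_on M W f" "c \<in> M" "x \<in> fst c"
  shows "((\<lambda>y. f (chart_inv c y)) has_derivative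
    frechet_derivative (\<lambda>y. f (chart_inv c y)) (at (snd c x))) (at (snd c x))"
  using smooth_fun_on_differentiable[OF M assms(1) W(2) assms(2,3)]
    by (simp add: frechet_derivative_works)

lemmas has_derivative_in_chart_at = has_derivative_in_chart[OF _ chart_at[OF M]]

lemma tangent_apply_cong:
  assumes "smooth_fun_on M W f" "\<And>y. y \<in> W \<Longrightarrow> f y = g y"
  shows "tangent_apply M x \<xi> f = tangent_apply M x \<xi> g"
proof -
  note ch = smooth_manifoldD(3)[OF M chart_at(1)[OF M, of x]]
  have "((\<lambda>y. g (chart_inv (chart_at M x) y)) has_derivative
    frechet_derivative (\<lambda>y. f (chart_inv (chart_at M x) y)) (at (snd (chart_at M x) x)))
      (at (snd (chart_at M x) x))"
    by (rule has_derivative_transform_within_open[OF has_derivative_in_chart_at[OF assms(1)]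
      open_chart_image[OF ch W(1)]])
      (use W(2) chart_at[OF M] assms(2) in \<open>auto simp: is_chartD(5)[OF ch]\<close>)
  then show ?thesis unfolding tangent_apply_eq by (simp add: frechet_derivativeI)
qed

lemma tangent_apply_add_fun:
  assumes "smooth_fun_on M W f" "smooth_fun_on M W g"
  shows "tangent_apply M x \<xi> (\<lambda>y. f y + g y) = tangent_apply M x \<xi> f + tangent_apply M x \<xi> g"
  unfolding tangent_apply_eq
  by (simp add: frechet_derivativeI[OF has_derivative_add[OF has_derivative_in_chart_at[OF assms(1)]
      has_derivative_in_chart_at[OF assms(2)]]])

lemma tangent_apply_mult:
  assumes "smooth_fun_on M W f" "smooth_fun_on M W g"
  shows "tangent_apply M x \<xi> (\<lambda>y. f y * g y) = f x * tangent_apply M x \<xi> g + tangent_apply M x \<xi> f *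
    g x"
  unfolding tangent_apply_eq
  by (simp add: frechet_derivativeI[OF has_derivative_mult[OF has_derivative_in_chart_at[OF
    assms(1)]
      has_derivative_in_chart_at[OF assms(2)]]] is_chartD(5)[OF smooth_manifoldD(3)[OF M]]
        chart_at[OF M])

lemma tangent_apply_add:
  assumes "smooth_fun_on M W f"
  shows "tangent_apply M x (\<xi> + \<zeta>) f = tangent_apply M x \<xi> f + tangent_apply M x \<zeta> f"
  using linear_add[OF has_derivative_linear[OF has_derivative_in_chart_at[OF assms]]]
  by (simp add: tangent_apply_eq plus_fun_def)

lemma tangent_apply_scaleR:
  assumes "smooth_fun_on M W f"
  shows "tangent_apply M x (k *\<^sub>R \<xi>) f = k * tangent_apply M x \<xi> f"
  using linear_cmul[OF has_derivative_linear[OF has_derivative_in_chart_at[OF assms]]]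
  by (simp add: tangent_apply_eq scaleR_fun_def)

end

lemma tangent_apply_const: "tangent_apply M x \<xi> (\<lambda>y. k) = 0"
  by (simp add: tangent_apply_eq)

lemma tangent_apply_sum:
  fixes M :: "('m::{t2_space, second_countable_topology}, 'e::real_normed_vector) chart set"
  assumes M: "smooth_manifold M" and W: "open W" "x \<in> W" and f: "\<And>i. i \<in> I \<Longrightarrow> smooth_fun_on M W
    (f i)"
  shows "tangent_apply M x \<xi> (\<lambda>y. \<Sum>i\<in>I. f i y) = (\<Sum>i\<in>I. tangent_apply M x \<xi> (f i))"
  using f
proof (induction I rule: infinite_finite_induct)
  case (insert i I)
  have "smooth_fun_on M W (\<lambda>y. \<Sum>i\<in>I. f i y)"
    by (rule smooth_fun_on_sum[OF M W(1)]) (use insert.prems in auto)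
  then show ?case using insert by (simp add: tangent_apply_add_fun[OF M W])
qed (simp_all add: tangent_apply_const)

text \<open>\<open>tangent_apply\<close> works in an arbitrarily chosen chart. The compatibility
  condition in \<open>tangent_space\<close> and the chain rule for the transition map give the same
  value in every other chart around the point.\<close>

lemma tangent_apply_chart:
  assumes M: "smooth_manifold M" and W: "open W" "x \<in> W" and f: "smooth_fun_on M W f"
    and \<xi>: "\<xi> \<in> tangent_space M x" and c: "c \<in> M" "x \<in> fst c"
  shows "tangent_apply M x \<xi> f = frechet_derivative (\<lambda>y. f (chart_inv c y)) (at (snd c x)) (\<xi> c)"
proof -
  let ?d = "chart_at M x"
  note d = chart_at[OF M, of x]
  note cc = smooth_manifoldD(3)[OF M c(1)] and cd = smooth_manifoldD(3)[OF M d(1)]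
  let ?T = "\<lambda>y. snd ?d (chart_inv c y)"
  have eq: "\<xi> ?d = frechet_derivative ?T (at (snd c x)) (\<xi> c)"
    using \<xi> c d unfolding tangent_space_def o_def by blast
  have T: "(?T has_derivative frechet_derivative ?T (at (snd c x))) (at (snd c x))"
    using smooth_on_differentiable[OF smooth_manifoldD(4)[OF M c(1) d(1)], of "snd c x"] c d
    by (simp add: frechet_derivative_works o_def)
  have Tx: "?T (snd c x) = snd ?d x" using is_chartD(5)[OF cc c(2)] by simp
  let ?Df = "frechet_derivative (\<lambda>y. f (chart_inv ?d y)) (at (snd ?d x))"
  have "((\<lambda>y. f (chart_inv ?d (?T y))) has_derivative (\<lambda>v. ?Df (frechet_derivative ?T (at (snd c x))
    v))) (at (snd c x))"
    using has_derivative_compose[OF T, of "\<lambda>y. f (chart_inv ?d y)" ?Df] has_derivative_in_chart[OF M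
      W f d]
    unfolding Tx by simp
  then have "((\<lambda>y. f (chart_inv c y)) has_derivative (\<lambda>v. ?Df (frechet_derivative ?T (at (snd c x))
    v))) (at (snd c x))"
    by (rule has_derivative_transform_within_open[OF _ open_chart_image[OF cc is_chartD(1)[OF cd]]])
      (use c d in \<open>auto simp: is_chartD(5)[OF cc] is_chartD(5)[OF cd]\<close>)
  from frechet_derivativeI[OF this] show ?thesis by (simp add: tangent_apply_eq eq)
qed

text \<open>The chart chosen by \<open>chart_at\<close> may jump from point to point. Near
  \<open>x\<close> one chart is kept fixed, in which the value is a sum of coordinates of the vector
  field times partial derivatives of \<open>f\<close>.\<close>

lemma smooth_tangent_apply:
  fixes M :: "('m::{t2_space, second_countable_topology}, 'e::real_normed_vector) chart set"
  assumes M: "smooth_manifold M" and W: "open W" and f: "smooth_fun_on M W f"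
    and a: "\<And>x. x \<in> W \<Longrightarrow> a x \<in> tangent_space M x"
    and sa: "\<And>c. c \<in> M \<Longrightarrow> smooth_fun_on M (W \<inter> fst c) (\<lambda>x. a x c)"
  shows "smooth_fun_on M W (\<lambda>x. tangent_apply M x (a x) f)"
proof (rule smooth_fun_on_local[OF M])
  fix x assume x: "x \<in> W"
  let ?c = "chart_at M x"
  note c = chart_at[OF M, of x]
  note ch = smooth_manifoldD(3)[OF M c(1)]
  let ?U = "W \<inter> fst ?c"
  have oU: "open ?U" using W is_chartD(1)[OF ch] by blast
  note oS = open_chart_image[OF ch oU]
  obtain r and e :: "nat \<Rightarrow> 'e" and \<kappa> where cs: "coord_system r e \<kappa>"
    using coord_system_exists[OF smooth_manifoldD(1)[OF M]] .
  have "smooth_fun_on M ?U (\<lambda>x. tangent_apply M x (a x) f)"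
  proof (rule smooth_fun_on_chart[OF M c(1) oU])
    let ?D = "\<lambda>y v. frechet_derivative (\<lambda>y. f (chart_inv ?c y)) (at y) v"
    let ?S = "snd ?c ` (fst ?c \<inter> ?U)"
    have sf: "smooth_on ?S (\<lambda>y. f (chart_inv ?c y))"
      by (rule smooth_on_subset[OF smooth_fun_onD[OF f c(1)]]) blast
    have "smooth_on ?S (\<lambda>y. \<Sum>i<r. \<kappa> i (a (chart_inv ?c y) ?c) *\<^sub>R ?D y (e i))"
    proof (rule smooth_on_sum[OF oS], rule smooth_on_scaleR[OF oS])
      fix i assume "i \<in> {..<r}"
      then have bl: "bounded_linear (\<kappa> i)" using coord_systemD(1)[OF cs] by simp
      show "smooth_on ?S (\<lambda>y. \<kappa> i (a (chart_inv ?c y) ?c))"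
        by (rule smooth_on_linear_compose[OF oS bl smooth_fun_onD[OF sa[OF c(1)] c(1)]])
      show "smooth_on ?S (\<lambda>y. ?D y (e i))"
        by (rule smooth_on_frechet_derivative[OF sf])
    qed
    then show "smooth_on ?S (\<lambda>y. tangent_apply M (chart_inv ?c y) (a (chart_inv ?c y)) f)"
    proof (rule smooth_on_cong[OF oS, rotated])
      fix y assume "y \<in> ?S"
      then obtain z where z: "y = snd ?c z" "z \<in> fst ?c" "z \<in> W" by blast
      have l: "linear (?D y)"
        using has_derivative_linear[OF has_derivative_in_chart[OF M W z(3) f c(1) z(2)]] z(1)
          by simp
      have "tangent_apply M (chart_inv ?c y) (a (chart_inv ?c y)) f = ?D y (a z ?c)"
        using tangent_apply_chart[OF M W z(3) f a[OF z(3)] c(1) z(2)] z is_chartD(5)[OF ch z(2)]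
          by simp
      also have "\<dots> = ?D y (\<Sum>i<r. \<kappa> i (a z ?c) *\<^sub>R e i)" by (simp add: coord_systemD(2)[OF cs])
      also have "\<dots> = (\<Sum>i<r. \<kappa> i (a z ?c) *\<^sub>R ?D y (e i))" by (simp add: linear_sum[OF l]
        linear_cmul[OF l])
      finally show "(\<Sum>i<r. \<kappa> i (a (chart_inv ?c y) ?c) *\<^sub>R ?D y (e i)) =
          tangent_apply M (chart_inv ?c y) (a (chart_inv ?c y)) f"
        using is_chartD(5)[OF ch z(2)] z(1) by simp
    qed
  qed blast
  then show "\<exists>V. open V \<and> x \<in> V \<and> smooth_fun_on M V (\<lambda>x. tangent_apply M x (a x) f)"
    using oU x c(2) by blast
qed

lemma tangent_apply_map:
  assumes P: "smooth_manifold P" and N: "smooth_manifold N" and f: "smooth_map P N f"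
    and g: "smooth_fun_on N W g" and W: "open W" "f x \<in> W"
  shows "tangent_apply N (f x) (tangent_map P N f x \<xi>) g = tangent_apply P x \<xi> (\<lambda>y. g (f y))"
proof -
  let ?c = "chart_at P x" and ?d = "chart_at N (f x)"
  note c = chart_at[OF P, of x] and d = chart_at[OF N, of "f x"]
  note cc = smooth_manifoldD(3)[OF P c(1)] and cd = smooth_manifoldD(3)[OF N d(1)]
  let ?T = "\<lambda>y. snd ?d (f (chart_inv ?c y))"
  have contf: "continuous_on UNIV f" using f unfolding smooth_map_def by blast
  have oU: "open (f -` fst ?d)"
    using continuous_open_preimage[OF contf open_UNIV is_chartD(1)[OF cd]] by simp
  have sT: "smooth_on (snd ?c ` (fst ?c \<inter> f -` fst ?d)) ?T"
    using f c(1) d(1) unfolding smooth_map_def by (auto simp: o_def)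
  have T: "(?T has_derivative frechet_derivative ?T (at (snd ?c x))) (at (snd ?c x))"
    using smooth_on_differentiable[OF sT, of "snd ?c x"] c d
    by (simp add: frechet_derivative_works)
  have Tx: "?T (snd ?c x) = snd ?d (f x)" using is_chartD(5)[OF cc c(2)] by simp
  let ?Dg = "frechet_derivative (\<lambda>y. g (chart_inv ?d y)) (at (snd ?d (f x)))"
  have "((\<lambda>y. g (chart_inv ?d (?T y))) has_derivative (\<lambda>v. ?Dg (frechet_derivative ?T
    (at (snd ?c x)) v))) (at (snd ?c x))"
    using has_derivative_compose[OF T, of "\<lambda>y. g (chart_inv ?d y)" ?Dg] has_derivative_in_chart[OF N
      W g d]
    unfolding Tx by simp
  then have "((\<lambda>y. g (f (chart_inv ?c y))) has_derivative (\<lambda>v. ?Dg (frechet_derivative ?T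
    (at (snd ?c x)) v))) (at (snd ?c x))"
    by (rule has_derivative_transform_within_open[OF _ open_chart_image[OF cc oU]])
      (use c d in \<open>auto simp: is_chartD(5)[OF cc] is_chartD(5)[OF cd]\<close>)
  moreover have "tangent_map P N f x \<xi> ?d = frechet_derivative ?T (at (snd ?c x)) (\<xi> ?c)"
    using d by (simp add: tangent_map_def Let_def o_def)
  ultimately show ?thesis by (simp add: tangent_apply_eq frechet_derivativeI)
qed

section \<open>The product with the real line\<close>

lemma fst_line_times_chart [simp]: "fst (line_times_chart c) = UNIV \<times> fst c"
  and snd_line_times_chart [simp]: "snd (line_times_chart c) (t, x) = (t, snd c x)"
  by (simp_all add: line_times_chart_def)

lemma line_times_chart_image:
  "snd (line_times_chart c) ` (fst (line_times_chart c) \<inter> (UNIV \<times> W)) = UNIV \<times> snd c ` (fst c \<inter> W)"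
  by (force simp: line_times_chart_def image_iff)

lemma chart_inv_line_times:
  assumes "is_chart c" "y \<in> snd c ` fst c"
  shows "chart_inv (line_times_chart c) (t, y) = (t, chart_inv c y)"
proof -
  have "inj_on (snd (line_times_chart c)) (fst (line_times_chart c))"
    using is_chartD(5)[OF assms(1)] by (intro inj_onI) (auto, metis)
  then have "chart_inv (line_times_chart c) (snd (line_times_chart c) (t, chart_inv c y)) =
    (t, chart_inv c y)"
    unfolding chart_inv_def[of "line_times_chart c"]
    by (rule inv_into_f_f) (simp add: is_chartD(7)[OF assms])
  then show ?thesis using is_chartD(6)[OF assms] by simp
qed

lemma is_chart_line_times:
  assumes "is_chart c"
  shows "is_chart (line_times_chart c)"
proof -
  note ch = is_chartD[OF assms]
  have im: "snd (line_times_chart c) ` fst (line_times_chart c) = UNIV \<times> snd c ` fst c"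
    using line_times_chart_image[of c UNIV] by simp
  have "continuous_on (UNIV \<times> fst c) (\<lambda>p. (fst p, snd c (snd p)))"
    by (intro continuous_on_Pair continuous_on_fst continuous_on_id)
      (rule continuous_on_compose2[OF ch(3)], auto intro: continuous_on_snd continuous_on_id)
  then have 1: "continuous_on (UNIV \<times> fst c) (snd (line_times_chart c))"
    by (simp add: line_times_chart_def split_beta)
  have "continuous_on (UNIV \<times> snd c ` fst c) (\<lambda>p. (fst p, chart_inv c (snd p)))"
    by (intro continuous_on_Pair continuous_on_fst continuous_on_id)
      (rule continuous_on_compose2[OF ch(4)], auto intro: continuous_on_snd continuous_on_id)
  moreover have "chart_inv (line_times_chart c) p = (fst p, chart_inv c (snd p))"
    if "p \<in> UNIV \<times> snd c ` fst c" for p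
    using that chart_inv_line_times[OF assms, of "snd p" "fst p"] by auto
  ultimately have 2: "continuous_on (UNIV \<times> snd c ` fst c) (chart_inv (line_times_chart c))"
    by (simp cong: continuous_on_cong)
  show ?thesis unfolding is_chart_def im homeomorphism_def
  proof (intro conjI ballI)
    show "chart_inv (line_times_chart c) (snd (line_times_chart c) p) = p"
      if "p \<in> fst (line_times_chart c)" for p
      using that ch(5) by (cases p) (simp add: chart_inv_line_times[OF assms])
    show "snd (line_times_chart c) (chart_inv (line_times_chart c) p) = p"
      if "p \<in> UNIV \<times> snd c ` fst c" for p
      using that ch(6) by (cases p) (simp add: chart_inv_line_times[OF assms])
    show "chart_inv (line_times_chart c) ` (UNIV \<times> snd c ` fst c) = fst (line_times_chart c)"
    proof
      show "chart_inv (line_times_chart c) ` (UNIV \<times> snd c ` fst c) \<subseteq> fst (line_times_chart c)"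
        using ch(7) by (auto simp: chart_inv_line_times[OF assms])
      show "fst (line_times_chart c) \<subseteq> chart_inv (line_times_chart c) ` (UNIV \<times> snd c ` fst c)"
      proof
        fix p assume "p \<in> fst (line_times_chart c)"
        then show "p \<in> chart_inv (line_times_chart c) ` (UNIV \<times> snd c ` fst c)"
          using ch(5) by (intro image_eqI[of _ _ "(fst p, snd c (snd p))"])
            (auto simp: chart_inv_line_times[OF assms])
      qed
    qed
  qed (use 1 2 ch(1,2) im in \<open>auto intro: open_Times\<close>)
qed

lemma smooth_manifold_line_times:
  fixes M :: "('m::{t2_space, second_countable_topology}, 'e::real_normed_vector) chart set"
  assumes M: "smooth_manifold M"
  shows "smooth_manifold (line_times M)"
  unfolding smooth_manifold_def
proof (intro conjI ballI)
  show "finite_dim TYPE(real \<times> 'e)" by (rule finite_dim_prod[OF finite_dim_real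
    smooth_manifoldD(1)[OF M]])
  show "(\<Union>c\<in>line_times M. fst c) = UNIV"
    using smooth_manifoldD(2)[OF M] unfolding line_times_def by fastforce
  show "is_chart c" if "c \<in> line_times M" for c
    using that is_chart_line_times smooth_manifoldD(3)[OF M] unfolding line_times_def by blast
  fix c' d' assume "c' \<in> line_times M" "d' \<in> line_times M"
  then obtain c d where c: "c \<in> M" "c' = line_times_chart c" and d: "d \<in> M" "d' = line_times_chart
    d"
    unfolding line_times_def by blast
  note cc = smooth_manifoldD(3)[OF M c(1)] and cd = smooth_manifoldD(3)[OF M d(1)]
  let ?S = "snd c ` (fst c \<inter> fst d)"
  have oS: "open ?S" by (rule open_chart_image[OF cc is_chartD(1)[OF cd]])
  then have o: "open (UNIV \<times> ?S)" by (simp add: open_Times)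
  have "smooth_on (UNIV \<times> ?S) (\<lambda>p. (fst p, (snd d \<circ> chart_inv c) (snd p)))"
    by (rule smooth_on_Pair[OF o smooth_on_bounded_linear[OF o bounded_linear_fst]
          smooth_on_compose[OF smooth_manifoldD(1)[OF M] o oS smooth_manifoldD(4)[OF M c(1) d(1)]
            smooth_on_bounded_linear[OF o bounded_linear_snd]]]) auto
  then have "smooth_on (UNIV \<times> ?S) (snd d' \<circ> chart_inv c')"
    by (rule smooth_on_cong[OF o, rotated]) (auto simp: c d chart_inv_line_times[OF cc])
  then show "smooth_on (snd c' ` (fst c' \<inter> fst d')) (snd d' \<circ> chart_inv c')"
    using line_times_chart_image[of c "fst d"] unfolding c(2) d(2) by simp
qed

context
  fixes M :: "('m::{t2_space, second_countable_topology}, 'e::real_normed_vector) chart set"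
  assumes M: "smooth_manifold M"
begin

lemma smooth_fun_on_line_snd:
  assumes "open W" "smooth_fun_on M W g"
  shows "smooth_fun_on (line_times M) (UNIV \<times> W) (\<lambda>p. g (snd p))"
proof (rule smooth_fun_onI)
  fix c' assume "c' \<in> line_times M"
  then obtain c where c: "c \<in> M" "c' = line_times_chart c" unfolding line_times_def by blast
  note cc = smooth_manifoldD(3)[OF M c(1)]
  let ?S = "snd c ` (fst c \<inter> W)"
  have oS: "open ?S" by (rule open_chart_image[OF cc assms(1)])
  then have o: "open (UNIV \<times> ?S)" by (simp add: open_Times)
  have "smooth_on (UNIV \<times> ?S) (\<lambda>p::real \<times> 'e. g (chart_inv c (snd p)))"
    by (rule smooth_on_compose[OF smooth_manifoldD(1)[OF M] o oS smooth_fun_onD[OF assms(2) c(1)]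
            smooth_on_bounded_linear[OF o bounded_linear_snd]]) auto
  then show "smooth_on (snd c' ` (fst c' \<inter> UNIV \<times> W)) (\<lambda>y. g (snd (chart_inv c' y)))"
    unfolding c(2) line_times_chart_image
    by (rule smooth_on_cong[OF o, rotated]) (auto simp: chart_inv_line_times[OF cc])
qed

lemma smooth_map_slice: "smooth_map M (line_times M) (\<lambda>x. (t, x))"
  unfolding smooth_map_def
proof (intro conjI ballI)
  show "continuous_on UNIV (\<lambda>x::'m. (t, x))" by (intro continuous_intros)
  fix c d' assume c: "c \<in> M" and "d' \<in> line_times M"
  then obtain d where d: "d \<in> M" "d' = line_times_chart d" unfolding line_times_def by blast
  note cc = smooth_manifoldD(3)[OF M c(1)] and cd = smooth_manifoldD(3)[OF M d(1)]
  let ?S = "snd c ` (fst c \<inter> fst d)"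
  have oS: "open ?S" by (rule open_chart_image[OF cc is_chartD(1)[OF cd]])
  have "smooth_on ?S (\<lambda>y. (t, (snd d \<circ> chart_inv c) y))"
    by (rule smooth_on_Pair[OF oS smooth_on_const smooth_manifoldD(4)[OF M c d(1)]])
  then show "smooth_on (snd c ` (fst c \<inter> (\<lambda>x. (t, x)) -` fst d')) (snd d' \<circ> (\<lambda>x. (t, x)) \<circ> chart_inv
    c)"
    using d(2) by (simp add: vimage_def o_def)
qed

lemma smooth_fun_on_slice:
  assumes "open W" "smooth_fun_on (line_times M) (UNIV \<times> W) F"
  shows "smooth_fun_on M W (\<lambda>x. F (t, x))"
  by (rule smooth_fun_on_compose[OF M smooth_manifold_line_times[OF M] smooth_map_slice assms(2)])
    (use assms(1) in \<open>auto intro: open_Times\<close>)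

lemma line_chart_function:
  assumes "open W" "smooth_fun_on (line_times M) (UNIV \<times> W) F" "c \<in> M"
  shows "smooth_on (UNIV \<times> snd c ` (fst c \<inter> W)) (\<lambda>p. F (fst p, chart_inv c (snd p)))"
proof -
  note cc = smooth_manifoldD(3)[OF M assms(3)]
  have o: "open (UNIV \<times> snd c ` (fst c \<inter> W))" by (simp add: open_Times open_chart_image[OF cc
    assms(1)])
  have "line_times_chart c \<in> line_times M" using assms(3) by (simp add: line_times_def)
  from smooth_fun_onD[OF assms(2) this]
  have "smooth_on (UNIV \<times> snd c ` (fst c \<inter> W)) (\<lambda>y. F (chart_inv (line_times_chart c) y))"
    unfolding line_times_chart_image .
  then show ?thesis
    by (rule smooth_on_cong[OF o, rotated]) (auto simp: chart_inv_line_times[OF cc])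
qed

lemma smooth_fun_on_integral:
  fixes F :: "real \<times> 'm \<Rightarrow> real"
  assumes "open W" "smooth_fun_on (line_times M) (UNIV \<times> W) F"
  shows "smooth_fun_on M W (\<lambda>x. integral {0..1} (\<lambda>t. F (t, x)))"
proof (rule smooth_fun_onI)
  fix c assume c: "c \<in> M"
  note o = open_chart_image[OF smooth_manifoldD(3)[OF M c] assms(1)]
  show "smooth_on (snd c ` (fst c \<inter> W)) (\<lambda>y. integral {0..1} (\<lambda>t. F (t, chart_inv c y)))"
    unfolding smooth_on_def
    using Ck_on_integral[OF smooth_manifoldD(1)[OF M] o smooth_onD[OF line_chart_function[OF assms
      c]]] by simp
qed

lemma curve_differentiable:
  assumes "open W" "smooth_fun_on (line_times M) (UNIV \<times> W) F" "x \<in> W"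
  shows "(\<lambda>t. F (t, x)) differentiable (at t)"
proof -
  let ?c = "chart_at M x"
  note c = chart_at[OF M, of x]
  have "(\<lambda>p. F (fst p, chart_inv ?c (snd p))) differentiable (at (t, snd ?c x))"
    by (rule smooth_on_differentiable[OF line_chart_function[OF assms(1,2) c(1)]])
      (use c(2) assms(3) in auto)
  then obtain D where "((\<lambda>p. F (fst p, chart_inv ?c (snd p))) has_derivative D) (at (t, snd ?c x))"
    unfolding differentiable_def by blast
  moreover have "((\<lambda>t. (t, snd ?c x)) has_derivative (\<lambda>h. (h, 0))) (at t)"
    by (intro has_derivative_Pair has_derivative_const has_derivative_ident)
  ultimately have "((\<lambda>t. F (fst (t, snd ?c x), chart_inv ?c (snd (t, snd ?c x)))) has_derivative
    (\<lambda>h. D (h, 0))) (at t)"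
    by (rule has_derivative_compose[rotated])
  then show ?thesis
    using is_chartD(5)[OF smooth_manifoldD(3)[OF M c(1)] c(2)] unfolding differentiable_def by auto
qed

lemma curve_continuous:
  assumes "open W" "smooth_fun_on (line_times M) (UNIV \<times> W) F" "x \<in> W"
  shows "continuous_on S (\<lambda>t. F (t, x))"
  using curve_differentiable[OF assms]
  by (meson continuous_at_imp_continuous_on differentiable_imp_continuous_within)

text \<open>The tangent vector on the left is the value of the anchor of \<open>T\<real> \<times> A\<close>.\<close>

lemma tangent_apply_line_times:
  fixes F :: "real \<times> 'm \<Rightarrow> real"
  assumes W: "open W" "smooth_fun_on (line_times M) (UNIV \<times> W) F" "x \<in> W"
  shows "tangent_apply (line_times M) (t, x)
      (tangent_of_coords (line_times M) (t, x) (line_times_chart (chart_at M x))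
        (s, \<xi> (chart_at M x))) F
    = s * deriv (\<lambda>u. F (u, x)) t + tangent_apply M x \<xi> (\<lambda>y. F (t, y))"
proof -
  let ?c = "chart_at M x" and ?d = "chart_at (line_times M) (t, x)"
  let ?l = "line_times_chart ?c"
  note L = smooth_manifold_line_times[OF M]
  note c = chart_at[OF M, of x] and d = chart_at[OF L, of "(t, x)"]
  have l: "?l \<in> line_times M" "(t, x) \<in> fst ?l" using c by (auto simp: line_times_def)
  note cc = smooth_manifoldD(3)[OF M c(1)] and cd = smooth_manifoldD(3)[OF L d(1)] and cl =
    smooth_manifoldD(3)[OF L l(1)]
  \<comment> \<open>The chart \<open>?d\<close> chosen at \<open>(t, x)\<close> need not be the
    product chart \<open>?l\<close> in which the vector is given; \<open>?T\<close> is the change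
    between them.\<close>
  let ?T = "\<lambda>y. snd ?d (chart_inv ?l y)"
  let ?y = "snd ?l (t, x)"
  have T: "(?T has_derivative frechet_derivative ?T (at ?y)) (at ?y)"
    using smooth_on_differentiable[OF smooth_manifoldD(4)[OF L l(1) d(1)], of ?y] l d
    by (simp add: frechet_derivative_works o_def del: fst_line_times_chart snd_line_times_chart)
  have Ty: "?T ?y = snd ?d (t, x)" using is_chartD(5)[OF cl l(2)] by simp
  have oW: "open (UNIV \<times> W)" and xW: "(t, x) \<in> UNIV \<times> W" using W by (auto intro: open_Times)
  let ?DF = "frechet_derivative (\<lambda>y. F (chart_inv ?d y)) (at (snd ?d (t, x)))"
  let ?G = "\<lambda>p. F (fst p, chart_inv ?c (snd p))"
  have "((\<lambda>y. F (chart_inv ?d (?T y))) has_derivative (\<lambda>v. ?DF (frechet_derivative ?T (at ?y) v)))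
    (at ?y)"
    using has_derivative_compose[OF T, of "\<lambda>y. F (chart_inv ?d y)" ?DF] has_derivative_in_chart[OF L
      oW xW W(2) d]
    unfolding Ty by simp
  then have "(?G has_derivative (\<lambda>v. ?DF (frechet_derivative ?T (at ?y) v))) (at ?y)"
  proof (rule has_derivative_transform_within_open[OF _ open_chart_image[OF cl is_chartD(1)[OF
    cd]]])
    show "?y \<in> snd ?l ` (fst ?l \<inter> fst ?d)" using l d by blast
    fix y assume "y \<in> snd ?l ` (fst ?l \<inter> fst ?d)"
    then obtain p where p: "y = snd ?l p" "p \<in> fst ?l" "p \<in> fst ?d" by blast
    have "chart_inv ?l y = p" using is_chartD(5)[OF cl p(2)] p(1) by simp
    moreover have "(fst y, chart_inv ?c (snd y)) = p"
      using p is_chartD(5)[OF cc] by (cases p) simp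
    ultimately show "F (chart_inv ?d (?T y)) = ?G y"
      using is_chartD(5)[OF cd p(3)] by simp
  qed
  then have G: "(?G has_derivative (\<lambda>v. ?DF (frechet_derivative ?T (at ?y) v))) (at (t, snd ?c x))"
    by simp
  let ?D = "\<lambda>v. ?DF (frechet_derivative ?T (at ?y) v)"
  have lD: "linear ?D" by (rule has_derivative_linear[OF G])
  have lhs: "tangent_apply (line_times M) (t, x)
      (tangent_of_coords (line_times M) (t, x) ?l (s, \<xi> ?c)) F = ?D (s, \<xi> ?c)"
    using d by (simp add: tangent_apply_eq tangent_of_coords_def o_def)
  \<comment> \<open>The two summands of the claim come from the time part and the space part of the
    vector, by restricting \<open>?G\<close> to the time axis and to the space directions through
    the point.\<close>
  have "(s, \<xi> ?c) = s *\<^sub>R (1, 0) + (0, \<xi> ?c)" by simp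
  then have "?D (s, \<xi> ?c) = s *\<^sub>R ?D (1, 0) + ?D (0, \<xi> ?c)"
    using linear_add[OF lD] linear_cmul[OF lD] by metis
  moreover have "?D (1, 0) = deriv (\<lambda>u. F (u, x)) t"
  proof -
    have "((\<lambda>t. (t, snd ?c x)) has_derivative (\<lambda>h. (h, 0))) (at t)"
      by (intro has_derivative_Pair has_derivative_const has_derivative_ident)
    from has_derivative_compose[OF this G]
    have "((\<lambda>u. F (u, x)) has_derivative (\<lambda>h. ?D (h, 0))) (at t)"
      using is_chartD(5)[OF cc c(2)] by simp
    moreover have "(\<lambda>h. ?D (h, 0)) = (\<lambda>h. h * ?D (1, 0))"
    proof
      show "?D (h, 0) = h * ?D (1, 0)" for h using linear_cmul[OF lD, of h "(1, 0)"] by simp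
    qed
    ultimately have "((\<lambda>u. F (u, x)) has_derivative (\<lambda>h. h * ?D (1, 0))) (at t)"
      by (rule back_subst[of "\<lambda>H. ((\<lambda>u. F (u, x)) has_derivative H) (at t)"])
    then have "((\<lambda>u. F (u, x)) has_real_derivative ?D (1, 0)) (at t)"
      by (simp add: has_field_derivative_def mult_commute_abs)
    then show ?thesis by (simp add: DERIV_imp_deriv)
  qed
  moreover have "?D (0, \<xi> ?c) = tangent_apply M x \<xi> (\<lambda>y. F (t, y))"
  proof -
    have "((\<lambda>z. (t, z)) has_derivative (\<lambda>h. (0, h))) (at (snd ?c x))"
      by (intro has_derivative_Pair has_derivative_const has_derivative_ident)
    from has_derivative_compose[OF this G]
    have "((\<lambda>z. F (t, chart_inv ?c z)) has_derivative (\<lambda>h. ?D (0, h))) (at (snd ?c x))" by simp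
    from frechet_derivativeI[OF this] show ?thesis by (simp add: tangent_apply_eq)
  qed
  ultimately show ?thesis using lhs by simp
qed

text \<open>Read in a chart, this is differentiation under the integral sign. The continuity in
  \<open>t\<close> is recorded because it makes later integrands integrable.\<close>

lemma tangent_apply_integral:
  fixes F :: "real \<times> 'm \<Rightarrow> real"
  assumes W: "open W" "smooth_fun_on (line_times M) (UNIV \<times> W) F" "x \<in> W"
  shows "tangent_apply M x \<xi> (\<lambda>x. integral {0..1} (\<lambda>t. F (t, x)))
      = integral {0..1} (\<lambda>t. tangent_apply M x \<xi> (\<lambda>y. F (t, y)))"
    and "continuous_on {0..1} (\<lambda>t. tangent_apply M x \<xi> (\<lambda>y. F (t, y)))"
proof -
  let ?c = "chart_at M x"
  note c = chart_at[OF M, of x]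
  note cc = smooth_manifoldD(3)[OF M c(1)]
  let ?S = "snd ?c ` (fst ?c \<inter> W)"
  let ?G = "\<lambda>p. F (fst p, chart_inv ?c (snd p))"
  have oS: "open ?S" by (rule open_chart_image[OF cc W(1)])
  have xS: "snd ?c x \<in> ?S" using c W by blast
  note G = line_chart_function[OF W(1,2) c(1)]
  obtain r and e :: "nat \<Rightarrow> 'e" and \<kappa> where cs: "coord_system r e \<kappa>"
    using coord_system_exists[OF smooth_manifoldD(1)[OF M]] .
  have eq: "tangent_apply M x \<xi> (\<lambda>y. F (t, y)) = frechet_derivative ?G (at (t, snd ?c x)) (0, \<xi> ?c)"
    for t
  proof -
    have "(?G has_derivative frechet_derivative ?G (at (t, snd ?c x))) (at (t, snd ?c x))"
      by (rule Ck_on_SucD[OF smooth_onD[OF G]]) (use xS in auto)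
    moreover have "((\<lambda>z. (t, z)) has_derivative (\<lambda>h. (0, h))) (at (snd ?c x))"
      by (intro has_derivative_Pair has_derivative_const has_derivative_ident)
    ultimately have "((\<lambda>z. ?G (t, z)) has_derivative (\<lambda>h. frechet_derivative ?G (at (t, snd ?c x))
      (0, h))) (at (snd ?c x))"
      by (rule has_derivative_compose[rotated])
    from frechet_derivativeI[OF this] show ?thesis by (simp add: tangent_apply_eq)
  qed
  have "((\<lambda>z. integral {0..1} (\<lambda>t. ?G (t, z))) has_derivative
      (\<lambda>h. integral {0..1} (\<lambda>t. frechet_derivative ?G (at (t, snd ?c x)) (0, h)))) (at (snd ?c x))"
    by (rule integral_has_derivative(1)[OF cs oS smooth_onD[OF G] xS])
  from frechet_derivativeI[OF this]
  show "tangent_apply M x \<xi> (\<lambda>x. integral {0..1} (\<lambda>t. F (t, x)))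
      = integral {0..1} (\<lambda>t. tangent_apply M x \<xi> (\<lambda>y. F (t, y)))"
    unfolding eq by (simp add: tangent_apply_eq)
  have "continuous_on {0..1::real} (\<lambda>t. (t, snd ?c x))" by (intro continuous_intros)
  from continuous_on_compose2[OF smooth_on_continuous[OF smooth_on_frechet_derivative[OF G]] this]
  show "continuous_on {0..1} (\<lambda>t. tangent_apply M x \<xi> (\<lambda>y. F (t, y)))"
    unfolding eq using xS by auto
qed

end

section \<open>Alternating functions on lists\<close>

lemma linear_on_subspace_cong:
  assumes "subspace S" "\<And>v. v \<in> S \<Longrightarrow> f v = g v" "linear_on_subspace S f"
  shows "linear_on_subspace S g"
  using assms(2,3) subspace_add[OF assms(1)] subspace_scale[OF assms(1)]
  unfolding linear_on_subspace_def by metis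

lemma linear_on_subspace_zero: "linear_on_subspace S f \<Longrightarrow> v \<in> S \<Longrightarrow> f 0 = 0"
  unfolding linear_on_subspace_def by (metis scaleR_zero_left)

lemma linear_on_subspace_sum:
  assumes "linear_on_subspace S f" "subspace S" "\<And>i. i \<in> I \<Longrightarrow> v i \<in> S"
  shows "f (\<Sum>i\<in>I. k i *\<^sub>R v i) = (\<Sum>i\<in>I. k i *\<^sub>R f (v i))"
  using assms(3)
proof (induction I rule: infinite_finite_induct)
  case (insert i I)
  have "(\<Sum>i\<in>I. k i *\<^sub>R v i) \<in> S" "k i *\<^sub>R v i \<in> S"
    using insert.prems by (auto intro!: subspace_sum subspace_scale assms(2))
  then show ?case using insert assms(1) by (simp add: linear_on_subspace_def)
qed (use linear_on_subspace_zero[OF assms(1) subspace_0[OF assms(2)]] in simp_all)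

text \<open>\<open>Omega_n\<close> addresses a slot by updating a list. The split
  \<open>us @ v # ws\<close> fits recursion on the arguments and the addition of an argument in
  front.\<close>

definition alt_on :: "'v::real_vector set \<Rightarrow> nat \<Rightarrow> ('v list \<Rightarrow> real) \<Rightarrow> bool"
  where "alt_on S n F \<longleftrightarrow>
    (\<forall>us ws. length us + Suc (length ws) = n \<and> set us \<subseteq> S \<and> set ws \<subseteq> S \<longrightarrow>
      linear_on_subspace S (\<lambda>v. F (us @ v # ws))) \<and>
    (\<forall>vs. \<forall>i<n. \<forall>j<n. length vs = n \<and> set vs \<subseteq> S \<and> i \<noteq> j \<and> vs ! i = vs ! j \<longrightarrow> F vs = 0)"

lemma alt_on_linear:
  "alt_on S n F \<Longrightarrow> length us + Suc (length ws) = n \<Longrightarrow> set us \<subseteq> S \<Longrightarrow> set ws \<subseteq> S \<Longrightarrow>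
    linear_on_subspace S (\<lambda>v. F (us @ v # ws))"
  unfolding alt_on_def by blast

lemma alt_on_eq_zero:
  "alt_on S n F \<Longrightarrow> length vs = n \<Longrightarrow> set vs \<subseteq> S \<Longrightarrow> i < n \<Longrightarrow> j < n \<Longrightarrow> i \<noteq> j \<Longrightarrow>
    vs ! i = vs ! j \<Longrightarrow> F vs = 0"
  unfolding alt_on_def by blast

lemma alt_on_adjacent_zero:
  assumes "alt_on S n F" "length us + Suc (Suc (length ws)) = n" "set us \<subseteq> S" "set ws \<subseteq> S" "v \<in> S"
  shows "F (us @ v # v # ws) = 0"
  by (rule alt_on_eq_zero[OF assms(1), of _ "length us" "Suc (length us)"])
    (use assms in \<open>auto simp: nth_append\<close>)

text \<open>Polarization: the value with \<open>v + w\<close> in both slots vanishes, and so do the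
  two pure terms of its expansion.\<close>

lemma alt_on_swap:
  assumes "subspace S" "alt_on S n F" "length us + Suc (Suc (length ws)) = n"
    "set us \<subseteq> S" "set ws \<subseteq> S" "v \<in> S" "w \<in> S"
  shows "F (us @ v # w # ws) = - F (us @ w # v # ws)"
proof -
  have vw: "v + w \<in> S" using subspace_add[OF assms(1)] assms(6,7) by blast
  have l1: "F (us @ (v + w) # z # ws) = F (us @ v # z # ws) + F (us @ w # z # ws)" if "z \<in> S" for z
    using alt_on_linear[OF assms(2), of us "z # ws"] assms(3-7) that
    unfolding linear_on_subspace_def by simp
  have l2: "F (us @ z # (v + w) # ws) = F (us @ z # v # ws) + F (us @ z # w # ws)" if "z \<in> S" for z
    using alt_on_linear[OF assms(2), of "us @ [z]" ws] assms(3-7) that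
    unfolding linear_on_subspace_def by simp
  note z = alt_on_adjacent_zero[OF assms(2-5)]
  show ?thesis
    using z[OF vw] z[OF assms(6)] z[OF assms(7)] l1[OF vw] l2[OF assms(6)] l2[OF assms(7)] by simp
qed

lemma alt_on_move:
  assumes "subspace S" "alt_on S n F" "length us + Suc (length ws) = n" "set us \<subseteq> S" "set ws \<subseteq> S"
    "v \<in> S"
  shows "F (us @ v # ws) = (-1) ^ length us * F (v # us @ ws)"
  using assms(3-5)
proof (induction us arbitrary: ws rule: rev_induct)
  case (snoc u us)
  then have u: "u \<in> S" by simp
  have "F ((us @ [u]) @ v # ws) = - F (us @ v # u # ws)"
    using alt_on_swap[OF assms(1,2), of us ws u v] snoc.prems u assms(6) by simp
  then show ?case using snoc.IH[of "u # ws"] snoc.prems by simp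
qed simp

lemma alt_on_Cons:
  assumes "alt_on S (Suc n) F" "a \<in> S"
  shows "alt_on S n (\<lambda>vs. F (a # vs))"
  unfolding alt_on_def
proof (intro conjI allI impI)
  fix us ws assume "length us + Suc (length ws) = n \<and> set us \<subseteq> S \<and> set ws \<subseteq> S"
  then show "linear_on_subspace S (\<lambda>v. F (a # us @ v # ws))"
    using alt_on_linear[OF assms(1), of "a # us" ws] assms(2) by simp
next
  fix vs i j assume "i < n" "j < n" "length vs = n \<and> set vs \<subseteq> S \<and> i \<noteq> j \<and> vs ! i = vs ! j"
  then show "F (a # vs) = 0"
    using alt_on_eq_zero[OF assms(1), of "a # vs" "Suc i" "Suc j"] assms(2) by simp
qed

section \<open>Vector bundles and their forms\<close>

context
  fixes M :: "('m::{t2_space, second_countable_topology}, 'e::real_normed_vector) chart set"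
    and E :: "('m, 'v::real_vector, 'f::real_normed_vector, 'z) vector_bundle_scheme"
  assumes E: "smooth_vector_bundle M E"
begin

lemma finite_dim_fibre: "finite_dim TYPE('f)"
  and subspace_fib: "subspace (fib E x)"
  and triv_exists: "\<exists>u\<in>trivs E. x \<in> fst u"
  and open_triv: "u \<in> trivs E \<Longrightarrow> open (fst u)"
  using E unfolding smooth_vector_bundle_def by auto

lemma triv_linear: "u \<in> trivs E \<Longrightarrow> x \<in> fst u \<Longrightarrow> linear_on_subspace (fib E x) (snd u x)"
  and triv_bij: "u \<in> trivs E \<Longrightarrow> x \<in> fst u \<Longrightarrow> bij_betw (snd u x) (fib E x) UNIV"
  and triv_transition: "u \<in> trivs E \<Longrightarrow> w \<in> trivs E \<Longrightarrow>
    smooth_fun_on M (fst u \<inter> fst w) (\<lambda>x. snd w x (triv_inv E u x y))"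
  using E unfolding smooth_vector_bundle_def by blast+

lemma triv_inv_fib: "u \<in> trivs E \<Longrightarrow> x \<in> fst u \<Longrightarrow> triv_inv E u x y \<in> fib E x"
  and triv_triv_inv: "u \<in> trivs E \<Longrightarrow> x \<in> fst u \<Longrightarrow> snd u x (triv_inv E u x y) = y"
  and triv_inv_triv: "u \<in> trivs E \<Longrightarrow> x \<in> fst u \<Longrightarrow> v \<in> fib E x \<Longrightarrow> triv_inv E u x (snd u x v) = v"
  using triv_bij[of u x] unfolding triv_inv_def bij_betw_def
  by (auto intro: inv_into_into f_inv_into_f)

lemma triv_inv_linear:
  assumes u: "u \<in> trivs E" "x \<in> fst u"
  shows "linear (triv_inv E u x)"
proof (rule linearI)
  note l = triv_linear[OF u] and i = triv_inv_fib[OF u] and t = triv_triv_inv[OF u]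
  note inj = bij_betw_imp_inj_on[OF triv_bij[OF u]]
  show "triv_inv E u x (y + z) = triv_inv E u x y + triv_inv E u x z" for y z
    by (rule inj_onD[OF inj])
      (use l i in \<open>auto simp: t linear_on_subspace_def intro!: subspace_add[OF subspace_fib]\<close>)
  show "triv_inv E u x (k *\<^sub>R y) = k *\<^sub>R triv_inv E u x y" for k y
    by (rule inj_onD[OF inj])
      (use l i in \<open>auto simp: t linear_on_subspace_def intro!: subspace_scale[OF subspace_fib]\<close>)
qed

lemma triv_at: "triv_at E x \<in> trivs E" "x \<in> fst (triv_at E x)"
  using someI_ex[of "\<lambda>u. u \<in> trivs E \<and> x \<in> fst u"] triv_exists[of x] unfolding triv_at_def by blast+

lemma Omega_nD:
  assumes "\<eta> \<in> Omega_n M E n"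
  shows "\<not> (length vs = n \<and> set vs \<subseteq> fib E x) \<Longrightarrow> \<eta> x vs = 0"
    "alt_on (fib E x) n (\<eta> x)"
    "u \<in> trivs E \<Longrightarrow> length ys = n \<Longrightarrow> smooth_fun_on M (fst u) (\<lambda>x. \<eta> x (map (triv_inv E u x) ys))"
proof -
  note d = assms[unfolded Omega_n_def mem_Collect_eq]
  note d1 = d[THEN conjunct1] and d2 = d[THEN conjunct2, THEN conjunct1]
    and d3 = d[THEN conjunct2, THEN conjunct2, THEN conjunct1]
    and d4 = d[THEN conjunct2, THEN conjunct2, THEN conjunct2]
  show "\<not> (length vs = n \<and> set vs \<subseteq> fib E x) \<Longrightarrow> \<eta> x vs = 0"
    using d1[rule_format, of vs x] by blast
  show "u \<in> trivs E \<Longrightarrow> length ys = n \<Longrightarrow> smooth_fun_on M (fst u) (\<lambda>x. \<eta> x (map (triv_inv E u x) ys))"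
    using d4 by blast
  show "alt_on (fib E x) n (\<eta> x)" unfolding alt_on_def
  proof (intro conjI allI impI)
    fix us ws assume h: "length us + Suc (length ws) = n \<and> set us \<subseteq> fib E x \<and> set ws \<subseteq> fib E x"
    \<comment> \<open>The update formulation is applied to a list that holds the zero vector as a
      placeholder in the slot.\<close>
    then have "linear_on_subspace (fib E x) (\<lambda>v. \<eta> x ((us @ 0 # ws)[length us := v]))"
      by (intro d2[rule_format]) (use h subspace_0[OF subspace_fib, of x] in auto)
    then show "linear_on_subspace (fib E x) (\<lambda>v. \<eta> x (us @ v # ws))" by simp
  next
    fix vs i j assume "i < n" "j < n" "length vs = n \<and> set vs \<subseteq> fib E x \<and> i \<noteq> j \<and> vs ! i = vs ! j"
    then show "\<eta> x vs = 0" by (intro d3[rule_format, of i j vs x]) auto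
  qed
qed

lemma Omega_nI:
  assumes "\<And>x vs. \<not> (length vs = n \<and> set vs \<subseteq> fib E x) \<Longrightarrow> \<eta> x vs = 0"
    "\<And>x. alt_on (fib E x) n (\<eta> x)"
    "\<And>u ys. u \<in> trivs E \<Longrightarrow> length ys = n \<Longrightarrow> smooth_fun_on M (fst u) (\<lambda>x. \<eta> x (map (triv_inv E u x)
      ys))"
  shows "\<eta> \<in> Omega_n M E n"
proof -
  have "linear_on_subspace (fib E x) (\<lambda>v. \<eta> x (vs[i := v]))"
    if "i < n" "length vs = n" "set vs \<subseteq> fib E x" for x vs i
  proof -
    have "set (take i vs) \<subseteq> fib E x" "set (drop (Suc i) vs) \<subseteq> fib E x"
      using that(3) set_take_subset[of i vs] set_drop_subset[of "Suc i" vs] by blast+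
    then show ?thesis
      using alt_on_linear[OF assms(2)[of x], of "take i vs" "drop (Suc i) vs"] that
      by (simp add: upd_conv_take_nth_drop)
  qed
  moreover have "\<eta> x vs = 0"
    if "i < n" "j < n" "length vs = n" "set vs \<subseteq> fib E x" "i \<noteq> j" "vs ! i = vs ! j" for x vs i j
    using alt_on_eq_zero[OF assms(2)] that by blast
  ultimately show ?thesis
    unfolding Omega_n_def mem_Collect_eq using assms(1,3) by (intro conjI) blast+
qed

end

text \<open>Sections of \<open>E\<close> along a map \<open>f\<close> over a part \<open>W\<close>
  of the base, that is, sections of the pulled back bundle, which is not itself constructed. For
  \<open>f = id\<close> and \<open>W = UNIV\<close> they are the ordinary sections. The image of a
  section under a bundle homomorphism is of this kind.\<close>

definition local_section ::
  "('p::topological_space, 'd::real_normed_vector) chart set \<Rightarrow> 'p set \<Rightarrow>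
   ('m, 'v, 'f::real_normed_vector, 'z) vector_bundle_scheme \<Rightarrow> ('p \<Rightarrow> 'm) \<Rightarrow> ('p \<Rightarrow> 'v) \<Rightarrow> bool"
  where "local_section P W E f a \<longleftrightarrow> (\<forall>p\<in>W. a p \<in> fib E (f p)) \<and>
    (\<forall>u\<in>trivs E. smooth_fun_on P (W \<inter> f -` fst u) (\<lambda>p. snd u (f p) (a p)))"

lemma sections_iff: "a \<in> sections M E \<longleftrightarrow> local_section M UNIV E id a"
  by (simp add: sections_def local_section_def)

lemma local_section_subset:
  assumes "local_section P W E f a" "V \<subseteq> W"
  shows "local_section P V E f a"
  using assms smooth_fun_on_subset[of P "W \<inter> _" _ "V \<inter> _"] unfolding local_section_def by blast

section \<open>Sections along a map and the evaluation of forms on them\<close>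

context
  fixes P :: "('p::{t2_space, second_countable_topology}, 'd::real_normed_vector) chart set"
    and N :: "('m::{t2_space, second_countable_topology}, 'e::real_normed_vector) chart set"
    and f :: "'p \<Rightarrow> 'm"
    and E :: "('m, 'v::real_vector, 'f::real_normed_vector, 'z) vector_bundle_scheme"
  assumes P: "smooth_manifold P" and N: "smooth_manifold N" and f: "smooth_map P N f"
    and E: "smooth_vector_bundle N E"
begin

lemma open_vimage_triv: "u \<in> trivs E \<Longrightarrow> open (f -` fst u)"
  using f continuous_open_preimage[OF _ open_UNIV open_triv[OF E], of f u] unfolding smooth_map_def
    by simp

lemma local_section_add:
  assumes W: "open W" and "local_section P W E f a" "local_section P W E f b"
  shows "local_section P W E f (\<lambda>p. a p + b p)"
  unfolding local_section_def
proof (intro conjI ballI)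
  show "a p + b p \<in> fib E (f p)" if "p \<in> W" for p
    using assms that subspace_add[OF subspace_fib[OF E]] unfolding local_section_def by blast
  fix u assume u: "u \<in> trivs E"
  have o: "open (W \<inter> f -` fst u)" using W open_vimage_triv[OF u] by blast
  have "smooth_fun_on P (W \<inter> f -` fst u) (\<lambda>p. snd u (f p) (a p) + snd u (f p) (b p))"
    by (rule smooth_fun_on_add[OF P o]) (use assms u in \<open>auto simp: local_section_def\<close>)
  then show "smooth_fun_on P (W \<inter> f -` fst u) (\<lambda>p. snd u (f p) (a p + b p))"
    by (rule smooth_fun_on_cong[OF P o, rotated])
      (use assms triv_linear[OF E u] in \<open>auto simp: local_section_def linear_on_subspace_def\<close>)
qed

lemma local_section_scale:
  assumes W: "open W" and "smooth_fun_on P W k" "local_section P W E f a"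
  shows "local_section P W E f (\<lambda>p. k p *\<^sub>R a p)"
  unfolding local_section_def
proof (intro conjI ballI)
  show "k p *\<^sub>R a p \<in> fib E (f p)" if "p \<in> W" for p
    using assms that subspace_scale[OF subspace_fib[OF E]] unfolding local_section_def by blast
  fix u assume u: "u \<in> trivs E"
  have o: "open (W \<inter> f -` fst u)" using W open_vimage_triv[OF u] by blast
  have "smooth_fun_on P (W \<inter> f -` fst u) (\<lambda>p. k p *\<^sub>R snd u (f p) (a p))"
    by (rule smooth_fun_on_scaleR[OF P o smooth_fun_on_subset[OF assms(2)]])
      (use assms(3) u in \<open>auto simp: local_section_def\<close>)
  then show "smooth_fun_on P (W \<inter> f -` fst u) (\<lambda>p. snd u (f p) (k p *\<^sub>R a p))"
    by (rule smooth_fun_on_cong[OF P o, rotated])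
      (use assms(3) triv_linear[OF E u] in \<open>auto simp: local_section_def linear_on_subspace_def\<close>)
qed

lemma local_section_extend_zero:
  assumes \<theta>: "\<theta> \<in> smooth_functions P" "closed K" "K \<subseteq> W" "\<And>p. p \<notin> K \<Longrightarrow> \<theta> p = 0"
    and W: "open W" and a: "local_section P W E f a"
  shows "local_section P UNIV E f (\<lambda>p. \<theta> p *\<^sub>R a p)"
  unfolding local_section_def
proof (intro conjI ballI)
  show mem: "\<theta> p *\<^sub>R a p \<in> fib E (f p)" for p
  proof (cases "p \<in> W")
    case True
    then show ?thesis using a subspace_scale[OF subspace_fib[OF E]] unfolding local_section_def
      by blast
  next
    case False
    then have "\<theta> p = 0" using \<theta>(3,4) by blast
    then show ?thesis using subspace_0[OF subspace_fib[OF E]] by simp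
  qed
  fix u assume u: "u \<in> trivs E"
  note o = open_vimage_triv[OF u]
  have "smooth_fun_on P (f -` fst u) (\<lambda>p. \<theta> p *\<^sub>R snd u (f p) (a p))"
    by (rule smooth_fun_on_extend_zero[OF P \<theta> W o]) (use a u in \<open>auto simp: local_section_def\<close>)
  then have "smooth_fun_on P (f -` fst u) (\<lambda>p. snd u (f p) (\<theta> p *\<^sub>R a p))"
  proof (rule smooth_fun_on_cong[OF P o, rotated])
    fix p assume p: "p \<in> f -` fst u"
    have l: "linear_on_subspace (fib E (f p)) (snd u (f p))" using triv_linear[OF E u] p by blast
    show "\<theta> p *\<^sub>R snd u (f p) (a p) = snd u (f p) (\<theta> p *\<^sub>R a p)"
    proof (cases "p \<in> W")
      case True
      then show ?thesis using l a unfolding local_section_def linear_on_subspace_def by auto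
    next
      case False
      then have "\<theta> p = 0" using \<theta>(3,4) by blast
      then show ?thesis using linear_on_subspace_zero[OF l subspace_0[OF subspace_fib[OF E]]]
        by simp
    qed
  qed
  then show "smooth_fun_on P (UNIV \<inter> f -` fst u) (\<lambda>p. snd u (f p) (\<theta> p *\<^sub>R a p))" by simp
qed

text \<open>One slot at a time, a smooth coordinate vector is expanded in a constant basis.\<close>

lemma smooth_form_coords:
  assumes \<eta>: "\<eta> \<in> Omega_n N E n" and u: "u \<in> trivs E" and W: "open W" "f ` W \<subseteq> fst u"
    and "length xs + length ys = n" "\<And>\<xi>. \<xi> \<in> set xs \<Longrightarrow> smooth_fun_on P W \<xi>"
  shows "smooth_fun_on P W (\<lambda>p. \<eta> (f p)
    (map (\<lambda>\<xi>. triv_inv E u (f p) (\<xi> p)) xs @ map (triv_inv E u (f p)) ys))"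
  using assms(5,6)
proof (induction xs arbitrary: ys rule: rev_induct)
  case Nil
  then have "smooth_fun_on N (fst u) (\<lambda>x. \<eta> x (map (triv_inv E u x) ys))"
    using Omega_nD(3)[OF E \<eta> u] by simp
  from smooth_fun_on_compose[OF P N f this open_triv[OF E u] W] show ?case by simp
next
  case (snoc \<xi> xs)
  obtain r and e :: "nat \<Rightarrow> 'f" and \<kappa> where cs: "coord_system r e \<kappa>"
    using coord_system_exists[OF finite_dim_fibre[OF E]] .
  let ?us = "\<lambda>p. map (\<lambda>\<xi>. triv_inv E u (f p) (\<xi> p)) xs" and ?ws = "\<lambda>p. map (triv_inv E u (f p)) ys"
  have "smooth_fun_on P W (\<lambda>p. \<Sum>i<r. \<kappa> i (\<xi> p) *\<^sub>R \<eta> (f p) (?us p @ triv_inv E u (f p) (e i) # ?ws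
    p))"
  proof (rule smooth_fun_on_sum[OF P W(1)], rule smooth_fun_on_scaleR[OF P W(1)])
    fix i assume "i \<in> {..<r}"
    then show "smooth_fun_on P W (\<lambda>p. \<kappa> i (\<xi> p))"
      using snoc.prems(2) by (intro smooth_fun_on_linear_compose[OF P W(1) coord_systemD(1)[OF cs]])
        auto
    show "smooth_fun_on P W (\<lambda>p. \<eta> (f p) (?us p @ triv_inv E u (f p) (e i) # ?ws p))"
      using snoc.IH[of "e i # ys"] snoc.prems by simp
  qed
  then show ?case
  proof (rule smooth_fun_on_cong[OF P W(1), rotated])
    fix p assume p: "p \<in> W"
    then have fp: "f p \<in> fst u" using W(2) by blast
    note t = triv_inv_fib[OF E u fp]
    note l = triv_inv_linear[OF E u fp]
    have "triv_inv E u (f p) (\<xi> p) = triv_inv E u (f p) (\<Sum>i<r. \<kappa> i (\<xi> p) *\<^sub>R e i)"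
      by (simp add: coord_systemD(2)[OF cs])
    also have "\<dots> = (\<Sum>i<r. \<kappa> i (\<xi> p) *\<^sub>R triv_inv E u (f p) (e i))"
      by (simp add: linear_sum[OF l] linear_cmul[OF l])
    finally have eq: "triv_inv E u (f p) (\<xi> p) = (\<Sum>i<r. \<kappa> i (\<xi> p) *\<^sub>R triv_inv E u (f p) (e i))" .
    have "linear_on_subspace (fib E (f p)) (\<lambda>v. \<eta> (f p) (?us p @ v # ?ws p))"
      by (rule alt_on_linear[OF Omega_nD(2)[OF E \<eta>]]) (use snoc.prems t in auto)
    from linear_on_subspace_sum[OF this subspace_fib[OF E] t, of "\<lambda>i. \<kappa> i (\<xi> p)" e "{..<r}",
      symmetric]
    show "(\<Sum>i<r. \<kappa> i (\<xi> p) *\<^sub>R \<eta> (f p) (?us p @ triv_inv E u (f p) (e i) # ?ws p)) =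
        \<eta> (f p) (map (\<lambda>\<xi>. triv_inv E u (f p) (\<xi> p)) (xs @ [\<xi>]) @ ?ws p)"
      by (simp add: eq)
  qed
qed

text \<open>In a trivialization around \<open>f p\<close> the sections become smooth coordinate
  vectors, and \<open>smooth_form_coords\<close> applies with no constant slots left.\<close>

lemma smooth_form_eval:
  assumes \<eta>: "\<eta> \<in> Omega_n N E n" and W: "open W" and as: "\<And>a. a \<in> set as \<Longrightarrow> local_section P W E f a"
  shows "smooth_fun_on P W (\<lambda>p. \<eta> (f p) (map (\<lambda>a. a p) as))"
proof (cases "length as = n")
  case False
  \<comment> \<open>On lists of the wrong length a form of degree \<open>n\<close> is zero by
    convention.\<close>
  then show ?thesis using Omega_nD(1)[OF E \<eta>] by (simp add: smooth_fun_on_const[OF P])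
next
  case True
  show ?thesis
  proof (rule smooth_fun_on_local[OF P])
    fix p assume p: "p \<in> W"
    obtain u where u: "u \<in> trivs E" "f p \<in> fst u" using triv_exists[OF E] by blast
    let ?V = "W \<inter> f -` fst u"
    have V: "open ?V" "f ` ?V \<subseteq> fst u" using W open_vimage_triv[OF u(1)] by auto
    have "smooth_fun_on P ?V (\<lambda>p. \<eta> (f p)
      (map (\<lambda>\<xi>. triv_inv E u (f p) (\<xi> p)) (map (\<lambda>a p. snd u (f p) (a p)) as) @ map (triv_inv E u
        (f p)) []))"
      by (rule smooth_form_coords[OF \<eta> u(1) V]) (use True as u(1) in \<open>auto simp: local_section_def\<close>)
    then have "smooth_fun_on P ?V (\<lambda>p. \<eta> (f p) (map (\<lambda>a. a p) as))"
    proof (rule smooth_fun_on_cong[OF P V(1), rotated])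
      fix q assume q: "q \<in> ?V"
      have "map (\<lambda>\<xi>. triv_inv E u (f q) (\<xi> q)) (map (\<lambda>a p. snd u (f p) (a p)) as) = map (\<lambda>a. a q)
        as"
        using q as by (auto simp: local_section_def intro!: triv_inv_triv[OF E u(1)])
      then show "\<eta> (f q) (map (\<lambda>\<xi>. triv_inv E u (f q) (\<xi> q)) (map (\<lambda>a p. snd u (f p) (a p)) as)
          @ map (triv_inv E u (f q)) []) = \<eta> (f q) (map (\<lambda>a. a q) as)" by (simp only: list.map(1)
            append_Nil2)
    qed
    then show "\<exists>V. open V \<and> p \<in> V \<and> smooth_fun_on P V (\<lambda>p. \<eta> (f p) (map (\<lambda>a. a p) as))"
      using V(1) p u(2) by blast
  qed
qed

end

section \<open>Global sections with prescribed local behaviour\<close>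

context
  fixes N :: "('m::{t2_space, second_countable_topology}, 'e::real_normed_vector) chart set"
    and E :: "('m, 'v::real_vector, 'f::real_normed_vector, 'z) vector_bundle_scheme"
  assumes N: "smooth_manifold N" and E: "smooth_vector_bundle N E"
begin

lemma local_section_triv_inv: "u \<in> trivs E \<Longrightarrow> local_section N (fst u) E id (\<lambda>x. triv_inv E u x y)"
  unfolding local_section_def using triv_inv_fib[OF E] triv_transition[OF E] by simp

text \<open>The same \<open>\<theta>\<close> serves all coordinate vectors \<open>w\<close>, so that
  a whole local frame becomes global at once and is unchanged on the common neighbourhood
  \<open>V\<close>.\<close>

lemma bump_section:
  assumes "u \<in> trivs E" "x \<in> fst u"
  obtains \<theta> V where "\<theta> \<in> smooth_functions N" "open V" "x \<in> V" "V \<subseteq> fst u" "\<And>y. y \<in> V \<Longrightarrow> \<theta> y = 1"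
    "\<And>w. (\<lambda>y. \<theta> y *\<^sub>R triv_inv E u y w) \<in> sections N E"
proof -
  obtain \<theta> K V where b: "\<theta> \<in> smooth_functions N" "closed K" "K \<subseteq> fst u" "\<And>y. y \<notin> K \<Longrightarrow> \<theta> y = 0"
    "open V" "x \<in> V" "\<And>y. y \<in> V \<Longrightarrow> \<theta> y = 1"
    by (rule bump_function[OF N open_triv[OF E assms(1)] assms(2)]) blast
  have "V \<subseteq> fst u" using b(3,4,7) by fastforce
  moreover have "(\<lambda>y. \<theta> y *\<^sub>R triv_inv E u y w) \<in> sections N E" for w
    unfolding sections_iff
    by (rule local_section_extend_zero[OF N N smooth_map_id[OF N] E b(1-4) open_triv[OF E assms(1)]
          local_section_triv_inv[OF assms(1)]])
  ultimately show thesis using that b by blast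
qed

lemma section_through:
  assumes "v \<in> fib E x"
  obtains a where "a \<in> sections N E" "a x = v"
proof -
  obtain u where u: "u \<in> trivs E" "x \<in> fst u" using triv_exists[OF E] by blast
  obtain \<theta> V where b: "x \<in> V" "\<And>y. y \<in> V \<Longrightarrow> \<theta> y = 1"
    "\<And>w. (\<lambda>y. \<theta> y *\<^sub>R triv_inv E u y w) \<in> sections N E"
    by (rule bump_section[OF u]) blast
  show thesis
    by (rule that[OF b(3)[of "snd u x v"]]) (use b triv_inv_triv[OF E u assms] in simp)
qed

end

text \<open>The bracket condition for homomorphisms speaks about global decompositions only; the bump
  function provides them.\<close>

lemma decomposition_along:
  fixes P :: "('p::{t2_space, second_countable_topology}, 'd::real_normed_vector) chart set"
    and N :: "('m::{t2_space, second_countable_topology}, 'e::real_normed_vector) chart set"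
    and E :: "('m, 'v::real_vector, 'f::real_normed_vector, 'z) vector_bundle_scheme"
  assumes P: "smooth_manifold P" and N: "smooth_manifold N" and f: "smooth_map P N f"
    and E: "smooth_vector_bundle N E"
  obtains \<theta> V and r :: nat and \<epsilon> where "\<theta> \<in> smooth_functions P" "open V" "p \<in> V" "\<And>q. q \<in> V \<Longrightarrow> \<theta> q =
    1"
    "\<And>i. i < r \<Longrightarrow> \<epsilon> i \<in> sections N E"
    "\<And>a. local_section P UNIV E f a \<Longrightarrow> \<exists>c. (\<forall>i<r. c i \<in> smooth_functions P) \<and>
      (\<forall>q. \<theta> q *\<^sub>R a q = (\<Sum>i<r. c i q *\<^sub>R \<epsilon> i (f q))) \<and> (\<forall>q. a q = 0 \<longrightarrow> (\<forall>i<r. c i q = 0))"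
proof -
  obtain r and e :: "nat \<Rightarrow> 'f" and \<kappa> where cs: "coord_system r e \<kappa>"
    using coord_system_exists[OF finite_dim_fibre[OF E]] .
  obtain u where u: "u \<in> trivs E" "f p \<in> fst u" using triv_exists[OF E] by blast
  obtain \<beta> V0 where b: "open V0" "f p \<in> V0" "V0 \<subseteq> fst u" "\<And>y. y \<in> V0 \<Longrightarrow> \<beta> y = 1"
    "\<And>w. (\<lambda>y. \<beta> y *\<^sub>R triv_inv E u y w) \<in> sections N E"
    by (rule bump_section[OF N E u]) blast
  have oU: "open (f -` V0)"
    using f continuous_open_preimage[OF _ open_UNIV b(1), of f] unfolding smooth_map_def by simp
  obtain \<theta> K V where t: "\<theta> \<in> smooth_functions P" "closed K" "K \<subseteq> f -` V0" "\<And>y. y \<notin> K \<Longrightarrow> \<theta> y = 0"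
    "open V" "p \<in> V" "\<And>y. y \<in> V \<Longrightarrow> \<theta> y = 1"
    by (rule bump_function[OF P oU]) (use b(2) in auto)
  \<comment> \<open>Two cut-offs occur: \<open>\<beta>\<close> on \<open>N\<close> makes the local
    frame global, and \<open>\<theta>\<close> on \<open>P\<close> vanishes except where
    \<open>\<beta> \<circ> f\<close> is 1. The factor \<open>\<beta>\<close> therefore does not
    disturb the expansion of \<open>\<theta> q *\<^sub>R a q\<close>.\<close>
  let ?\<epsilon> = "\<lambda>i y. \<beta> y *\<^sub>R triv_inv E u y (e i)"
  have "\<exists>c. (\<forall>i<r. c i \<in> smooth_functions P) \<and> (\<forall>q. \<theta> q *\<^sub>R a q = (\<Sum>i<r. c i q *\<^sub>R ?\<epsilon> i (f q))) \<and>
      (\<forall>q. a q = 0 \<longrightarrow> (\<forall>i<r. c i q = 0))"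
    if a: "local_section P UNIV E f a" for a
  proof -
    let ?c = "\<lambda>i q. \<theta> q *\<^sub>R \<kappa> i (snd u (f q) (a q))"
    have "smooth_fun_on P UNIV (?c i)" if "i < r" for i
    proof (rule smooth_fun_on_extend_zero[OF P t(1-4) oU open_UNIV], unfold Int_UNIV_right)
      have "smooth_fun_on P (f -` V0) (\<lambda>q. snd u (f q) (a q))"
        by (rule smooth_fun_on_subset[of _ "UNIV \<inter> f -` fst u"])
          (use a u(1) b(3) in \<open>auto simp: local_section_def\<close>)
      then show "smooth_fun_on P (f -` V0) (\<lambda>q. \<kappa> i (snd u (f q) (a q)))"
        by (rule smooth_fun_on_linear_compose[OF P oU coord_systemD(1)[OF cs that]])
    qed
    moreover have "\<theta> q *\<^sub>R a q = (\<Sum>i<r. ?c i q *\<^sub>R ?\<epsilon> i (f q))" for q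
    proof (cases "f q \<in> V0")
      case True
      then have fq: "f q \<in> fst u" using b(3) by blast
      note l = triv_inv_linear[OF E u(1) fq]
      let ?y = "snd u (f q) (a q)"
      have "a q = triv_inv E u (f q) ?y"
        using triv_inv_triv[OF E u(1) fq] a unfolding local_section_def by simp
      also have "\<dots> = triv_inv E u (f q) (\<Sum>i<r. \<kappa> i ?y *\<^sub>R e i)" by (simp add: coord_systemD(2)[OF
        cs])
      also have "\<dots> = (\<Sum>i<r. \<kappa> i ?y *\<^sub>R triv_inv E u (f q) (e i))"
        by (simp add: linear_sum[OF l] linear_cmul[OF l])
      finally have "\<theta> q *\<^sub>R a q = \<theta> q *\<^sub>R (\<Sum>i<r. \<kappa> i ?y *\<^sub>R triv_inv E u (f q) (e i))"
        by (rule arg_cong)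
      then show ?thesis by (simp add: scaleR_sum_right b(4)[OF True])
    next
      case False
      then have "\<theta> q = 0" using t(3,4) by blast
      then show ?thesis by simp
    qed
    \<comment> \<open>The coefficients vanish wherever the section does. This yields the dependence
      of the Koszul expression on pointwise values.\<close>
    moreover have "?c i q = 0" if "i < r" "a q = 0" for i q
    proof (cases "f q \<in> V0")
      case True
      then have "f q \<in> fst u" using b(3) by blast
      then have "snd u (f q) 0 = 0"
        using linear_on_subspace_zero[OF triv_linear[OF E u(1)] subspace_0[OF subspace_fib[OF E]]]
          by blast
      then show ?thesis using that linear_0[OF bounded_linear.linear[OF coord_systemD(1)[OF cs]]]
        by simp
    next
      case False
      then have "\<theta> q = 0" using t(3,4) by blast
      then show ?thesis by simp
    qed
    ultimately show ?thesis by (intro exI[of _ ?c] conjI allI impI) (simp_all only: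
      smooth_functions_iff)
  qed
  from that[OF t(1,5,6,7) b(5) this] show thesis .
qed

section \<open>Bundle homomorphisms and pullback of forms\<close>

lemma vb_homD:
  assumes "vb_hom P A N B f \<Phi>"
  shows "smooth_map P N f" "v \<in> fib A x \<Longrightarrow> fst (\<Phi> (x, v)) = f x"
    "v \<in> fib A x \<Longrightarrow> snd (\<Phi> (x, v)) \<in> fib B (f x)"
    "linear_on_subspace (fib A x) (\<lambda>v. snd (\<Phi> (x, v)))"
    "u \<in> trivs A \<Longrightarrow> w \<in> trivs B \<Longrightarrow> smooth_fun_on P (fst u \<inter> f -` fst w)
      (\<lambda>x. snd w (f x) (snd (\<Phi> (x, triv_inv A u x y))))"
  using assms unfolding vb_hom_def by blast+

lemma base_map_vb_hom:
  fixes P :: "('p::{t2_space, second_countable_topology}, 'd::real_normed_vector) chart set"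
    and A :: "('p, 'v::real_vector, 'f::real_normed_vector, 'z) vector_bundle_scheme"
  assumes "vb_hom P A N B f \<Phi>" "smooth_vector_bundle P A"
  shows "base_map \<Phi> = f"
  using vb_homD(2)[OF assms(1) subspace_0[OF subspace_fib[OF assms(2)]]]
  by (simp add: base_map_def fun_eq_iff)

text \<open>The assumptions on \<open>B\<close> are few in order to include the tangent bundle without a proof that its
  transition maps are smooth.\<close>

lemma local_section_hom:
  fixes P :: "('p::{t2_space, second_countable_topology}, 'd::real_normed_vector) chart set"
    and A :: "('p, 'v::real_vector, 'f::real_normed_vector, 'z) vector_bundle_scheme"
    and B :: "('n::topological_space, 'w::real_vector, 'g::real_normed_vector, 'y)
      vector_bundle_scheme"
  assumes P: "smooth_manifold P" and A: "smooth_vector_bundle P A" and \<Phi>: "vb_hom P A N B f \<Phi>"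
    and ow: "\<And>w. w \<in> trivs B \<Longrightarrow> open (fst w)"
    and lin: "\<And>w y. w \<in> trivs B \<Longrightarrow> y \<in> fst w \<Longrightarrow> linear_on_subspace (fib B y) (snd w y)"
    and sub: "\<And>y. subspace (fib B y)"
    and W: "open W" and a: "local_section P W A id a"
  shows "local_section P W B f (\<lambda>p. snd (\<Phi> (p, a p)))"
  unfolding local_section_def
proof (intro conjI ballI)
  show "snd (\<Phi> (p, a p)) \<in> fib B (f p)" if "p \<in> W" for p
    using vb_homD(3)[OF \<Phi>] a that unfolding local_section_def by simp
  fix w assume w: "w \<in> trivs B"
  have contf: "continuous_on UNIV f" using vb_homD(1)[OF \<Phi>] unfolding smooth_map_def by blast
  have ov: "open (f -` fst w)" using continuous_open_preimage[OF contf open_UNIV ow[OF w]] by simp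
  obtain r and e :: "nat \<Rightarrow> 'f" and \<kappa> where cs: "coord_system r e \<kappa>"
    using coord_system_exists[OF finite_dim_fibre[OF A]] .
  show "smooth_fun_on P (W \<inter> f -` fst w) (\<lambda>p. snd w (f p) (snd (\<Phi> (p, a p))))"
  proof (rule smooth_fun_on_local[OF P])
    fix p assume p: "p \<in> W \<inter> f -` fst w"
    obtain u where u: "u \<in> trivs A" "p \<in> fst u" using triv_exists[OF A] by blast
    let ?V = "W \<inter> f -` fst w \<inter> fst u"
    have oV: "open ?V" using W ov open_triv[OF A u(1)] by blast
    have "smooth_fun_on P ?V (\<lambda>p. \<Sum>i<r. \<kappa> i (snd u p (a p)) *\<^sub>R snd w (f p)
      (snd (\<Phi> (p, triv_inv A u p (e i)))))"
    proof (rule smooth_fun_on_sum[OF P oV], rule smooth_fun_on_scaleR[OF P oV])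
      fix i assume i: "i \<in> {..<r}"
      have "smooth_fun_on P ?V (\<lambda>p. snd u p (a p))"
        by (rule smooth_fun_on_subset[of _ "W \<inter> id -` fst u"])
          (use a u(1) in \<open>auto simp: local_section_def\<close>)
      then show "smooth_fun_on P ?V (\<lambda>p. \<kappa> i (snd u p (a p)))"
        using i by (intro smooth_fun_on_linear_compose[OF P oV coord_systemD(1)[OF cs]]) auto
      show "smooth_fun_on P ?V (\<lambda>p. snd w (f p) (snd (\<Phi> (p, triv_inv A u p (e i)))))"
        by (rule smooth_fun_on_subset[OF vb_homD(5)[OF \<Phi> u(1) w]]) blast
    qed
    then have "smooth_fun_on P ?V (\<lambda>p. snd w (f p) (snd (\<Phi> (p, a p))))"
    proof (rule smooth_fun_on_cong[OF P oV, rotated])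
      fix q assume q: "q \<in> ?V"
      then have qu: "q \<in> fst u" and qw: "f q \<in> fst w" by auto
      note l = triv_inv_linear[OF A u(1) qu] and t = triv_inv_fib[OF A u(1) qu]
      let ?y = "snd u q (a q)"
      have "a q \<in> fib A q" using a q by (simp add: local_section_def)
      then have "a q = triv_inv A u q ?y" using triv_inv_triv[OF A u(1) qu] by simp
      also have "\<dots> = triv_inv A u q (\<Sum>i<r. \<kappa> i ?y *\<^sub>R e i)" by (simp add: coord_systemD(2)[OF cs])
      also have "\<dots> = (\<Sum>i<r. \<kappa> i ?y *\<^sub>R triv_inv A u q (e i))"
        by (simp add: linear_sum[OF l] linear_cmul[OF l])
      finally have "snd (\<Phi> (q, a q)) = snd (\<Phi> (q, \<Sum>i<r. \<kappa> i ?y *\<^sub>R triv_inv A u q (e i)))"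
        by (rule arg_cong)
      also have "\<dots> = (\<Sum>i<r. \<kappa> i ?y *\<^sub>R snd (\<Phi> (q, triv_inv A u q (e i))))"
        by (rule linear_on_subspace_sum[OF vb_homD(4)[OF \<Phi>] subspace_fib[OF A] t])
      finally have "snd w (f q) (snd (\<Phi> (q, a q))) =
          snd w (f q) (\<Sum>i<r. \<kappa> i ?y *\<^sub>R snd (\<Phi> (q, triv_inv A u q (e i))))" by (rule arg_cong)
      also have "\<dots> = (\<Sum>i<r. \<kappa> i ?y *\<^sub>R snd w (f q) (snd (\<Phi> (q, triv_inv A u q (e i)))))"
        by (rule linear_on_subspace_sum[OF lin[OF w qw] sub vb_homD(3)[OF \<Phi> t]])
      finally show "(\<Sum>i<r. \<kappa> i ?y *\<^sub>R snd w (f q) (snd (\<Phi> (q, triv_inv A u q (e i))))) =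
          snd w (f q) (snd (\<Phi> (q, a q)))" by simp
    qed
    then show "\<exists>V. open V \<and> p \<in> V \<and> smooth_fun_on P V (\<lambda>p. snd w (f p) (snd (\<Phi> (p, a p))))"
      using oV p u(2) by blast
  qed
qed

lemma alt_on_compose:
  assumes "alt_on T n F" "linear_on_subspace S g" "\<And>v. v \<in> S \<Longrightarrow> g v \<in> T" "subspace S"
  shows "alt_on S n (\<lambda>vs. F (map g vs))"
  unfolding alt_on_def
proof (intro conjI allI impI)
  fix us ws assume h: "length us + Suc (length ws) = n \<and> set us \<subseteq> S \<and> set ws \<subseteq> S"
  have "linear_on_subspace T (\<lambda>v. F (map g us @ v # map g ws))"
    by (rule alt_on_linear[OF assms(1)]) (use h assms(3) in auto)
  then show "linear_on_subspace S (\<lambda>v. F (map g (us @ v # ws)))"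
    using assms(2,3) unfolding linear_on_subspace_def by simp
next
  fix vs i j assume ij: "i < n" "j < n" "length vs = n \<and> set vs \<subseteq> S \<and> i \<noteq> j \<and> vs ! i = vs ! j"
  show "F (map g vs) = 0"
    by (rule alt_on_eq_zero[OF assms(1), of _ i j]) (use ij assms(3) in auto)
qed

lemma alt_on_cong:
  assumes "alt_on S n F" "\<And>vs. length vs = n \<Longrightarrow> set vs \<subseteq> S \<Longrightarrow> F vs = G vs" "subspace S"
  shows "alt_on S n G"
  unfolding alt_on_def
proof (intro conjI allI impI)
  fix us ws assume h: "length us + Suc (length ws) = n \<and> set us \<subseteq> S \<and> set ws \<subseteq> S"
  show "linear_on_subspace S (\<lambda>v. G (us @ v # ws))"
    by (rule linear_on_subspace_cong[OF assms(3) _ alt_on_linear[OF assms(1)]]) (use h assms(2) in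
      auto)
next
  fix vs i j assume ij: "i < n" "j < n" "length vs = n \<and> set vs \<subseteq> S \<and> i \<noteq> j \<and> vs ! i = vs ! j"
  then show "G vs = 0" using assms(2)[of vs] alt_on_eq_zero[OF assms(1), of vs i j] by simp
qed

text \<open>Alternation is inherited through the linear fibre maps. Smoothness is tested on local
  frames of \<open>A\<close>, whose images are sections of \<open>B\<close> along
  \<open>f\<close>.\<close>

lemma pullback_Omega_n:
  fixes P :: "('p::{t2_space, second_countable_topology}, 'd::real_normed_vector) chart set"
    and A :: "('p, 'v::real_vector, 'f::real_normed_vector, 'z) vector_bundle_scheme"
    and N :: "('n::{t2_space, second_countable_topology}, 'e::real_normed_vector) chart set"
    and B :: "('n, 'w::real_vector, 'g::real_normed_vector, 'y) vector_bundle_scheme"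
  assumes P: "smooth_manifold P" and N: "smooth_manifold N"
    and A: "smooth_vector_bundle P A" and B: "smooth_vector_bundle N B"
    and \<Phi>: "vb_hom P A N B f \<Phi>" and \<eta>: "\<eta> \<in> Omega_n N B n"
  shows "pullback A \<Phi> \<eta> \<in> Omega_n P A n"
proof (rule Omega_nI[OF A])
  note bm = base_map_vb_hom[OF \<Phi> A]
  show "pullback A \<Phi> \<eta> x vs = 0" if "\<not> (length vs = n \<and> set vs \<subseteq> fib A x)" for x vs
    using that Omega_nD(1)[OF B \<eta>] by (auto simp: pullback_def)
  show "alt_on (fib A x) n (pullback A \<Phi> \<eta> x)" for x
  proof (rule alt_on_cong[OF _ _ subspace_fib[OF A]])
    show "alt_on (fib A x) n (\<lambda>vs. \<eta> (f x) (map (\<lambda>v. snd (\<Phi> (x, v))) vs))"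
      by (rule alt_on_compose[OF Omega_nD(2)[OF B \<eta>] vb_homD(4)[OF \<Phi>] vb_homD(3)[OF \<Phi>]
        subspace_fib[OF A]])
    fix vs assume "set vs \<subseteq> fib A x"
    then show "\<eta> (f x) (map (\<lambda>v. snd (\<Phi> (x, v))) vs) = pullback A \<Phi> \<eta> x vs"
      by (simp add: pullback_def bm)
  qed
  fix u and ys :: "'f list" assume u: "u \<in> trivs A"
  note ou = open_triv[OF A u]
  have "smooth_fun_on P (fst u) (\<lambda>p. \<eta> (f p) (map (\<lambda>a. a p)
    (map (\<lambda>y p. snd (\<Phi> (p, triv_inv A u p y))) ys)))"
  proof (rule smooth_form_eval[OF P N vb_homD(1)[OF \<Phi>] B \<eta> ou])
    fix a assume "a \<in> set (map (\<lambda>y p. snd (\<Phi> (p, triv_inv A u p y))) ys)"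
    then obtain y where a: "a = (\<lambda>p. snd (\<Phi> (p, triv_inv A u p y)))" by auto
    show "local_section P (fst u) B f a" unfolding a
      by (rule local_section_hom[OF P A \<Phi> open_triv[OF B] triv_linear[OF B] subspace_fib[OF B] ou
            local_section_triv_inv[OF P A u]])
  qed
  then show "smooth_fun_on P (fst u) (\<lambda>x. pullback A \<Phi> \<eta> x (map (triv_inv A u x) ys))"
  proof (rule smooth_fun_on_cong[OF P ou, rotated])
    fix x assume x: "x \<in> fst u"
    have "set (map (triv_inv A u x) ys) \<subseteq> fib A x" using triv_inv_fib[OF A u x] by auto
    then show "\<eta> (f x) (map (\<lambda>a. a x) (map (\<lambda>y p. snd (\<Phi> (p, triv_inv A u p y))) ys)) =
        pullback A \<Phi> \<eta> x (map (triv_inv A u x) ys)"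
      by (simp add: pullback_def bm o_def)
  qed
qed

section \<open>Inhomogeneous forms\<close>

lemma component_add: "component n (\<eta> + \<omega>) = component n \<eta> + component n \<omega>"
  and component_scaleR: "component n (k *\<^sub>R \<eta>) = k *\<^sub>R component n \<eta>"
  and component_zero: "component n 0 = 0"
  by (auto simp: component_def fun_eq_iff scaleR_fun_def)

lemma component_Omega: "\<eta> \<in> Omega M E \<Longrightarrow> component n \<eta> \<in> Omega_n M E n"
  by (simp add: Omega_def)

context
  fixes M :: "('m::{t2_space, second_countable_topology}, 'e::real_normed_vector) chart set"
    and E :: "('m, 'v::real_vector, 'f::real_normed_vector, 'z) vector_bundle_scheme"
  assumes M: "smooth_manifold M" and E: "smooth_vector_bundle M E"
begin

lemma Omega_vanish:
  assumes "\<eta> \<in> Omega M E" "\<not> set vs \<subseteq> fib E x"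
  shows "\<eta> x vs = 0"
proof -
  have "component (length vs) \<eta> x vs = 0"
    by (rule Omega_nD(1)[OF E component_Omega[OF assms(1)]]) (use assms(2) in blast)
  then show ?thesis by (simp add: component_def)
qed

lemma Omega_alt_on:
  assumes "\<eta> \<in> Omega M E"
  shows "alt_on (fib E x) n (\<eta> x)"
  by (rule alt_on_cong[OF Omega_nD(2)[OF E component_Omega[OF assms]] _ subspace_fib[OF E]])
    (simp add: component_def)

lemma subspace_Omega_n: "subspace (Omega_n M E n)"
proof (rule subspaceI)
  have o: "open (fst u)" if "u \<in> trivs E" for u using open_triv[OF E that] .
  show "0 \<in> Omega_n M E n"
    by (rule Omega_nI[OF E]) (auto simp: alt_on_def linear_on_subspace_def smooth_fun_on_const[OF
      M])
  show "\<eta> + \<omega> \<in> Omega_n M E n" if h: "\<eta> \<in> Omega_n M E n" "\<omega> \<in> Omega_n M E n" for \<eta> \<omega>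
  proof (rule Omega_nI[OF E])
    show "(\<eta> + \<omega>) x vs = 0" if "\<not> (length vs = n \<and> set vs \<subseteq> fib E x)" for x vs
      using Omega_nD(1)[OF E h(1) that] Omega_nD(1)[OF E h(2) that] by simp
    show "alt_on (fib E x) n ((\<eta> + \<omega>) x)" for x
      using Omega_nD(2)[OF E h(1), of x] Omega_nD(2)[OF E h(2), of x]
      unfolding alt_on_def linear_on_subspace_def by (simp add: algebra_simps)
    show "smooth_fun_on M (fst u) (\<lambda>x. (\<eta> + \<omega>) x (map (triv_inv E u x) ys))"
      if "u \<in> trivs E" "length ys = n" for u ys
      using smooth_fun_on_add[OF M o Omega_nD(3)[OF E h(1)] Omega_nD(3)[OF E h(2)]] that by simp
  qed
  show "k *\<^sub>R \<eta> \<in> Omega_n M E n" if h: "\<eta> \<in> Omega_n M E n" for \<eta> k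
  proof (rule Omega_nI[OF E])
    show "(k *\<^sub>R \<eta>) x vs = 0" if "\<not> (length vs = n \<and> set vs \<subseteq> fib E x)" for x vs
      using Omega_nD(1)[OF E h that] by (simp add: scaleR_fun_def)
    show "alt_on (fib E x) n ((k *\<^sub>R \<eta>) x)" for x
      using Omega_nD(2)[OF E h, of x]
      unfolding alt_on_def linear_on_subspace_def by (simp add: scaleR_fun_def algebra_simps)
    show "smooth_fun_on M (fst u) (\<lambda>x. (k *\<^sub>R \<eta>) x (map (triv_inv E u x) ys))"
      if "u \<in> trivs E" "length ys = n" for u ys
      using smooth_fun_on_scaleR[OF M o smooth_fun_on_const[OF M] Omega_nD(3)[OF E h]] that
      by (simp add: scaleR_fun_def)
  qed
qed

lemma subspace_Omega: "subspace (Omega M E)"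
proof (rule subspaceI)
  show "0 \<in> Omega M E"
    unfolding Omega_def using subspace_0[OF subspace_Omega_n] by (simp add: component_zero)
  show "\<eta> + \<omega> \<in> Omega M E" if "\<eta> \<in> Omega M E" "\<omega> \<in> Omega M E" for \<eta> \<omega>
  proof -
    have "finite ({n. component n \<eta> \<noteq> 0} \<union> {n. component n \<omega> \<noteq> 0})"
      using that unfolding Omega_def by simp
    then have "finite {n. component n (\<eta> + \<omega>) \<noteq> 0}"
      by (rule rev_finite_subset) (auto simp: component_add)
    then show ?thesis using that subspace_add[OF subspace_Omega_n] unfolding Omega_def
      by (simp add: component_add)
  qed
  show "k *\<^sub>R \<eta> \<in> Omega M E" if "\<eta> \<in> Omega M E" for \<eta> k
  proof -
    have "finite {n. component n \<eta> \<noteq> 0}" using that unfolding Omega_def by simp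
    then have "finite {n. component n (k *\<^sub>R \<eta>) \<noteq> 0}"
      by (rule rev_finite_subset) (auto simp: component_scaleR)
    then show ?thesis using that subspace_scale[OF subspace_Omega_n] unfolding Omega_def
      by (simp add: component_scaleR)
  qed
qed

end

lemma pullback_Omega:
  fixes P :: "('p::{t2_space, second_countable_topology}, 'd::real_normed_vector) chart set"
    and A :: "('p, 'v::real_vector, 'f::real_normed_vector, 'z) vector_bundle_scheme"
    and N :: "('n::{t2_space, second_countable_topology}, 'e::real_normed_vector) chart set"
    and B :: "('n, 'w::real_vector, 'g::real_normed_vector, 'y) vector_bundle_scheme"
  assumes P: "smooth_manifold P" and N: "smooth_manifold N"
    and A: "smooth_vector_bundle P A" and B: "smooth_vector_bundle N B"
    and \<Phi>: "vb_hom P A N B f \<Phi>" and \<eta>: "\<eta> \<in> Omega N B"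
  shows "pullback A \<Phi> \<eta> \<in> Omega P A"
proof -
  have c: "component n (pullback A \<Phi> \<eta>) = pullback A \<Phi> (component n \<eta>)" for n
    by (auto simp: component_def pullback_def fun_eq_iff)
  have "finite {n. component n \<eta> \<noteq> 0}" using \<eta> unfolding Omega_def by simp
  moreover have "pullback A \<Phi> 0 = 0" by (auto simp: pullback_def fun_eq_iff)
  ultimately have "finite {n. component n (pullback A \<Phi> \<eta>) \<noteq> 0}"
    unfolding c by (elim rev_finite_subset) auto
  then show ?thesis
    using pullback_Omega_n[OF P N A B \<Phi> component_Omega[OF \<eta>]] unfolding Omega_def by (simp add: c)
qed

section \<open>The Koszul formula\<close>

lemma omit_Cons [simp]: "omit 0 (a # as) = as" "omit (Suc i) (a # as) = a # omit i as"
  by (simp_all add: omit_def)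

lemma length_omit: "i < length as \<Longrightarrow> length (omit i as) = length as - 1"
  by (simp add: omit_def)

lemma set_omit: "set (omit i as) \<subseteq> set as"
  unfolding omit_def using set_take_subset[of i as] set_drop_subset[of "Suc i" as] by auto

lemma map_omit: "map h (omit i as) = omit i (map h as)"
  by (simp add: omit_def take_map drop_map)

lemma alt_on_update_linear:
  assumes "alt_on S n F" "length vs = n" "set vs \<subseteq> S" "i < n"
  shows "linear_on_subspace S (\<lambda>v. F (vs[i := v]))"
proof -
  have "set (take i vs) \<subseteq> S" "set (drop (Suc i) vs) \<subseteq> S"
    using assms(3) set_take_subset[of i vs] set_drop_subset[of "Suc i" vs] by blast+
  then show ?thesis
    using alt_on_linear[OF assms(1), of "take i vs" "drop (Suc i) vs"] assms
    by (simp add: upd_conv_take_nth_drop)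
qed

lemma alt_on_update:
  assumes "alt_on S n F" "length vs = n" "set vs \<subseteq> S" "i < n" "v \<in> S" "w \<in> S" "subspace S"
  shows "F (vs[i := k *\<^sub>R v + w]) = k * F (vs[i := v]) + F (vs[i := w])"
  using alt_on_update_linear[OF assms(1-4)] assms(5,6) subspace_scale[OF assms(7) assms(5), of k]
  unfolding linear_on_subspace_def by simp

text \<open>Let \<open>w\<close> be the common entry. The lists with \<open>v\<close> in slot
  \<open>i\<close> and with \<open>v\<close> in slot \<open>j\<close> give the two mixed terms in
  the expansion of the value with \<open>v + w\<close> in both slots, which vanishes.\<close>

lemma alt_on_update_swap:
  assumes "alt_on S n F" "length vs = n" "set vs \<subseteq> S" "i < n" "j < n" "i \<noteq> j" "vs ! i = vs ! j"
    "v \<in> S" "subspace S"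
  shows "F (vs[i := v]) = - F (vs[j := v])"
proof -
  let ?w = "vs ! i"
  have w: "?w \<in> S" using assms(2-4) nth_mem by blast
  have vw: "v + ?w \<in> S" using assms(8,9) w subspace_add by blast
  have z: "F (vs[i := a, j := a]) = 0" if "a \<in> S" for a
    by (rule alt_on_eq_zero[OF assms(1), of _ i j])
      (use assms that set_update_subset_insert[of vs i a] set_update_subset_insert[of "vs[i := a]" j
        a] in auto)
  have l1: "F (vs[i := v + ?w, j := b]) = F (vs[i := v, j := b]) + F (vs[i := ?w, j := b])" if
    "b \<in> S" for b
    using alt_on_update[OF assms(1), of "vs[j := b]" i v ?w 1] assms w that
      set_update_subset_insert[of vs j b]
    by (auto simp: list_update_swap[of j i])
  have l2: "F (vs[i := b, j := v + ?w]) = F (vs[i := b, j := v]) + F (vs[i := b, j := ?w])" if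
    "b \<in> S" for b
    using alt_on_update[OF assms(1), of "vs[i := b]" j v ?w 1] assms w that
      set_update_subset_insert[of vs i b]
    by auto
  have "vs[i := v, j := ?w] = vs[i := v]"
    using assms(6,7) by (metis list_update_id list_update_swap)
  moreover have "vs[i := ?w, j := v] = vs[j := v]" by simp
  ultimately show ?thesis
    using z[OF vw] z[OF assms(8)] z[OF w] l1[OF vw] l2[OF assms(8)] l2[OF w] by simp
qed

text \<open>Translates between the bracket terms of the Koszul formula, which put the bracket first,
  and those of the Lie derivative, which put it into the slot of its argument.\<close>

lemma alt_on_front:
  assumes "alt_on S n F" "length vs = n" "set vs \<subseteq> S" "j < n" "v \<in> S" "subspace S"
  shows "F (vs[j := v]) = (-1) ^ j * F (v # omit j vs)"
proof -
  have "F (take j vs @ v # drop (Suc j) vs) = (-1) ^ length (take j vs) * F (v # take j vs @ drop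
    (Suc j) vs)"
    by (rule alt_on_move[OF assms(6,1)])
      (use assms set_take_subset[of j vs] set_drop_subset[of "Suc j" vs] in auto)
  then show ?thesis
    using assms(2,4) by (simp add: omit_def upd_conv_take_nth_drop)
qed

definition contract :: "('m \<Rightarrow> 'v) \<Rightarrow> ('m, 'v) form \<Rightarrow> ('m, 'v) form"
  where "contract a \<eta> = (\<lambda>x vs. \<eta> x (a x # vs))"

lemma eval_form_Cons: "eval_form \<eta> (a # as) = eval_form (contract a \<eta>) as"
  by (simp add: eval_form_def contract_def fun_eq_iff)

text \<open>The value of the Lie derivative of \<open>\<eta>\<close> along \<open>a\<close> on the
  sections \<open>as\<close>, kept as an expression in sections and not as a form.\<close>

definition lie_form :: "('m, 'e::real_normed_vector) chart set \<Rightarrow>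
    ('m, 'v::real_vector, 'f, 'e) lie_algebroid \<Rightarrow>
    ('m \<Rightarrow> 'v) \<Rightarrow> ('m, 'v) form \<Rightarrow> ('m \<Rightarrow> 'v) list \<Rightarrow> 'm \<Rightarrow> real"
  where "lie_form M A a \<eta> as x = tangent_apply M x (anchor A x (a x)) (eval_form \<eta> as)
    - (\<Sum>i<length as. eval_form \<eta> (as[i := brk A a (as ! i)]) x)"

text \<open>Cartan's formula \<open>\<iota>\<^sub>a d = L\<^sub>a - d \<iota>\<^sub>a\<close>, which turns the Koszul formula into a recursion.\<close>

lemma koszul_Cons:
  fixes A :: "('m, 'v::real_vector, 'f, 'e::real_normed_vector) lie_algebroid"
  assumes S: "subspace (fib A x)" and \<eta>: "alt_on (fib A x) (length as) (\<eta> x)"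
    and mem: "\<And>b. b \<in> set (a # as) \<Longrightarrow> b x \<in> fib A x"
    and br: "\<And>b c. b \<in> set (a # as) \<Longrightarrow> c \<in> set (a # as) \<Longrightarrow> brk A b c x \<in> fib A x"
  shows "koszul M A \<eta> (a # as) x = lie_form M A a \<eta> as x - koszul M A (contract a \<eta>) as x"
proof -
  let ?n = "length as"
  \<comment> \<open>The summand with index 0 is the derivative along \<open>a\<close>. In the others
    the index shift reverses the sign, and \<open>a\<close> stays in front as in the
    contraction.\<close>
  have s1: "(\<Sum>i<length (a # as). (-1) ^ i * tangent_apply M x (anchor A x (((a # as) ! i) x))
    (eval_form \<eta> (omit i (a # as))))
      = tangent_apply M x (anchor A x (a x)) (eval_form \<eta> as)
        - (\<Sum>i<?n. (-1) ^ i * tangent_apply M x (anchor A x ((as ! i) x)) (eval_form (contract a \<eta>)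
          (omit i as)))"
    unfolding length_Cons sum.lessThan_Suc_shift by (simp add: eval_form_Cons sum_negf)
  have front: "(-1) ^ j * eval_form \<eta> (brk A a (as ! j) # omit j as) x = eval_form \<eta>
    (as[j := brk A a (as ! j)]) x"
    if j: "j < ?n" for j
  proof -
    let ?v = "brk A a (as ! j) x" and ?vs = "map (\<lambda>b. b x) as"
    have vs: "set ?vs \<subseteq> fib A x" using mem by auto
    have "\<eta> x (?vs[j := ?v]) = (-1) ^ j * \<eta> x (?v # omit j ?vs)"
      by (rule alt_on_front[OF \<eta> _ vs _ _ S]) (use j br in auto)
    moreover have "(-1::real) ^ j * ((-1) ^ j * y) = y" for y
      by (simp add: power_mult_distrib[symmetric] mult.assoc[symmetric])
    ultimately show ?thesis
      by (simp add: eval_form_def map_omit map_update)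
  qed
  \<comment> \<open>The bracket of two later arguments stands before \<open>a\<close>. One
    transposition restores \<open>a\<close> to the first place and produces the sign in front of the
    contraction.\<close>
  have swap: "eval_form \<eta> (brk A (as ! i) (as ! j) # a # omit i (omit j as)) x
      = - eval_form (contract a \<eta>) (brk A (as ! i) (as ! j) # omit i (omit j as)) x"
    if ij: "i < j" "j < ?n" for i j
  proof -
    have "set (omit i (omit j as)) \<subseteq> set as" by (rule subset_trans[OF set_omit set_omit])
    then have "set (map (\<lambda>b. b x) (omit i (omit j as))) \<subseteq> fib A x" using mem by auto
    moreover have "length (omit i (omit j as)) = ?n - 2" using ij by (simp add: length_omit)
    ultimately show ?thesis
      using alt_on_swap[OF S \<eta>, of "[]" "map (\<lambda>b. b x) (omit i (omit j as))" "brk A (as ! i)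
        (as ! j) x" "a x"]
        mem[of a] br[of "as ! i" "as ! j"] ij
      by (simp add: eval_form_def contract_def)
  qed
  \<comment> \<open>Shifting both indices by one leaves \<open>(-1) ^ (i + j)\<close> unchanged for
    pairs in the tail; a pair formed with the head has only one index shifted and receives a minus
    sign.\<close>
  have "(\<Sum>j<length (a # as). \<Sum>i<j. (-1) ^ (i + j) *
        eval_form \<eta> (brk A ((a # as) ! i) ((a # as) ! j) # omit i (omit j (a # as))) x)
      = (\<Sum>j<?n. - ((-1) ^ j * eval_form \<eta> (brk A a (as ! j) # omit j as) x)
          + (\<Sum>i<j. (-1) ^ (i + j) * eval_form \<eta> (brk A (as ! i) (as ! j) # a # omit i (omit j as))
            x))"
    unfolding length_Cons by (subst sum.lessThan_Suc_shift) (simp add: sum.lessThan_Suc_shift del: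
      sum.lessThan_Suc)
  also have "\<dots> = (\<Sum>j<?n. - eval_form \<eta> (as[j := brk A a (as ! j)]) x
      - (\<Sum>i<j. (-1) ^ (i + j) * eval_form (contract a \<eta>) (brk A (as ! i) (as ! j) # omit i
        (omit j as)) x))"
    by (rule sum.cong) (simp_all add: front swap sum_negf)
  also have "\<dots> = - (\<Sum>j<?n. eval_form \<eta> (as[j := brk A a (as ! j)]) x)
      - (\<Sum>j<?n. \<Sum>i<j. (-1) ^ (i + j) * eval_form (contract a \<eta>) (brk A (as ! i) (as ! j) # omit i
        (omit j as)) x)"
    by (simp add: sum_subtractf sum_negf)
  finally show ?thesis
    unfolding koszul_def[of M A \<eta> "a # as"] s1 lie_form_def koszul_def[of M A "contract a \<eta>"]
      by simp
qed

lemma koszul_Nil: "koszul M A \<eta> [] x = 0"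
  by (simp add: koszul_def)

lemma koszul_singleton: "koszul M A \<eta> [a] x = tangent_apply M x (anchor A x (a x)) (eval_form \<eta> [])"
  by (simp add: koszul_def)

lemma koszul_component:
  assumes "length as = Suc n"
  shows "koszul M A \<eta> as = koszul M A (component n \<eta>) as"
proof -
  have e: "eval_form (component n \<eta>) bs = eval_form \<eta> bs" if "length bs = n" for bs
    using that by (simp add: eval_form_def component_def fun_eq_iff)
  have l: "length (omit i as) = n" if "i < Suc n" for i using that assms by (simp add: length_omit)
  have l2: "Suc (length (omit i (omit j as))) = n" if "i < j" "j < Suc n" for i j
    using that assms by (simp add: length_omit)
  show ?thesis by (simp add: koszul_def fun_eq_iff assms e l l2)
qed

section \<open>The Koszul expression of a Lie algebroid: linearity over functions and
  alternation\<close>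

lemma lie_algebroidD:
  assumes "is_lie_algebroid M A"
  shows "smooth_vector_bundle M A" "vb_hom M A M (tangent_bundle M) id (\<lambda>(x, v). (x, anchor A x v))"
    "lie_bracket_on (sections M A) (brk A)"
    "a \<in> sections M A \<Longrightarrow> b \<in> sections M A \<Longrightarrow> g \<in> smooth_functions M \<Longrightarrow>
      brk A a (\<lambda>y. g y *\<^sub>R b y) x = g x *\<^sub>R brk A a b x + tangent_apply M x (anchor A x (a x)) g *\<^sub>R
        b x"
  using assms unfolding is_lie_algebroid_def by blast+

context
  fixes M :: "('m::{t2_space, second_countable_topology}, 'e::real_normed_vector) chart set"
    and A :: "('m, 'v::real_vector, 'f::real_normed_vector, 'e) lie_algebroid"
  assumes M: "smooth_manifold M" and A: "is_lie_algebroid M A"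
begin

private lemmas vbA = lie_algebroidD(1)[OF A]

lemma section_mem: "a \<in> sections M A \<Longrightarrow> a x \<in> fib A x"
  by (simp add: sections_def)

lemma smooth_functions_const: "(\<lambda>_. k) \<in> smooth_functions M"
  unfolding smooth_functions_iff by (rule smooth_fun_on_const[OF M])

text \<open>The shape \<open>g b + c\<close> covers multiples (\<open>c = 0\<close>) and sums
  (\<open>g = 1\<close>) at once; linearity in a slot is stated in this shape below.\<close>

lemma section_lincomb:
  assumes "g \<in> smooth_functions M" "b \<in> sections M A" "c \<in> sections M A"
  shows "(\<lambda>x. g x *\<^sub>R b x + c x) \<in> sections M A"
  using assms unfolding sections_iff smooth_functions_iff
  by (intro local_section_add[OF M M smooth_map_id[OF M] vbA open_UNIV]
      local_section_scale[OF M M smooth_map_id[OF M] vbA open_UNIV])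

lemma zero_section: "0 \<in> sections M A"
proof -
  have z: "0 \<in> fib A x" for x by (rule subspace_0[OF subspace_fib[OF vbA]])
  have "smooth_fun_on M (fst u) (\<lambda>x. snd u x 0)" if u: "u \<in> trivs A" for u
    by (rule smooth_fun_on_cong[OF M open_triv[OF vbA u] _ smooth_fun_on_const[OF M, of _ 0]])
      (rule linear_on_subspace_zero[OF triv_linear[OF vbA u] z, symmetric])
  then show ?thesis using z by (simp add: sections_def)
qed

lemma brk_section: "a \<in> sections M A \<Longrightarrow> b \<in> sections M A \<Longrightarrow> brk A a b \<in> sections M A"
  using lie_algebroidD(3)[OF A] unfolding lie_bracket_on_def by blast

lemma brk_add:
  assumes "a \<in> sections M A" "b \<in> sections M A" "c \<in> sections M A"
  shows "brk A a (b + c) = brk A a b + brk A a c" "brk A (b + c) a = brk A b a + brk A c a"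
  using assms lie_algebroidD(3)[OF A] unfolding lie_bracket_on_def linear_on_subspace_def by blast+

lemma brk_antisym:
  assumes "a \<in> sections M A" "b \<in> sections M A"
  shows "brk A b a = - brk A a b"
proof -
  have z: "brk A c c = 0" if "c \<in> sections M A" for c
    using that lie_algebroidD(3)[OF A] unfolding lie_bracket_on_def by blast
  have ab: "a + b \<in> sections M A"
    using section_lincomb[OF smooth_functions_const[of 1] assms] by (simp add: plus_fun_def)
  show ?thesis
    using z[OF ab] z[OF assms(1)] z[OF assms(2)]
    by (simp add: brk_add[OF ab assms] brk_add[OF assms(1) assms] brk_add[OF assms(2) assms]
      add_eq_0_iff add.commute)
qed

lemma brk_lincomb:
  assumes "a \<in> sections M A" "g \<in> smooth_functions M" "b \<in> sections M A" "c \<in> sections M A"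
  shows "brk A a (\<lambda>y. g y *\<^sub>R b y + c y) x
    = g x *\<^sub>R brk A a b x + tangent_apply M x (anchor A x (a x)) g *\<^sub>R b x + brk A a c x"
proof -
  have gb: "(\<lambda>y. g y *\<^sub>R b y) \<in> sections M A"
    using section_lincomb[OF assms(2,3) zero_section] by simp
  have "brk A a ((\<lambda>y. g y *\<^sub>R b y) + c) x = brk A a (\<lambda>y. g y *\<^sub>R b y) x + brk A a c x"
    by (simp add: brk_add[OF assms(1) gb assms(4)])
  then show ?thesis using lie_algebroidD(4)[OF A assms(1,3,2), of x] by (simp add: plus_fun_def)
qed

lemma anchor_linear: "linear_on_subspace (fib A x) (anchor A x)"
  using vb_homD(4)[OF lie_algebroidD(2)[OF A], of x] by simp

lemma anchor_tangent: "v \<in> fib A x \<Longrightarrow> anchor A x v \<in> tangent_space M x"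
  using vb_homD(3)[OF lie_algebroidD(2)[OF A], of v x] by (simp add: tangent_bundle_def)

lemma anchor_apply_lincomb:
  assumes "v \<in> fib A x" "w \<in> fib A x" "g \<in> smooth_functions M"
  shows "tangent_apply M x (anchor A x (k *\<^sub>R v + w)) g
    = k * tangent_apply M x (anchor A x v) g + tangent_apply M x (anchor A x w) g"
proof -
  have "anchor A x (k *\<^sub>R v + w) = k *\<^sub>R anchor A x v + anchor A x w"
    using anchor_linear[of x] assms(1,2) subspace_scale[OF subspace_fib[OF vbA] assms(1), of k]
    unfolding linear_on_subspace_def by simp
  then show ?thesis
    using assms(3) unfolding smooth_functions_iff
    by (simp add: tangent_apply_add[OF M open_UNIV UNIV_I] tangent_apply_scaleR[OF M open_UNIV
      UNIV_I])
qed

text \<open>The anchor is a bundle homomorphism into the tangent bundle, so it turns a section into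
  a smooth vector field, which differentiates smooth functions to smooth functions.\<close>

lemma smooth_anchor_apply:
  assumes "a \<in> sections M A" "g \<in> smooth_functions M"
  shows "(\<lambda>x. tangent_apply M x (anchor A x (a x)) g) \<in> smooth_functions M"
proof -
  have tb: "fib (tangent_bundle M) = tangent_space M"
    "trivs (tangent_bundle M) = (\<lambda>c. (fst c, \<lambda>x \<xi>. \<xi> c)) ` M"
    by (simp_all add: tangent_bundle_def)
  have sub: "subspace (tangent_space M x)" for x
  proof (rule subspaceI)
    have lin: "linear (frechet_derivative (snd d \<circ> chart_inv c) (at (snd c x)))"
      if "c \<in> M" "d \<in> M" "x \<in> fst c" "x \<in> fst d" for c d
      by (rule linear_frechet_derivative[OF smooth_on_differentiable[OF smooth_manifoldD(4)[OF M
        that(1,2)]]])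
        (use that in blast)
    show "0 \<in> tangent_space M x" unfolding tangent_space_def by (simp add: linear_0[OF lin])
    show "\<xi> + \<zeta> \<in> tangent_space M x" if "\<xi> \<in> tangent_space M x" "\<zeta> \<in> tangent_space M x" for \<xi> \<zeta>
    proof -
      have "(\<xi> + \<zeta>) d = frechet_derivative (snd d \<circ> chart_inv c) (at (snd c x)) ((\<xi> + \<zeta>) c)"
        if "c \<in> M" "d \<in> M" "x \<in> fst c" "x \<in> fst d" for c d
      proof -
        have "\<xi> d = frechet_derivative (snd d \<circ> chart_inv c) (at (snd c x)) (\<xi> c)"
          "\<zeta> d = frechet_derivative (snd d \<circ> chart_inv c) (at (snd c x)) (\<zeta> c)"
          using that \<open>\<xi> \<in> _\<close> \<open>\<zeta> \<in> _\<close> unfolding tangent_space_def by blast+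
        then show ?thesis by (simp add: linear_add[OF lin[OF that]])
      qed
      moreover have "(\<xi> + \<zeta>) c = 0" if "\<not> (c \<in> M \<and> x \<in> fst c)" for c
      proof -
        have "\<xi> c = 0" "\<zeta> c = 0"
          using that \<open>\<xi> \<in> _\<close> \<open>\<zeta> \<in> _\<close> unfolding tangent_space_def by blast+
        then show ?thesis by simp
      qed
      ultimately show ?thesis unfolding tangent_space_def by blast
    qed
    show "k *\<^sub>R \<xi> \<in> tangent_space M x" if "\<xi> \<in> tangent_space M x" for \<xi> k
    proof -
      have "(k *\<^sub>R \<xi>) d = frechet_derivative (snd d \<circ> chart_inv c) (at (snd c x)) ((k *\<^sub>R \<xi>) c)"
        if "c \<in> M" "d \<in> M" "x \<in> fst c" "x \<in> fst d" for c d
      proof -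
        have "\<xi> d = frechet_derivative (snd d \<circ> chart_inv c) (at (snd c x)) (\<xi> c)"
          using that \<open>\<xi> \<in> _\<close> unfolding tangent_space_def by blast
        then show ?thesis by (simp add: scaleR_fun_def linear_cmul[OF lin[OF that]])
      qed
      moreover have "(k *\<^sub>R \<xi>) c = 0" if "\<not> (c \<in> M \<and> x \<in> fst c)" for c
      proof -
        have "\<xi> c = 0" using that \<open>\<xi> \<in> _\<close> unfolding tangent_space_def by blast
        then show ?thesis by (simp add: scaleR_fun_def)
      qed
      ultimately show ?thesis unfolding tangent_space_def by blast
    qed
  qed
  have "local_section M UNIV (tangent_bundle M) id (\<lambda>p. snd ((\<lambda>(x, v). (x, anchor A x v))
    (p, a p)))"
  proof (rule local_section_hom[OF M vbA lie_algebroidD(2)[OF A]])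
    show "open (fst w)" if "w \<in> trivs (tangent_bundle M)" for w
      using that is_chartD(1)[OF smooth_manifoldD(3)[OF M]] unfolding tb by auto
    show "linear_on_subspace (fib (tangent_bundle M) y) (snd w y)" if "w \<in> trivs (tangent_bundle M)"
      for w y
      using that unfolding tb by (auto simp: linear_on_subspace_def scaleR_fun_def)
    show "subspace (fib (tangent_bundle M) y)" for y unfolding tb by (rule sub)
  qed (use assms(1) in \<open>simp_all add: sections_iff\<close>)
  then have ls: "local_section M UNIV (tangent_bundle M) id (\<lambda>x. anchor A x (a x))" by simp
  show ?thesis unfolding smooth_functions_iff
  proof (rule smooth_tangent_apply[OF M open_UNIV])
    show "smooth_fun_on M UNIV g" using assms(2) by (simp add: smooth_functions_iff)
    show "anchor A x (a x) \<in> tangent_space M x" for x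
      using anchor_tangent section_mem[OF assms(1)] by blast
    show "smooth_fun_on M (UNIV \<inter> fst c) (\<lambda>x. anchor A x (a x) c)" if "c \<in> M" for c
      using ls that unfolding local_section_def tb by auto
  qed
qed

lemma smooth_eval_form:
  assumes "\<eta> \<in> Omega_n M A n" "set as \<subseteq> sections M A"
  shows "eval_form \<eta> as \<in> smooth_functions M"
  using smooth_form_eval[OF M M smooth_map_id[OF M] vbA assms(1) open_UNIV, of as] assms(2)
  unfolding sections_iff smooth_functions_iff eval_form_def[abs_def]
    by (auto simp: sections_iff[symmetric])

lemma smooth_functions_sum:
  "(\<And>i. i \<in> I \<Longrightarrow> f i \<in> smooth_functions M) \<Longrightarrow> (\<lambda>x. \<Sum>i\<in>I. f i x) \<in> smooth_functions M"
  unfolding smooth_functions_iff by (rule smooth_fun_on_sum[OF M open_UNIV])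

lemma smooth_functions_cmult: "f \<in> smooth_functions M \<Longrightarrow> (\<lambda>x. k * f x) \<in> smooth_functions M"
  unfolding smooth_functions_iff by (rule smooth_fun_on_mult[OF M open_UNIV smooth_fun_on_const[OF
    M]])

lemma smooth_koszul:
  assumes \<eta>: "\<eta> \<in> Omega_n M A n" and as: "set as \<subseteq> sections M A"
  shows "koszul M A \<eta> as \<in> smooth_functions M"
proof -
  have o: "set (omit i as) \<subseteq> sections M A" for i by (rule subset_trans[OF set_omit as])
  have o2: "set (omit i (omit j as)) \<subseteq> sections M A" for i j by (rule subset_trans[OF set_omit o])
  have "(\<lambda>x. (\<Sum>i<length as. (-1) ^ i * tangent_apply M x (anchor A x ((as ! i) x)) (eval_form \<eta>
    (omit i as))))
      \<in> smooth_functions M"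
    by (rule smooth_functions_sum, rule smooth_functions_cmult, rule smooth_anchor_apply)
      (use as o in \<open>auto intro: smooth_eval_form[OF \<eta>]\<close>)
  moreover have "(\<lambda>x. \<Sum>j<length as. \<Sum>i<j. (-1) ^ (i + j) *
        eval_form \<eta> (brk A (as ! i) (as ! j) # omit i (omit j as)) x) \<in> smooth_functions M"
    by (rule smooth_functions_sum, rule smooth_functions_sum, rule smooth_functions_cmult, rule
      smooth_eval_form[OF \<eta>])
      (use as o2 in \<open>auto intro!: brk_section\<close>)
  ultimately show ?thesis
    unfolding koszul_def[abs_def] smooth_functions_iff by (rule smooth_fun_on_add[OF M open_UNIV])
qed

lemma contract_Omega_n:
  assumes \<eta>: "\<eta> \<in> Omega_n M A (Suc n)" and a: "a \<in> sections M A"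
  shows "contract a \<eta> \<in> Omega_n M A n"
proof (rule Omega_nI[OF vbA])
  show "contract a \<eta> x vs = 0" if "\<not> (length vs = n \<and> set vs \<subseteq> fib A x)" for x vs
    unfolding contract_def by (rule Omega_nD(1)[OF vbA \<eta>]) (use that in auto)
  show "alt_on (fib A x) n (contract a \<eta> x)" for x
    unfolding contract_def by (rule alt_on_Cons[OF Omega_nD(2)[OF vbA \<eta>] section_mem[OF a]])
  fix u and ys :: "'f list" assume u: "u \<in> trivs A"
  have "smooth_fun_on M (fst u) (\<lambda>x. \<eta> (id x) (map (\<lambda>b. b x) (a # map (\<lambda>y x. triv_inv A u x y)
    ys)))"
  proof (rule smooth_form_eval[OF M M smooth_map_id[OF M] vbA \<eta> open_triv[OF vbA u]])
    fix b assume "b \<in> set (a # map (\<lambda>y x. triv_inv A u x y) ys)"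
    then consider "b = a" | y where "b = (\<lambda>x. triv_inv A u x y)" by auto
    then show "local_section M (fst u) A id b"
    proof cases
      case 1
      then show ?thesis using a local_section_subset[of M UNIV A id a "fst u"]
        by (simp add: sections_iff)
    next
      case 2
      then show ?thesis using local_section_triv_inv[OF M vbA u] by simp
    qed
  qed
  then show "smooth_fun_on M (fst u) (\<lambda>x. contract a \<eta> x (map (triv_inv A u x) ys))"
    by (simp add: contract_def o_def)
qed

lemma koszul_rec:
  assumes "\<eta> \<in> Omega_n M A n" "a \<in> sections M A" "set as \<subseteq> sections M A" "length as = n"
  shows "koszul M A \<eta> (a # as) x = lie_form M A a \<eta> as x - koszul M A (contract a \<eta>) as x"
proof (rule koszul_Cons[OF subspace_fib[OF vbA]])
  show "alt_on (fib A x) (length as) (\<eta> x)" using Omega_nD(2)[OF vbA assms(1)] assms(4) by simp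
  show "b x \<in> fib A x" if "b \<in> set (a # as)" for b
    by (rule section_mem) (use that assms in auto)
  show "brk A b c x \<in> fib A x" if "b \<in> set (a # as)" "c \<in> set (a # as)" for b c
    by (rule section_mem[OF brk_section]) (use that assms in auto)
qed

lemma koszul_scaleR:
  assumes \<eta>: "\<eta> \<in> Omega_n M A n" and as: "set as \<subseteq> sections M A"
  shows "koszul M A (k *\<^sub>R \<eta>) as x = k * koszul M A \<eta> as x"
proof -
  have e: "eval_form (k *\<^sub>R \<eta>) bs = (\<lambda>x. k * eval_form \<eta> bs x)" for bs
    by (simp add: eval_form_def scaleR_fun_def fun_eq_iff)
  have "tangent_apply M x \<xi> (eval_form (k *\<^sub>R \<eta>) (omit i as)) = k * tangent_apply M x \<xi> (eval_form \<eta>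
    (omit i as))"
    for \<xi> i
  proof -
    have "set (omit i as) \<subseteq> sections M A" by (rule subset_trans[OF set_omit as])
    from smooth_eval_form[OF \<eta> this] show ?thesis
      unfolding e smooth_functions_iff
      by (simp add: tangent_apply_mult[OF M open_UNIV UNIV_I smooth_fun_on_const[OF M]]
        tangent_apply_const)
  qed
  then show ?thesis
    unfolding koszul_def by (simp add: e distrib_left sum_distrib_left mult.left_commute)
qed

text \<open>After two steps of the recursion every term either is antisymmetric in \<open>a\<close>
  and \<open>b\<close> or has a partner with the opposite sign and the two exchanged. The recursion
  gives no access to the first slot; this symmetry carries results about later slots over to
  it.\<close>

lemma koszul_swap_head:
  assumes \<eta>: "\<eta> \<in> Omega_n M A (Suc n)" and ab: "a \<in> sections M A" "b \<in> sections M A"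
    and as: "set as \<subseteq> sections M A" "length as = n"
  shows "koszul M A \<eta> (a # b # as) x = - koszul M A \<eta> (b # a # as) x"
proof -
  have K: "koszul M A \<eta> (a # b # as) x = tangent_apply M x (anchor A x (a x)) (eval_form \<eta> (b # as))
      - tangent_apply M x (anchor A x (b x)) (eval_form \<eta> (a # as))
      - eval_form \<eta> (brk A a b # as) x
      - (\<Sum>i<n. eval_form \<eta> (b # as[i := brk A a (as ! i)]) x) + (\<Sum>i<n. eval_form \<eta>
        (a # as[i := brk A b (as ! i)]) x)
      + koszul M A (contract b (contract a \<eta>)) as x"
    if ab: "a \<in> sections M A" "b \<in> sections M A" for a b
  proof -
    have "koszul M A \<eta> (a # b # as) x = lie_form M A a \<eta> (b # as) x - koszul M A (contract a \<eta>)
      (b # as) x"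
      by (rule koszul_rec[OF \<eta> that(1)]) (use as that in auto)
    moreover have "koszul M A (contract a \<eta>) (b # as) x
        = lie_form M A b (contract a \<eta>) as x - koszul M A (contract b (contract a \<eta>)) as x"
      by (rule koszul_rec[OF contract_Omega_n[OF \<eta> that(1)] that(2) as])
    moreover have "lie_form M A a \<eta> (b # as) x = tangent_apply M x (anchor A x (a x)) (eval_form \<eta>
      (b # as))
        - eval_form \<eta> (brk A a b # as) x - (\<Sum>i<n. eval_form \<eta> (b # as[i := brk A a (as ! i)]) x)"
      unfolding lie_form_def length_Cons as(2) sum.lessThan_Suc_shift by simp
    ultimately show ?thesis by (simp add: lie_form_def as(2) eval_form_Cons)
  qed
  have mem: "set (map (\<lambda>c. c x) as) \<subseteq> fib A x" for x using as(1) section_mem by auto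
  have "brk A a b x \<in> fib A x" using section_mem[OF brk_section[OF ab]] .
  then have "linear_on_subspace (fib A x) (\<lambda>v. \<eta> x ([] @ v # map (\<lambda>c. c x) as))"
    by (intro alt_on_linear[OF Omega_nD(2)[OF vbA \<eta>]]) (use as mem in auto)
  then have "\<eta> x ([] @ ((-1) *\<^sub>R brk A a b x) # map (\<lambda>c. c x) as)
      = (-1) *\<^sub>R \<eta> x ([] @ brk A a b x # map (\<lambda>c. c x) as)"
    using \<open>brk A a b x \<in> fib A x\<close> unfolding linear_on_subspace_def by blast
  then have 1: "eval_form \<eta> (brk A b a # as) x = - eval_form \<eta> (brk A a b # as) x"
    by (simp add: eval_form_def brk_antisym[OF ab])
  \<comment> \<open>As functions the two sides must agree on all lists, also on those of the wrong
    length or with entries outside the fibre, where both are zero.\<close>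
  have "contract a (contract b \<eta>) = (-1) *\<^sub>R contract b (contract a \<eta>)"
  proof (intro ext)
    fix y vs
    show "contract a (contract b \<eta>) y vs = ((-1) *\<^sub>R contract b (contract a \<eta>)) y vs"
    proof (cases "Suc (length vs) = n \<and> set vs \<subseteq> fib A y \<or> Suc (Suc (length vs)) = Suc n \<and> set vs \<subseteq>
      fib A y")
      case True
      then show ?thesis
        using alt_on_swap[OF subspace_fib[OF vbA] Omega_nD(2)[OF vbA \<eta>, of y], of "[]" vs "b y"
          "a y"]
          section_mem ab by (auto simp: contract_def scaleR_fun_def)
    next
      case False
      then show ?thesis
        using Omega_nD(1)[OF vbA \<eta>, of "b y # a y # vs" y] Omega_nD(1)[OF vbA \<eta>, of "a y # b y # vs"
          y]
        by (auto simp: contract_def scaleR_fun_def)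
    qed
  qed
  moreover have "koszul M A ((-1) *\<^sub>R contract b (contract a \<eta>)) as x = - koszul M A
    (contract b (contract a \<eta>)) as x"
  proof (cases n)
    case 0
    then show ?thesis using as(2) by (simp add: koszul_Nil)
  next
    case (Suc m)
    have "contract b (contract a \<eta>) \<in> Omega_n M A m"
      using \<eta> unfolding Suc by (rule contract_Omega_n[OF contract_Omega_n[OF _ ab(1)] ab(2)])
    from koszul_scaleR[OF this as(1), of "-1"] show ?thesis by simp
  qed
  ultimately have 2: "koszul M A (contract a (contract b \<eta>)) as x = - koszul M A
    (contract b (contract a \<eta>)) as x"
    by simp
  show ?thesis unfolding K[OF ab] K[OF ab(2,1)] 1 2 by simp
qed

lemma eval_form_slot:
  assumes \<eta>: "\<eta> \<in> Omega_n M A n" and as: "set as \<subseteq> sections M A" "length as = n" "k < n"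
    and s: "s x = r *\<^sub>R b x + c x" "b x \<in> fib A x" "c x \<in> fib A x"
  shows "eval_form \<eta> (as[k := s]) x = r * eval_form \<eta> (as[k := b]) x + eval_form \<eta> (as[k := c]) x"
  using alt_on_update[OF Omega_nD(2)[OF vbA \<eta>, of x], of "map (\<lambda>a. a x) as" k "b x" "c x" r] as s
    section_mem subspace_fib[OF vbA] by (auto simp: eval_form_def map_update)

text \<open>Differentiating the coefficient \<open>g\<close> in the value of \<open>\<eta>\<close>
  produces the derivative of \<open>g\<close> along the anchor of \<open>a\<close>, times the value
  at \<open>b\<close>. The Leibniz rule for the bracket in slot \<open>k\<close> produces the same
  term, which the Lie derivative subtracts.\<close>

lemma lie_form_slot:
  assumes \<eta>: "\<eta> \<in> Omega_n M A n" and a: "a \<in> sections M A"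
    and as: "set as \<subseteq> sections M A" "length as = n" "k < n"
    and g: "g \<in> smooth_functions M" and b: "b \<in> sections M A" and c: "c \<in> sections M A"
  shows "lie_form M A a \<eta> (as[k := \<lambda>x. g x *\<^sub>R b x + c x]) x
    = g x * lie_form M A a \<eta> (as[k := b]) x + lie_form M A a \<eta> (as[k := c]) x"
proof -
  let ?s = "\<lambda>x. g x *\<^sub>R b x + c x"
  let ?D = "tangent_apply M x (anchor A x (a x))"
  let ?E = "\<lambda>s. eval_form \<eta> (as[k := s])"
  let ?t = "\<lambda>s i. eval_form \<eta> ((as[k := s])[i := brk A a ((as[k := s]) ! i)]) x"
  note m = section_mem
  have upd: "set (as[k := s]) \<subseteq> sections M A" if "s \<in> sections M A" for s k
    using as(1) that set_update_subset_insert[of as k s] by blast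
  have E: "?E ?s = (\<lambda>y. g y * ?E b y + ?E c y)"
    by (rule ext, rule eval_form_slot[OF \<eta> as refl m[OF b] m[OF c]])
  have sm: "smooth_fun_on M UNIV (?E b)" "smooth_fun_on M UNIV (?E c)" "smooth_fun_on M UNIV g"
    using smooth_eval_form[OF \<eta> upd] b c g by (simp_all add: smooth_functions_iff)
  have d: "?D (?E ?s) = g x * ?D (?E b) + ?D g * ?E b x + ?D (?E c)"
    unfolding E
    by (simp add: tangent_apply_add_fun[OF M open_UNIV UNIV_I smooth_fun_on_mult[OF M open_UNIV
      sm(3,1)] sm(2)]
        tangent_apply_mult[OF M open_UNIV UNIV_I sm(3,1)])
  have t: "?t ?s i = g x * ?t b i + ?t c i + (if i = k then ?D g * ?E b x else 0)" if i: "i < n" for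
    i
  proof (cases "i = k")
    case False
    have bi: "brk A a (as ! i) \<in> sections M A" using as i a by (intro brk_section) auto
    have "?t s i = eval_form \<eta> ((as[i := brk A a (as ! i)])[k := s]) x" for s
      using False by (simp add: list_update_swap)
    then show ?thesis
      using False eval_form_slot[OF \<eta> upd[OF bi, of i], of k ?s x "g x" b c] as m[OF b] m[OF c]
        by simp
  next
    case True
    \<comment> \<open>The part of the Leibniz formula that remains beside the multiple of the
      bracket with \<open>b\<close>. Grouped this way, linearity in the slot is applied
      twice.\<close>
    let ?z = "\<lambda>y. tangent_apply M y (anchor A y (a y)) g *\<^sub>R b y + brk A a c y"
    have z: "?z x \<in> fib A x"
      by (intro subspace_add subspace_scale subspace_fib[OF vbA] m b brk_section a c)
    have "?t ?s i = ?E (brk A a ?s) x" using True as by simp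
    also have "\<dots> = g x * ?E (brk A a b) x + ?E ?z x"
      by (rule eval_form_slot[OF \<eta> as]) (use brk_lincomb[OF a g b c] m[OF brk_section[OF a b]] z in
        auto)
    also have "?E ?z x = ?D g * ?E b x + ?E (brk A a c) x"
      by (rule eval_form_slot[OF \<eta> as]) (use m[OF brk_section[OF a c]] m[OF b] in auto)
    finally show ?thesis using True as by simp
  qed
  have "(\<Sum>i<n. ?t ?s i) = g x * (\<Sum>i<n. ?t b i) + (\<Sum>i<n. ?t c i) + ?D g * ?E b x"
    using as(3) by (simp add: t sum.distrib sum_distrib_left)
  then show ?thesis unfolding lie_form_def using d as(2) by (simp add: algebra_simps)
qed

text \<open>By the recursion, linearity in a slot behind the first follows from that of the Lie
  derivative and from that of the contraction, which has one degree less. The first slot is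
  exchanged with the second by \<open>koszul_swap_head\<close>. In degree 0 the claim is linearity
  of the anchor.\<close>

lemma koszul_slot:
  assumes "\<eta> \<in> Omega_n M A n" "set as \<subseteq> sections M A" "length as = Suc n" "k < Suc n"
    and g: "g \<in> smooth_functions M" and b: "b \<in> sections M A" and c: "c \<in> sections M A"
  shows "koszul M A \<eta> (as[k := \<lambda>x. g x *\<^sub>R b x + c x]) x
    = g x * koszul M A \<eta> (as[k := b]) x + koszul M A \<eta> (as[k := c]) x"
  using assms(1-4)
proof (induction n arbitrary: \<eta> as k)
  case 0
  then obtain a where as: "as = [a]" by (metis length_0_conv length_Suc_conv)
  have "eval_form \<eta> [] \<in> smooth_functions M" by (rule smooth_eval_form[OF 0(1)]) simp
  then show ?case
    using anchor_apply_lincomb[OF section_mem[OF b] section_mem[OF c]] 0(4) by (simp add: as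
      koszul_singleton)
next
  case (Suc n)
  let ?s = "\<lambda>x. g x *\<^sub>R b x + c x"
  note s = section_lincomb[OF g b c]
  have tail: "koszul M A \<eta> (a # as[k := ?s]) x = g x * koszul M A \<eta> (a # as[k := b]) x + koszul M A
    \<eta> (a # as[k := c]) x"
    if h: "a \<in> sections M A" "set as \<subseteq> sections M A" "length as = Suc n" "k < Suc n" for a as k
  proof -
    have "set (as[k := z]) \<subseteq> sections M A" if "z \<in> sections M A" for z
      using h(2) that set_update_subset_insert[of as k z] by blast
    then have rec: "koszul M A \<eta> (a # as[k := z]) x = lie_form M A a \<eta> (as[k := z]) x - koszul M A
      (contract a \<eta>) (as[k := z]) x"
      if "z \<in> sections M A" for z
      using koszul_rec[OF Suc.prems(1) h(1)] that h(3) by simp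
    show ?thesis
      unfolding rec[OF s] rec[OF b] rec[OF c] lie_form_slot[OF Suc.prems(1) h g b c]
        Suc.IH[OF contract_Omega_n[OF Suc.prems(1) h(1)] h(2-4)] by (simp add: algebra_simps)
  qed
  obtain a0 a1 as' where as: "as = a0 # a1 # as'"
    using Suc.prems(3) by (metis length_Suc_conv)
  show ?case
  proof (cases k)
    case (Suc k')
    then show ?thesis using tail[of a0 "a1 # as'" k'] Suc.prems as by simp
  next
    case 0
    have a: "a1 \<in> sections M A" "set as' \<subseteq> sections M A" "length as' = n" using Suc.prems as by auto
    have "koszul M A \<eta> (z # a1 # as') x = - koszul M A \<eta> (a1 # z # as') x" if "z \<in> sections M A" for
      z
      by (rule koszul_swap_head[OF Suc.prems(1) that a])
    then show ?thesis
      using tail[of a1 "a0 # as'" 0] Suc.prems as 0 s b c by simp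
  qed
qed

text \<open>Equal arguments behind the first are handled by the recursion. If the first argument is
  one of them, exchanging the first two either reproduces the expression with a minus sign or brings
  both equal arguments into the tail.\<close>

lemma koszul_dup:
  assumes "\<eta> \<in> Omega_n M A n" "set as \<subseteq> sections M A" "length as = Suc n"
    "i < j" "j < Suc n" "as ! i = as ! j"
  shows "koszul M A \<eta> as x = 0"
  using assms
proof (induction n arbitrary: \<eta> as i j)
  case (Suc n)
  have tail: "koszul M A \<eta> (a # as) x = 0"
    if h: "a \<in> sections M A" "set as \<subseteq> sections M A" "length as = Suc n" "i < j" "j < Suc n"
      "as ! i = as ! j"
    for a as i j
  proof -
    note \<eta> = Suc.prems(1)
    have mem: "set (map (\<lambda>c. c y) bs) \<subseteq> fib A y" if "set bs \<subseteq> sections M A" for bs y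
      using that section_mem by auto
    have z: "eval_form \<eta> bs y = 0"
      if "set bs \<subseteq> sections M A" "length bs = Suc n" "bs ! i = bs ! j" for bs y
      unfolding eval_form_def
      by (rule alt_on_eq_zero[OF Omega_nD(2)[OF vbA \<eta>], of _ y i j]) (use that mem h(4,5) in auto)
    have "eval_form \<eta> as = (\<lambda>y. 0)" using z[OF h(2,3,6)] by blast
    then have d: "tangent_apply M x (anchor A x (a x)) (eval_form \<eta> as) = 0"
      by (simp add: tangent_apply_const)
    let ?t = "\<lambda>l. eval_form \<eta> (as[l := brk A a (as ! l)]) x"
    have "?t l = 0" if "l < Suc n" "l \<noteq> i" "l \<noteq> j" for l
    proof (rule z)
      have "brk A a (as ! l) \<in> sections M A" using that h by (intro brk_section) auto
      then show "set (as[l := brk A a (as ! l)]) \<subseteq> sections M A"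
        using h(2) set_update_subset_insert[of as l] by blast
    qed (use that h in auto)
    \<comment> \<open>A bracket in a slot other than \<open>i\<close> and \<open>j\<close> leaves
      the repeated argument in place. The two remaining terms cancel by antisymmetry.\<close>
    then have "(\<Sum>l<Suc n. ?t l) = (\<Sum>l\<in>{i, j}. ?t l)"
      using h(4,5) by (intro sum.mono_neutral_right) auto
    also have "\<dots> = ?t i + ?t j" using h(4) by simp
    also have "\<dots> = 0"
    proof -
      let ?vs = "map (\<lambda>c. c x) as"
      have "brk A a (as ! j) x \<in> fib A x" using h by (intro section_mem brk_section) auto
      then have "\<eta> x (?vs[i := brk A a (as ! j) x]) = - \<eta> x (?vs[j := brk A a (as ! j) x])"
        by (intro alt_on_update_swap[OF Omega_nD(2)[OF vbA \<eta>]]) (use h mem subspace_fib[OF vbA] in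
          auto)
      then show ?thesis by (simp add: eval_form_def map_update h(6))
    qed
    finally have "lie_form M A a \<eta> as x = 0" unfolding lie_form_def using d h(3) by simp
    moreover have "koszul M A (contract a \<eta>) as x = 0"
      by (rule Suc.IH[OF contract_Omega_n[OF \<eta> h(1)] h(2-6)])
    ultimately show ?thesis using koszul_rec[OF \<eta> h(1-3)] by simp
  qed
  obtain a0 a1 as' where as: "as = a0 # a1 # as'"
    using Suc.prems(3) by (metis length_Suc_conv)
  have a: "a0 \<in> sections M A" "a1 \<in> sections M A" "set as' \<subseteq> sections M A" "length as' = n"
    using Suc.prems as by auto
  consider (t) i' j' where "i = Suc i'" "j = Suc j'" | (h1) "i = 0" "j = 1" | (h2) j' where "i = 0"
    "j = Suc (Suc j')"
    using Suc.prems(4) by (cases i; cases j; cases "j - 1") auto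
  then show ?case
  proof cases
    case t
    then show ?thesis using tail[of a0 "a1 # as'" i' j'] Suc.prems as by auto
  next
    case h1
    then have "a0 = a1" using Suc.prems(6) as by simp
    then show ?thesis using koszul_swap_head[OF Suc.prems(1) a, of x] as by simp
  next
    case h2
    have "koszul M A \<eta> (a1 # a0 # as') x = 0"
      using tail[of a1 "a0 # as'" 0 "Suc j'"] Suc.prems as h2 a by auto
    then show ?thesis using koszul_swap_head[OF Suc.prems(1) a, of x] as by simp
  qed
qed simp

end

section \<open>The differential\<close>

text \<open>An arbitrary extension of a fibre element to a section, which need not depend smoothly
  on the point. By \<open>koszul_tensorial\<close> the choice does not affect the Koszul expression
  at \<open>x\<close>.\<close>

definition section_ext :: "('m, 'e::real_normed_vector) chart set \<Rightarrow>
    ('m, 'v, 'f::real_normed_vector, 'z) vector_bundle_scheme \<Rightarrow> 'm \<Rightarrow> 'v \<Rightarrow> 'm \<Rightarrow> 'v"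
  where "section_ext M E x v = (SOME a. a \<in> sections M E \<and> a x = v)"

text \<open>The candidate for the form described by \<open>ext_deriv\<close>, given by its values at
  fibre elements. The value 0 on the empty list matches the condition
  \<open>component 0 \<omega> = 0\<close> in that description.\<close>

definition koszul_form :: "('m, 'e::real_normed_vector) chart set \<Rightarrow>
    ('m, 'v::real_vector, 'f::real_normed_vector, 'e) lie_algebroid \<Rightarrow> ('m, 'v) form \<Rightarrow> ('m, 'v) form"
  where "koszul_form M A \<eta> = (\<lambda>x vs. if vs = [] \<or> \<not> set vs \<subseteq> fib A x then 0
    else koszul M A \<eta> (map (section_ext M A x) vs) x)"

context
  fixes M :: "('m::{t2_space, second_countable_topology}, 'e::real_normed_vector) chart set"
    and A :: "('m, 'v::real_vector, 'f::real_normed_vector, 'e) lie_algebroid"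
  assumes M: "smooth_manifold M" and A: "is_lie_algebroid M A"
begin

private lemmas vb = lie_algebroidD(1)[OF A]

lemma section_ext:
  assumes "v \<in> fib A x"
  shows "section_ext M A x v \<in> sections M A" "section_ext M A x v x = v"
  using someI_ex[of "\<lambda>a. a \<in> sections M A \<and> a x = v"] section_through[OF M vb assms]
  unfolding section_ext_def by metis+

text \<open>That the sum is a section is proved together with linearity, because the induction step
  uses it.\<close>

lemma koszul_sum_slot:
  fixes r :: nat
  assumes "\<eta> \<in> Omega_n M A n" "set as \<subseteq> sections M A" "length as = Suc n" "k < Suc n"
    and c: "\<And>i. i < r \<Longrightarrow> c i \<in> smooth_functions M" and \<epsilon>: "\<And>i. i < r \<Longrightarrow> \<epsilon> i \<in> sections M A"
  shows "(\<lambda>y. \<Sum>i<r. c i y *\<^sub>R \<epsilon> i y) \<in> sections M A \<and>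
    koszul M A \<eta> (as[k := \<lambda>y. \<Sum>i<r. c i y *\<^sub>R \<epsilon> i y]) x = (\<Sum>i<r. c i x * koszul M A \<eta> (as[k := \<epsilon> i])
      x)"
  using c \<epsilon>
proof (induction r)
  case 0
  have z: "(\<lambda>y. 0) \<in> sections M A" using zero_section[OF M A] by (simp add: zero_fun_def)
  from koszul_slot[OF M A assms(1-4) smooth_functions_const[OF M A, of 1] z z, of x] z
  show ?case by simp
next
  case (Suc r)
  let ?s = "\<lambda>y. \<Sum>i<r. c i y *\<^sub>R \<epsilon> i y"
  have s: "?s \<in> sections M A" and IH: "koszul M A \<eta> (as[k := ?s]) x = (\<Sum>i<r. c i x * koszul M A \<eta>
    (as[k := \<epsilon> i]) x)"
    using Suc by auto
  have eq: "(\<lambda>y. \<Sum>i<Suc r. c i y *\<^sub>R \<epsilon> i y) = (\<lambda>y. c r y *\<^sub>R \<epsilon> r y + ?s y)"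
    by (simp add: add.commute)
  show ?case
    unfolding eq
    using section_lincomb[OF M A _ _ s, of "c r" "\<epsilon> r"] koszul_slot[OF M A assms(1-4) _ _ s, of
      "c r" "\<epsilon> r" x] Suc.prems IH
    by simp
qed

text \<open>After a cut-off the section is a combination of global sections with coefficients that
  vanish at \<open>x\<close>, so linearity over functions gives zero. The cut-off itself comes out
  as the factor \<open>\<theta> x = 1\<close>.\<close>

lemma koszul_zero_at:
  assumes \<eta>: "\<eta> \<in> Omega_n M A n" and as: "set as \<subseteq> sections M A" "length as = Suc n" "k < Suc n"
    and a: "a \<in> sections M A" "a x = 0"
  shows "koszul M A \<eta> (as[k := a]) x = 0"
proof -
  obtain \<theta> V and r :: nat and \<epsilon> where d: "\<theta> \<in> smooth_functions M" "x \<in> V" "\<And>q. q \<in> V \<Longrightarrow> \<theta> q = 1"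
    "\<And>i. i < r \<Longrightarrow> \<epsilon> i \<in> sections M A"
    and dec: "\<And>a. local_section M UNIV A id a \<Longrightarrow> \<exists>c. (\<forall>i<r. c i \<in> smooth_functions M) \<and>
      (\<forall>q. \<theta> q *\<^sub>R a q = (\<Sum>i<r. c i q *\<^sub>R \<epsilon> i (id q))) \<and> (\<forall>q. a q = 0 \<longrightarrow> (\<forall>i<r. c i q = 0))"
    by (rule decomposition_along[OF M M smooth_map_id[OF M] vb, of x]) blast
  obtain c where c: "\<And>i. i < r \<Longrightarrow> c i \<in> smooth_functions M"
    "\<And>q. \<theta> q *\<^sub>R a q = (\<Sum>i<r. c i q *\<^sub>R \<epsilon> i q)" "\<And>i. i < r \<Longrightarrow> c i x = 0"
    using dec[of a] a unfolding sections_iff id_apply by metis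
  have z: "(\<lambda>y. 0) \<in> sections M A" using zero_section[OF M A] by (simp add: zero_fun_def)
  have k0: "koszul M A \<eta> (as[k := \<lambda>y. 0]) x = 0"
    using koszul_slot[OF M A \<eta> as smooth_functions_const[OF M A, of 1] z z, of x] by simp
  have "koszul M A \<eta> (as[k := \<lambda>y. \<theta> y *\<^sub>R a y + 0]) x = \<theta> x * koszul M A \<eta> (as[k := a]) x"
    using koszul_slot[OF M A \<eta> as d(1) a(1) z, of x] k0 by simp
  moreover have "(\<lambda>y. \<theta> y *\<^sub>R a y + 0) = (\<lambda>y. \<Sum>i<r. c i y *\<^sub>R \<epsilon> i y)" using c(2) by simp
  moreover have "koszul M A \<eta> (as[k := \<lambda>y. \<Sum>i<r. c i y *\<^sub>R \<epsilon> i y]) x = 0"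
    using koszul_sum_slot[OF \<eta> as c(1) d(4), where x = x] c(3) by simp
  ultimately show ?thesis using d(2,3) by simp
qed

lemma koszul_replace:
  assumes \<eta>: "\<eta> \<in> Omega_n M A n" and as: "set as \<subseteq> sections M A" "length as = Suc n" "k < Suc n"
    and ab: "a \<in> sections M A" "b \<in> sections M A" "a x = b x"
  shows "koszul M A \<eta> (as[k := a]) x = koszul M A \<eta> (as[k := b]) x"
proof -
  let ?d = "\<lambda>y. (-1) *\<^sub>R b y + a y"
  have d: "?d \<in> sections M A" by (rule section_lincomb[OF M A smooth_functions_const[OF M A]
    ab(2,1)])
  have "koszul M A \<eta> (as[k := \<lambda>y. 1 *\<^sub>R b y + ?d y]) x = 1 * koszul M A \<eta> (as[k := b]) x + koszul M
    A \<eta> (as[k := ?d]) x"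
    by (rule koszul_slot[OF M A \<eta> as smooth_functions_const[OF M A] ab(2) d])
  moreover have "koszul M A \<eta> (as[k := ?d]) x = 0"
    by (rule koszul_zero_at[OF \<eta> as d]) (simp add: ab(3))
  moreover have "(\<lambda>y. 1 *\<^sub>R b y + ?d y) = a" by (simp add: fun_eq_iff)
  ultimately show ?thesis by simp
qed

text \<open>The arguments are exchanged one at a time: the lists
  \<open>take m bs @ drop m as\<close> interpolate between \<open>as\<close> and \<open>bs\<close>,
  and neighbouring ones differ in one slot by sections that agree at \<open>x\<close>.\<close>

lemma koszul_tensorial:
  assumes \<eta>: "\<eta> \<in> Omega_n M A n" and as: "set as \<subseteq> sections M A" "length as = Suc n"
    and bs: "set bs \<subseteq> sections M A" and eq: "map (\<lambda>a. a x) as = map (\<lambda>b. b x) bs"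
  shows "koszul M A \<eta> as x = koszul M A \<eta> bs x"
proof -
  have lb: "length bs = Suc n" using eq as(2) by (metis length_map)
  have "koszul M A \<eta> (take m bs @ drop m as) x = koszul M A \<eta> as x" if "m \<le> Suc n" for m
    using that
  proof (induction m)
    case (Suc m)
    let ?l = "take m bs @ drop m as"
    have m: "m < Suc n" using Suc by simp
    have l: "set ?l \<subseteq> sections M A" "length ?l = Suc n"
      using as bs lb m set_take_subset[of m bs] set_drop_subset[of m as] by auto
    have d: "drop m as = as ! m # drop (Suc m) as" using m as(2) by (simp add: Cons_nth_drop_Suc)
    have upd: "?l[m := z] = take m bs @ z # drop (Suc m) as" for z
      using m lb by (simp add: d list_update_append)
    have "(as ! m) x = (bs ! m) x" using eq m as(2) lb by (metis nth_map)
    then have "koszul M A \<eta> (?l[m := bs ! m]) x = koszul M A \<eta> (?l[m := as ! m]) x"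
      by (intro koszul_replace[OF \<eta> l m]) (use as bs m lb in auto)
    moreover have "?l[m := as ! m] = ?l" by (simp only: upd d[symmetric])
    moreover have "?l[m := bs ! m] = take (Suc m) bs @ drop (Suc m) as"
      using m lb by (simp add: upd take_Suc_conv_app_nth)
    ultimately show ?case using Suc by simp
  qed simp
  from this[of "Suc n"] show ?thesis using as(2) lb by simp
qed

lemma koszul_form_eval:
  assumes \<eta>: "\<eta> \<in> Omega_n M A n" and as: "set as \<subseteq> sections M A" "length as = Suc n"
  shows "koszul_form M A \<eta> x (map (\<lambda>a. a x) as) = koszul M A \<eta> as x"
proof -
  have mem: "a x \<in> fib A x" if "a \<in> set as" for a using as(1) that section_mem[OF M A] by blast
  have "koszul M A \<eta> (map (section_ext M A x) (map (\<lambda>a. a x) as)) x = koszul M A \<eta> as x"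
    by (rule koszul_tensorial[OF \<eta>]) (use as mem section_ext in auto)
  then show ?thesis using as(2) mem by (auto simp: koszul_form_def)
qed

lemma koszul_form_Omega_n:
  assumes \<eta>: "\<eta> \<in> Omega_n M A n"
  shows "component (Suc n) (koszul_form M A \<eta>) \<in> Omega_n M A (Suc n)"
proof (rule Omega_nI[OF vb])
  let ?K = "koszul_form M A \<eta>"
  show "component (Suc n) ?K x vs = 0" if "\<not> (length vs = Suc n \<and> set vs \<subseteq> fib A x)" for x vs
    using that by (auto simp: component_def koszul_form_def)
  have ev: "component (Suc n) ?K x (map (\<lambda>a. a x) as) = koszul M A \<eta> as x"
    if "set as \<subseteq> sections M A" "length as = Suc n" for as x
    using koszul_form_eval[OF \<eta> that] that(2) by (simp add: component_def)
  show "alt_on (fib A x) (Suc n) (component (Suc n) ?K x)" for x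
    unfolding alt_on_def
  proof (intro conjI allI impI)
    let ?X = "section_ext M A x"
    fix us ws assume h: "length us + Suc (length ws) = Suc n \<and> set us \<subseteq> fib A x \<and> set ws \<subseteq> fib A x"
    \<comment> \<open>The zero section is a placeholder for slot \<open>length us\<close>, into
      which varying sections are put so that \<open>koszul_slot\<close> applies.\<close>
    let ?L = "map ?X us @ 0 # map ?X ws"
    have L: "set ?L \<subseteq> sections M A" "length ?L = Suc n" "length us < Suc n"
      using h section_ext(1) zero_section[OF M A] by auto
    have e: "component (Suc n) ?K x (us @ s x # ws) = koszul M A \<eta> (?L[length us := s]) x" if s:
      "s \<in> sections M A" for s
    proof -
      have "map (\<lambda>a. a x) (?L[length us := s]) = us @ s x # ws"
      proof -
        have "map (\<lambda>a. a x) (map ?X vs) = vs" if "set vs \<subseteq> fib A x" for vs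
          using that section_ext(2) by (induction vs) auto
        from this[of us] this[of ws] show ?thesis using h
          by (simp add: list_update_append)
      qed
      moreover have "set (?L[length us := s]) \<subseteq> sections M A"
        using L(1) s set_update_subset_insert[of ?L "length us" s] by blast
      ultimately show ?thesis using ev[of "?L[length us := s]" x] L(2) by simp
    qed
    show "linear_on_subspace (fib A x) (\<lambda>v. component (Suc n) ?K x (us @ v # ws))"
      unfolding linear_on_subspace_def
    proof (intro conjI ballI allI)
      fix v w assume vw: "v \<in> fib A x" "w \<in> fib A x"
      let ?s = "\<lambda>y. 1 *\<^sub>R ?X v y + ?X w y"
      have s: "?s \<in> sections M A"
        by (rule section_lincomb[OF M A smooth_functions_const[OF M A] section_ext(1)[OF vw(1)]
          section_ext(1)[OF vw(2)]])
      show "component (Suc n) ?K x (us @ (v + w) # ws)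
          = component (Suc n) ?K x (us @ v # ws) + component (Suc n) ?K x (us @ w # ws)"
        using e[OF s] e[OF section_ext(1)[OF vw(1)]] e[OF section_ext(1)[OF vw(2)]]
          koszul_slot[OF M A \<eta> L smooth_functions_const[OF M A, of 1] section_ext(1)[OF vw(1)]
            section_ext(1)[OF vw(2)], of x]
        by (simp add: section_ext(2) vw)
    next
      fix c v assume v: "v \<in> fib A x"
      let ?s = "\<lambda>y. c *\<^sub>R ?X v y + 0 y"
      have s: "?s \<in> sections M A"
        by (rule section_lincomb[OF M A smooth_functions_const[OF M A] section_ext(1)[OF v]
          zero_section[OF M A]])
      have "koszul M A \<eta> (?L[length us := 0]) x = 0"
        by (rule koszul_zero_at[OF \<eta> L zero_section[OF M A]]) simp
      then show "component (Suc n) ?K x (us @ (c *\<^sub>R v) # ws) = c *\<^sub>R component (Suc n) ?K x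
        (us @ v # ws)"
        using e[OF s] e[OF section_ext(1)[OF v]]
          koszul_slot[OF M A \<eta> L smooth_functions_const[OF M A, of c] section_ext(1)[OF v]
            zero_section[OF M A], of x]
        by (simp add: section_ext(2) v)
    qed
  next
    fix vs i j assume ij: "i < Suc n" "j < Suc n" "length vs = Suc n \<and> set vs \<subseteq> fib A x \<and> i \<noteq> j \<and> vs
      ! i = vs ! j"
    have "koszul M A \<eta> (map (section_ext M A x) vs) x = 0"
    proof (cases "i < j")
      case True
      show ?thesis
        by (rule koszul_dup[OF M A \<eta> _ _ True]) (use ij section_ext(1) in auto)
    next
      case False
      then have ji: "j < i" using ij by simp
      show ?thesis
        by (rule koszul_dup[OF M A \<eta> _ _ ji]) (use ij section_ext(1) in auto)
    qed
    then show "component (Suc n) ?K x vs = 0" by (simp add: component_def koszul_form_def)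
  qed
  fix u and ys :: "'f list" assume u: "u \<in> trivs A" and ys: "length ys = Suc n"
  show "smooth_fun_on M (fst u) (\<lambda>x. component (Suc n) ?K x (map (triv_inv A u x) ys))"
  proof (rule smooth_fun_on_local[OF M])
    fix x assume x: "x \<in> fst u"
    \<comment> \<open>The extensions inside \<open>koszul_form\<close> change with the point without
      any smoothness. On \<open>V\<close> they are replaced by fixed global sections that restrict
      there to the local sections with coordinates \<open>ys\<close>.\<close>
    obtain \<theta> V where b: "open V" "x \<in> V" "V \<subseteq> fst u" "\<And>y. y \<in> V \<Longrightarrow> \<theta> y = 1"
      "\<And>w. (\<lambda>y. \<theta> y *\<^sub>R triv_inv A u y w) \<in> sections M A"
      by (rule bump_section[OF M vb u x]) blast
    let ?as = "map (\<lambda>w y. \<theta> y *\<^sub>R triv_inv A u y w) ys"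
    have as: "set ?as \<subseteq> sections M A" "length ?as = Suc n" using b(5) ys by auto
    have "smooth_fun_on M V (koszul M A \<eta> ?as)"
      using smooth_fun_on_subset[OF smooth_koszul[OF M A \<eta> as(1), unfolded smooth_functions_iff]]
        by blast
    then have "smooth_fun_on M V (\<lambda>x. component (Suc n) ?K x (map (triv_inv A u x) ys))"
    proof (rule smooth_fun_on_cong[OF M b(1), rotated])
      fix y assume y: "y \<in> V"
      have m: "map (\<lambda>a. a y) ?as = map (triv_inv A u y) ys" using b(4)[OF y] by simp
      show "koszul M A \<eta> ?as y = component (Suc n) ?K y (map (triv_inv A u y) ys)"
        using ev[OF as, of y] unfolding m by (rule sym)
    qed
    then show "\<exists>V. open V \<and> x \<in> V \<and> smooth_fun_on M V (\<lambda>x. component (Suc n) ?K x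
      (map (triv_inv A u x) ys))"
      using b(1,2) by blast
  qed
qed

lemma koszul_form_component:
  "component (Suc n) (koszul_form M A \<eta>) = component (Suc n) (koszul_form M A (component n \<eta>))"
proof (intro ext)
  fix x vs
  show "component (Suc n) (koszul_form M A \<eta>) x vs = component (Suc n) (koszul_form M A (component n
    \<eta>)) x vs"
    using koszul_component[of "map (section_ext M A x) vs" n M A \<eta>] by (simp add: component_def
      koszul_form_def)
qed

lemma koszul_form_Omega:
  assumes \<eta>: "\<eta> \<in> Omega M A"
  shows "koszul_form M A \<eta> \<in> Omega M A" "component 0 (koszul_form M A \<eta>) = 0"
    "as \<noteq> [] \<Longrightarrow> set as \<subseteq> sections M A \<Longrightarrow> eval_form (koszul_form M A \<eta>) as = koszul M A \<eta> as"
proof -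
  show 0: "component 0 (koszul_form M A \<eta>) = 0"
    by (simp add: component_def koszul_form_def fun_eq_iff)
  have S: "component (Suc n) (koszul_form M A \<eta>) \<in> Omega_n M A (Suc n)" for n
    by (subst koszul_form_component) (rule koszul_form_Omega_n[OF component_Omega[OF \<eta>]])
  have "component n (koszul_form M A \<eta>) \<in> Omega_n M A n" for n
  proof (cases n)
    case 0
    then show ?thesis using \<open>component 0 _ = 0\<close> subspace_0[OF subspace_Omega_n[OF M vb]] by simp
  next
    case (Suc m)
    then show ?thesis using S by simp
  qed
  moreover have "finite {n. component n (koszul_form M A \<eta>) \<noteq> 0}"
  proof -
    have "component (Suc n) (koszul_form M A \<eta>) = 0" if "component n \<eta> = 0" for n
    proof -
      have "koszul M A 0 as x = 0" for as x
      proof -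
        have "eval_form 0 bs = (\<lambda>x. 0)" for bs :: "('m \<Rightarrow> 'v) list" by (simp add: eval_form_def
          fun_eq_iff)
        then show ?thesis by (simp add: koszul_def tangent_apply_const)
      qed
      then have "koszul_form M A 0 = 0" by (simp add: koszul_form_def fun_eq_iff)
      then show ?thesis by (subst koszul_form_component) (simp add: that component_zero)
    qed
    then have "{n. component n (koszul_form M A \<eta>) \<noteq> 0} \<subseteq> Suc ` {n. component n \<eta> \<noteq> 0}"
      using 0 by (auto simp: image_iff) (metis not0_implies_Suc)
    moreover have "finite {n. component n \<eta> \<noteq> 0}" using \<eta> unfolding Omega_def by simp
    ultimately show ?thesis by (meson finite_imageI finite_subset)
  qed
  ultimately show "koszul_form M A \<eta> \<in> Omega M A" unfolding Omega_def by blast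
  assume as: "as \<noteq> []" "set as \<subseteq> sections M A"
  then obtain n where n: "length as = Suc n" by (cases as) auto
  show "eval_form (koszul_form M A \<eta>) as = koszul M A \<eta> as"
  proof
    fix x
    have "koszul_form M A (component n \<eta>) x (map (\<lambda>a. a x) as) = koszul M A (component n \<eta>) as x"
      by (rule koszul_form_eval[OF component_Omega[OF \<eta>] as(2) n])
    moreover have "component (Suc n) (koszul_form M A \<eta>) x (map (\<lambda>a. a x) as)
        = component (Suc n) (koszul_form M A (component n \<eta>)) x (map (\<lambda>a. a x) as)"
      by (subst koszul_form_component) (rule refl)
    ultimately show "eval_form (koszul_form M A \<eta>) as x = koszul M A \<eta> as x"
      using n koszul_component[OF n, of M A \<eta>] by (simp add: eval_form_def component_def)
  qed
qed

text \<open>Every fibre element extends to a section, so values on sections determine a form in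
  positive degrees. Degree 0 and lists that leave the fibre are settled by the normalizations. This
  is the uniqueness behind \<open>THE\<close>.\<close>

lemma Omega_eqI:
  assumes "\<omega> \<in> Omega M A" "\<omega>' \<in> Omega M A" "component 0 \<omega> = 0" "component 0 \<omega>' = 0"
    and eq: "\<And>as. as \<noteq> [] \<Longrightarrow> set as \<subseteq> sections M A \<Longrightarrow> eval_form \<omega> as = eval_form \<omega>' as"
  shows "\<omega> = \<omega>'"
proof (intro ext)
  fix x vs
  consider "\<not> set vs \<subseteq> fib A x" | "vs = []" | "set vs \<subseteq> fib A x" "vs \<noteq> []" by blast
  then show "\<omega> x vs = \<omega>' x vs"
  proof cases
    case 1
    then show ?thesis using Omega_vanish[OF M vb assms(1)] Omega_vanish[OF M vb assms(2)] by simp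
  next
    case 2
    have "component 0 \<omega> x [] = component 0 \<omega>' x []" using assms(3,4) by simp
    then show ?thesis using 2 by (simp add: component_def)
  next
    case 3
    have "map (\<lambda>a. a x) (map (section_ext M A x) vs) = vs"
      using 3(1) section_ext(2) by (induction vs) auto
    moreover have "eval_form \<omega> (map (section_ext M A x) vs) x = eval_form \<omega>'
      (map (section_ext M A x) vs) x"
    proof -
      have "set (map (section_ext M A x) vs) \<subseteq> sections M A" using 3(1) section_ext(1) by auto
      then show ?thesis using eq[of "map (section_ext M A x) vs"] 3(2) by simp
    qed
    ultimately show ?thesis by (simp add: eval_form_def del: map_map)
  qed
qed

text \<open>Besides giving the existence of differentials this serves to compute one: any form with
  the right values on sections is the differential. In the homotopy formula it is applied to a
  combination of pullbacks and an integral.\<close>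

lemma ext_deriv_eqI:
  assumes "\<omega> \<in> Omega M A" "component 0 \<omega> = 0"
    "\<And>as. as \<noteq> [] \<Longrightarrow> set as \<subseteq> sections M A \<Longrightarrow> eval_form \<omega> as = koszul M A \<eta> as"
  shows "ext_deriv M A \<eta> = \<omega>"
  unfolding ext_deriv_def
proof (rule the_equality)
  show "\<omega>' = \<omega>" if "\<omega>' \<in> Omega M A \<and> component 0 \<omega>' = 0 \<and>
      (\<forall>as. as \<noteq> [] \<and> set as \<subseteq> sections M A \<longrightarrow> eval_form \<omega>' as = koszul M A \<eta> as)" for \<omega>'
  proof (rule Omega_eqI[OF _ assms(1) _ assms(2)])
    show "\<omega>' \<in> Omega M A" "component 0 \<omega>' = 0" using that by blast+
    fix as assume "as \<noteq> []" "set as \<subseteq> sections M A"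
    then show "eval_form \<omega>' as = eval_form \<omega> as" using that assms(3)[of as] by metis
  qed
qed (use assms in blast)

lemma ext_deriv:
  assumes \<eta>: "\<eta> \<in> Omega M A"
  shows "ext_deriv M A \<eta> \<in> Omega M A" "component 0 (ext_deriv M A \<eta>) = 0"
    "as \<noteq> [] \<Longrightarrow> set as \<subseteq> sections M A \<Longrightarrow> eval_form (ext_deriv M A \<eta>) as = koszul M A \<eta> as"
proof -
  have "ext_deriv M A \<eta> = koszul_form M A \<eta>"
    by (rule ext_deriv_eqI[OF koszul_form_Omega[OF \<eta>]])
  then show "ext_deriv M A \<eta> \<in> Omega M A" "component 0 (ext_deriv M A \<eta>) = 0"
    "as \<noteq> [] \<Longrightarrow> set as \<subseteq> sections M A \<Longrightarrow> eval_form (ext_deriv M A \<eta>) as = koszul M A \<eta> as"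
    using koszul_form_Omega[OF \<eta>] by auto
qed

end

section \<open>Pullback commutes with the Koszul formula\<close>

lemma nth_omit: "i < length xs \<Longrightarrow> j < length xs - 1 \<Longrightarrow>
  omit i xs ! j = xs ! (if j < i then j else Suc j)"
  by (auto simp: omit_def nth_append min_def)

lemma omit_omit: "i < k \<Longrightarrow> k < length xs \<Longrightarrow> omit (k - 1) (omit i xs) = omit i (omit k xs)"
proof (induction xs arbitrary: i k)
  case (Cons a xs)
  then obtain k' where k: "k = Suc k'" by (cases k) auto
  show ?case
  proof (cases i)
    case (Suc i')
    then obtain k'' where "k' = Suc k''" using Cons.prems k by (cases k') auto
    then show ?thesis using Cons.IH[of i' k'] Cons.prems k Suc by simp
  qed (simp add: k)
qed simp

text \<open>The pairs on the left stand for ordered pairs of distinct indices, \<open>j\<close>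
  being the position of the second index among those other than the first. Each unordered pair
  \<open>i < k\<close> thus occurs twice, as \<open>(i, k - 1)\<close> and as
  \<open>(k, i)\<close>.\<close>

lemma double_sum_pairs:
  fixes h :: "nat \<Rightarrow> nat \<Rightarrow> 'a::comm_monoid_add"
  shows "(\<Sum>i<Suc n. \<Sum>j<n. h i j) = (\<Sum>k<Suc n. \<Sum>i<k. h i (k - 1) + h k i)"
proof (induction n)
  case (Suc n)
  have "(\<Sum>i<Suc (Suc n). \<Sum>j<Suc n. h i j) = (\<Sum>i<Suc n. \<Sum>j<n. h i j) + (\<Sum>i<Suc n. h i n) +
    (\<Sum>j<Suc n. h (Suc n) j)"
    by (simp add: sum.distrib ac_simps)
  also have "\<dots> = (\<Sum>k<Suc n. \<Sum>i<k. h i (k - 1) + h k i) + (\<Sum>i<Suc n. h i (Suc n - 1) + h (Suc n) i)"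
    unfolding Suc by (simp add: sum.distrib ac_simps)
  finally show ?case by simp
qed simp

text \<open>This is the error of the Leibniz rule when \<open>t i k\<close> is the derivative of the coefficients of
  the \<open>k\<close>-th argument along the \<open>i\<close>-th anchor.\<close>

lemma alternating_pairs:
  fixes F :: "'v::real_vector list \<Rightarrow> real" and t :: "nat \<Rightarrow> nat \<Rightarrow> 'v"
  assumes F: "alt_on S n F" and S: "subspace S" and vs: "length vs = Suc n" "set vs \<subseteq> S"
    and t: "\<And>i k. i < Suc n \<Longrightarrow> k < Suc n \<Longrightarrow> t i k \<in> S"
  shows "(\<Sum>i<Suc n. (-1) ^ i * (\<Sum>j<n. F ((omit i vs)[j := t i (omit i [0..<Suc n] ! j)])))
    = (\<Sum>k<Suc n. \<Sum>i<k. (-1) ^ (i + k) * (F (t k i # omit i (omit k vs)) - F (t i k # omit i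
      (omit k vs))))"
proof -
  let ?h = "\<lambda>i j. (-1) ^ i * F ((omit i vs)[j := t i (omit i [0..<Suc n] ! j)])"
  have front: "F ((omit i vs)[j := z]) = (-1) ^ j * F (z # omit j (omit i vs))"
    if "i < Suc n" "j < n" "z \<in> S" for i j z
    by (rule alt_on_front[OF F _ _ that(2,3) S])
      (use vs that length_omit[of i vs] set_omit[of i vs] in auto)
  have "(\<Sum>i<Suc n. (-1) ^ i * (\<Sum>j<n. F ((omit i vs)[j := t i (omit i [0..<Suc n] ! j)]))) =
    (\<Sum>i<Suc n. \<Sum>j<n. ?h i j)"
    by (simp add: sum_distrib_left)
  also have "\<dots> = (\<Sum>k<Suc n. \<Sum>i<k. ?h i (k - 1) + ?h k i)" by (rule double_sum_pairs)
  also have "\<dots> = (\<Sum>k<Suc n. \<Sum>i<k. (-1) ^ (i + k) * (F (t k i # omit i (omit k vs)) - F (t i k # omit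
    i (omit k vs))))"
  proof (intro sum.cong refl)
    fix k i assume "k \<in> {..<Suc n}" "i \<in> {..<k}"
    then have ik: "i < k" "k < Suc n" "i < Suc n" "k - 1 < n" "i < n" by auto
    have n1: "omit i [0..<Suc n] ! (k - 1) = k"
      using ik nth_omit[of i "[0..<Suc n]" "k - 1"] by (simp del: upt_Suc)
    have n2: "omit k [0..<Suc n] ! i = i"
      using ik nth_omit[of k "[0..<Suc n]" i] by (simp del: upt_Suc)
    \<comment> \<open>Once \<open>i < k\<close> is omitted, argument \<open>k\<close> stands in slot
      \<open>k - 1\<close>. The lost factor makes the two terms of a pair enter with opposite
      signs.\<close>
    have s: "(-1::real) ^ (k - Suc 0) = - ((-1) ^ k)" using ik(1) by (cases k) auto
    have "?h i (k - 1) = - ((-1) ^ (i + k) * F (t i k # omit i (omit k vs)))"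
      unfolding n1 front[OF ik(3,4) t[OF ik(3,2)]] using omit_omit[of i k vs] ik vs(1)
      by (simp add: s power_add)
    moreover have "?h k i = (-1) ^ (i + k) * F (t k i # omit i (omit k vs))"
      unfolding n2 front[OF ik(2,5) t[OF ik(2,3)]] by (simp add: power_add)
    ultimately show "?h i (k - 1) + ?h k i
        = (-1) ^ (i + k) * (F (t k i # omit i (omit k vs)) - F (t i k # omit i (omit k vs)))"
      by (simp add: right_diff_distrib)
  qed
  finally show ?thesis .
qed

lemma sum_fun_apply: "(\<Sum>i\<in>I. f i) x = (\<Sum>i\<in>I. f i x)" for f :: "'i \<Rightarrow> 'a \<Rightarrow> 'b::comm_monoid_add"
  by (induction I rule: infinite_finite_induct) auto

lemma local_section_pull:
  assumes P: "smooth_manifold P" and N: "smooth_manifold N" and f: "smooth_map P N f"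
    and E: "smooth_vector_bundle N E" and s: "s \<in> sections N E"
  shows "local_section P UNIV E f (\<lambda>q. s (f q))"
  unfolding local_section_def
proof (intro conjI ballI)
  show "s (f q) \<in> fib E (f q)" for q using s by (simp add: sections_def)
  fix u assume u: "u \<in> trivs E"
  have "smooth_fun_on N (fst u) (\<lambda>x. snd u x (s x))" using s u by (simp add: sections_def)
  from smooth_fun_on_compose[OF P N f this open_triv[OF E u], of "f -` fst u"]
  show "smooth_fun_on P (UNIV \<inter> f -` fst u) (\<lambda>p. snd u (f p) (s (f p)))"
    using open_vimage_triv[OF P N f E u] by auto
qed

lemma subspace_sections:
  fixes N :: "('n::{t2_space, second_countable_topology}, 'd::real_normed_vector) chart set"
    and B :: "('n, 'w::real_vector, 'g::real_normed_vector, 'd) lie_algebroid"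
  assumes N: "smooth_manifold N" and B: "is_lie_algebroid N B"
  shows "subspace (sections N B)"
proof (rule subspaceI)
  show "0 \<in> sections N B" by (rule zero_section[OF N B])
  show "a + b \<in> sections N B" if "a \<in> sections N B" "b \<in> sections N B" for a b
    using section_lincomb[OF N B smooth_functions_const[OF N B, of 1] that]
      by (simp add: plus_fun_def)
  show "k *\<^sub>R a \<in> sections N B" if "a \<in> sections N B" for k a
    using section_lincomb[OF N B smooth_functions_const[OF N B, of k] that zero_section[OF N B]]
    by (simp add: scaleR_fun_def)
qed

section \<open>Combinations of pulled back sections and their frozen counterparts\<close>

context
  fixes P :: "('p::{t2_space, second_countable_topology}, 'e::real_normed_vector) chart set"
    and N :: "('n::{t2_space, second_countable_topology}, 'd::real_normed_vector) chart set"
    and B :: "('n, 'w::real_vector, 'g::real_normed_vector, 'd) lie_algebroid"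
    and f :: "'p \<Rightarrow> 'n" and r :: nat and \<epsilon> :: "nat \<Rightarrow> 'n \<Rightarrow> 'w"
  assumes P: "smooth_manifold P" and N: "smooth_manifold N" and f: "smooth_map P N f"
    and B: "is_lie_algebroid N B" and \<epsilon>: "\<And>i. i < r \<Longrightarrow> \<epsilon> i \<in> sections N B"
begin

private lemmas vbB = lie_algebroidD(1)[OF B]

private abbreviation comb :: "(nat \<Rightarrow> 'p \<Rightarrow> real) \<Rightarrow> 'p \<Rightarrow> 'w"
  where "comb c q \<equiv> (\<Sum>i<r. c i q *\<^sub>R \<epsilon> i (f q))"

text \<open>Its value at \<open>f p\<close> is \<open>comb c p\<close>. Unlike \<open>comb c\<close>
  it lives on the base of \<open>B\<close>, where the bracket and the Koszul expression of
  \<open>B\<close> apply to it.\<close>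

private abbreviation frozen :: "'p \<Rightarrow> (nat \<Rightarrow> 'p \<Rightarrow> real) \<Rightarrow> 'n \<Rightarrow> 'w"
  where "frozen p c \<equiv> (\<Sum>i<r. c i p *\<^sub>R \<epsilon> i)"

lemma frozen_section: "frozen p c \<in> sections N B"
  by (intro subspace_sum subspace_scale subspace_sections[OF N B] \<epsilon>) simp

lemma frozen_apply: "frozen p c y = (\<Sum>i<r. c i p *\<^sub>R \<epsilon> i y)"
  by (simp add: sum_fun_apply scaleR_fun_def)

lemma section_mem_B: "s \<in> sections N B \<Longrightarrow> s y \<in> fib B y"
  by (simp add: sections_def)

lemma comb_mem: "(\<Sum>i<r. k i *\<^sub>R \<epsilon> i y) \<in> fib B y"
  by (intro subspace_sum subspace_scale subspace_fib[OF vbB] section_mem_B \<epsilon>) simp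

lemma local_section_comb:
  assumes "\<And>i. i < r \<Longrightarrow> c i \<in> smooth_functions P"
  shows "local_section P UNIV B f (comb c)"
proof -
  have "local_section P UNIV B f (\<lambda>q. \<Sum>i<m. c i q *\<^sub>R \<epsilon> i (f q))" if "m \<le> r" for m
    using that
  proof (induction m)
    case 0
    show ?case using local_section_pull[OF P N f vbB zero_section[OF N B]]
      by (simp add: zero_fun_def)
  next
    case (Suc m)
    have "local_section P UNIV B f (\<lambda>q. c m q *\<^sub>R \<epsilon> m (f q))"
      by (rule local_section_scale[OF P N f vbB open_UNIV _ local_section_pull[OF P N f vbB \<epsilon>]])
        (use assms Suc.prems in \<open>auto simp: smooth_functions_iff\<close>)
    from local_section_add[OF P N f vbB open_UNIV Suc.IH this] Suc.prems show ?case by simp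
  qed
  then show ?thesis by simp
qed

text \<open>The coefficients are frozen in one slot after the other.\<close>

lemma leibniz_frozen:
  assumes \<eta>: "\<eta> \<in> Omega_n N B n" and pre: "set pre \<subseteq> sections N B"
    and cs: "\<And>c i. c \<in> set cs \<Longrightarrow> i < r \<Longrightarrow> c i \<in> smooth_functions P" and len: "length pre + length cs =
      n"
  shows "tangent_apply P p \<xi> (\<lambda>q. \<eta> (f q) (map (\<lambda>s. s (f q)) pre @ map (\<lambda>c. comb c q) cs))
    = tangent_apply P p \<xi> (\<lambda>q. \<eta> (f q) (map (\<lambda>s. s (f q)) (pre @ map (frozen p) cs)))
      + (\<Sum>j<length cs. \<eta> (f p) ((map (\<lambda>s. s (f p)) pre @ map (\<lambda>c. comb c p) cs)
          [length pre + j := \<Sum>i<r. tangent_apply P p \<xi> ((cs ! j) i) *\<^sub>R \<epsilon> i (f p)]))"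
  using pre cs len
proof (induction cs arbitrary: pre)
  case (Cons c cs)
  let ?D = "tangent_apply P p \<xi>"
  \<comment> \<open>The slot under treatment is made variable: the slots before it hold sections of
    \<open>B\<close>, those after it still hold combinations.\<close>
  define G where "G s q = \<eta> (f q) (map (\<lambda>s. s (f q)) (pre @ [s]) @ map (\<lambda>c. comb c q) cs)" for s q
  have sG: "smooth_fun_on P UNIV (G s)" if s: "s \<in> sections N B" for s
  proof -
    have "smooth_fun_on P UNIV (\<lambda>q. \<eta> (f q) (map (\<lambda>a. a q) (map (\<lambda>s q. s (f q)) (pre @ [s]) @ map
      comb cs)))"
    proof (rule smooth_form_eval[OF P N f vbB \<eta> open_UNIV])
      fix a assume "a \<in> set (map (\<lambda>s q. s (f q)) (pre @ [s]) @ map comb cs)"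
      then consider s' where "s' \<in> sections N B" "a = (\<lambda>q. s' (f q))" | c where "c \<in> set cs"
        "a = comb c"
        using Cons.prems(1) s by auto
      then show "local_section P UNIV B f a"
      proof cases
        case 1
        then show ?thesis using local_section_pull[OF P N f vbB] by simp
      next
        case 2
        then show ?thesis using local_section_comb[of c] Cons.prems(2) by simp
      qed
    qed
    then show ?thesis unfolding G_def by (simp add: o_def)
  qed
  have c: "smooth_fun_on P UNIV (c i)" if "i < r" for i
    using Cons.prems(2)[of c i] that by (simp add: smooth_functions_iff)
  have mem: "set (map (\<lambda>s. s (f q)) pre) \<subseteq> fib B (f q)" "set (map (\<lambda>c. comb c q) cs) \<subseteq> fib B (f q)"
    for q
    using Cons.prems(1) section_mem_B comb_mem by auto
  have lin: "linear_on_subspace (fib B (f q)) (\<lambda>v. \<eta> (f q) (map (\<lambda>s. s (f q)) pre @ v # map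
    (\<lambda>c. comb c q) cs))" for q
    by (rule alt_on_linear[OF Omega_nD(2)[OF vbB \<eta>]]) (use Cons.prems(3) mem in auto)
  have expand: "\<eta> (f q) (map (\<lambda>s. s (f q)) pre @ (\<Sum>i<r. k i *\<^sub>R \<epsilon> i (f q)) # map (\<lambda>c. comb c q) cs)
      = (\<Sum>i<r. k i * G (\<epsilon> i) q)" for k q
    using linear_on_subspace_sum[OF lin subspace_fib[OF vbB], where I = "{..<r}" and v =
      "\<lambda>i. \<epsilon> i (f q)" and k = k]
      section_mem_B[OF \<epsilon>] unfolding G_def by simp
  have "?D (\<lambda>q. \<eta> (f q) (map (\<lambda>s. s (f q)) pre @ map (\<lambda>c. comb c q) (c # cs)))
      = ?D (\<lambda>q. \<Sum>i<r. c i q * G (\<epsilon> i) q)"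
    using expand[of _ "\<lambda>i. c i _"] by (simp add: expand)
  also have "\<dots> = (\<Sum>i<r. ?D (\<lambda>q. c i q * G (\<epsilon> i) q))"
    by (rule tangent_apply_sum[OF P open_UNIV UNIV_I smooth_fun_on_mult[OF P open_UNIV c sG[OF \<epsilon>]]])
      auto
  also have "\<dots> = (\<Sum>i<r. c i p * ?D (G (\<epsilon> i)) + ?D (c i) * G (\<epsilon> i) p)"
    by (rule sum.cong) (simp_all add: tangent_apply_mult[OF P open_UNIV UNIV_I c sG[OF \<epsilon>]])
  also have "\<dots> = (\<Sum>i<r. c i p * ?D (G (\<epsilon> i))) + (\<Sum>i<r. ?D (c i) * G (\<epsilon> i) p)"
    by (rule sum.distrib)
  \<comment> \<open>The coefficients are constants now, so the sum can be taken back inside the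
    derivative; this freezes the slot.\<close>
  also have "(\<Sum>i<r. c i p * ?D (G (\<epsilon> i))) = ?D (G (frozen p c))"
  proof -
    have "G (frozen p c) = (\<lambda>q. \<Sum>i<r. c i p * G (\<epsilon> i) q)"
      using expand[of _ "\<lambda>i. c i p"] by (simp add: G_def frozen_apply fun_eq_iff)
    moreover have "?D (\<lambda>q. \<Sum>i<r. c i p * G (\<epsilon> i) q) = (\<Sum>i<r. ?D (\<lambda>q. c i p * G (\<epsilon> i) q))"
      by (rule tangent_apply_sum[OF P open_UNIV UNIV_I smooth_fun_on_mult[OF P open_UNIV
        smooth_fun_on_const[OF P] sG[OF \<epsilon>]]]) auto
    moreover have "?D (\<lambda>q. c i p * G (\<epsilon> i) q) = c i p * ?D (G (\<epsilon> i))" if "i < r" for i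
      by (simp add: tangent_apply_mult[OF P open_UNIV UNIV_I smooth_fun_on_const[OF P]
        sG[OF \<epsilon>[OF that]]] tangent_apply_const)
    ultimately show ?thesis by simp
  qed
  also have "(\<Sum>i<r. ?D (c i) * G (\<epsilon> i) p)
      = \<eta> (f p) (map (\<lambda>s. s (f p)) pre @ (\<Sum>i<r. ?D (c i) *\<^sub>R \<epsilon> i (f p)) # map (\<lambda>c. comb c p) cs)"
    by (rule expand[symmetric])
  also have "?D (G (frozen p c)) = ?D (\<lambda>q. \<eta> (f q) (map (\<lambda>s. s (f q)) ((pre @ [frozen p c]) @ map
    (frozen p) cs)))
      + (\<Sum>j<length cs. \<eta> (f p) ((map (\<lambda>s. s (f p)) (pre @ [frozen p c]) @ map (\<lambda>c. comb c p) cs)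
          [length (pre @ [frozen p c]) + j := \<Sum>i<r. ?D ((cs ! j) i) *\<^sub>R \<epsilon> i (f p)]))"
    unfolding G_def by (rule Cons.IH) (use Cons.prems frozen_section in auto)
  finally show ?case
    unfolding length_Cons sum.lessThan_Suc_shift
    by (simp add: frozen_apply list_update_append o_def)
qed simp

text \<open>The coefficients are constants, so bilinearity produces no Leibniz terms. The result is
  the double sum in the bracket condition for homomorphisms.\<close>

lemma brk_frozen:
  "brk B (frozen p c) (frozen p c') y = (\<Sum>i<r. \<Sum>j<r. (c i p * c' j p) *\<^sub>R brk B (\<epsilon> i) (\<epsilon> j) y)"
proof -
  have br: "linear_on_subspace (sections N B) (brk B a)" "linear_on_subspace (sections N B)
    (\<lambda>b. brk B b a)"
    if "a \<in> sections N B" for a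
    using lie_algebroidD(3)[OF B] that unfolding lie_bracket_on_def by blast+
  note S = subspace_sections[OF N B]
  have "brk B (frozen p c) (frozen p c') = (\<Sum>i<r. c i p *\<^sub>R brk B (\<epsilon> i) (frozen p c'))"
    by (rule linear_on_subspace_sum[OF br(2)[OF frozen_section] S]) (simp add: \<epsilon>)
  also have "\<dots> = (\<Sum>i<r. c i p *\<^sub>R (\<Sum>j<r. c' j p *\<^sub>R brk B (\<epsilon> i) (\<epsilon> j)))"
  proof (intro sum.cong refl)
    fix i assume "i \<in> {..<r}"
    then show "c i p *\<^sub>R brk B (\<epsilon> i) (frozen p c') = c i p *\<^sub>R (\<Sum>j<r. c' j p *\<^sub>R brk B (\<epsilon> i) (\<epsilon> j))"
      using linear_on_subspace_sum[OF br(1)[OF \<epsilon>] S, where I = "{..<r}" and v = \<epsilon> and k =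
        "\<lambda>j. c' j p"] \<epsilon> by simp
  qed
  finally show ?thesis by (simp add: sum_fun_apply scaleR_fun_def scaleR_sum_right)
qed

text \<open>Let \<open>t i k\<close> collect the derivatives of the coefficients of argument
  \<open>k\<close> along the anchor of argument \<open>i\<close>. Freezing costs terms in
  \<open>t\<close> in every derivative, by \<open>leibniz_frozen\<close>, while the bracket
  condition contributes \<open>t i k - t k i\<close> to every bracket.
  \<open>alternating_pairs\<close> brings the first contribution into the shape of the second, with
  the opposite sign.\<close>

lemma koszul_pullback:
  fixes A :: "('p, 'v::real_vector, 'f::real_normed_vector, 'e) lie_algebroid"
  assumes \<eta>: "\<eta> \<in> Omega_n N B n" and A: "smooth_vector_bundle P A"
    and \<Phi>: "lie_algebroid_hom P A N B \<Phi>" and bm: "base_map \<Phi> = f"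
    and ss: "set ss \<subseteq> sections P A" "length ss = Suc n" and lc: "length cs = Suc n"
    and cs: "\<And>c i. c \<in> set cs \<Longrightarrow> i < r \<Longrightarrow> c i \<in> smooth_functions P"
    and dec: "\<And>j q. j < Suc n \<Longrightarrow> snd (\<Phi> (q, (ss ! j) q)) = comb (cs ! j) q"
    and br: "\<And>s s'. s \<in> set ss \<Longrightarrow> s' \<in> set ss \<Longrightarrow> brk A s s' p \<in> fib A p"
  shows "koszul N B \<eta> (map (frozen p) cs) (f p) = koszul P A (pullback A \<Phi> \<eta>) ss p"
proof -
  have vbh: "vb_hom P A N B f \<Phi>"
    and anc: "\<And>x v. v \<in> fib A x \<Longrightarrow> anchor B (f x) (snd (\<Phi> (x, v))) = tangent_map P N f x
      (anchor A x v)"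
    using \<Phi> unfolding lie_algebroid_hom_def Let_def bm by blast+
  \<comment> \<open>Both arguments are decomposed over the same sections \<open>\<epsilon>\<close>,
    so the two index ranges of the condition coincide.\<close>
  have hom: "snd (\<Phi> (p, brk A a b p)) =
        (\<Sum>i<r. \<Sum>j<r. (fa i p * fb j p) *\<^sub>R brk B (\<epsilon> i) (\<epsilon> j) (f p))
        + (\<Sum>j<r. tangent_apply P p (anchor A p (a p)) (fb j) *\<^sub>R \<epsilon> j (f p))
        - (\<Sum>i<r. tangent_apply P p (anchor A p (b p)) (fa i) *\<^sub>R \<epsilon> i (f p))"
    if "a \<in> sections P A" "b \<in> sections P A" "\<forall>i<r. fa i \<in> smooth_functions P \<and> \<epsilon> i \<in> sections N B"
      "\<forall>j<r. fb j \<in> smooth_functions P \<and> \<epsilon> j \<in> sections N B"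
      "\<forall>x. snd (\<Phi> (x, a x)) = comb fa x" "\<forall>x. snd (\<Phi> (x, b x)) = comb fb x" for a b fa fb
    using \<Phi>[unfolded lie_algebroid_hom_def Let_def bm, THEN conjunct2, THEN conjunct2,
        rule_format, OF that(1,2), of r fa \<epsilon> r fb \<epsilon> p] that(3-6) by blast
  define F where "F = \<eta> (f p)"
  define vals where "vals = map (\<lambda>c. comb c p) cs"
  define X where "X i = tangent_apply P p (anchor A p ((ss ! i) p))" for i
  define t where "t i k = (\<Sum>l<r. X i ((cs ! k) l) *\<^sub>R \<epsilon> l (f p))" for i k
  have F: "alt_on (fib B (f p)) n F" unfolding F_def by (rule Omega_nD(2)[OF vbB \<eta>])
  note S = subspace_fib[OF vbB, of "f p"]
  have vals: "length vals = Suc n" "set vals \<subseteq> fib B (f p)" using lc comb_mem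
    by (auto simp: vals_def)
  have t: "t i k \<in> fib B (f p)" for i k unfolding t_def by (rule comb_mem)
  have ssm: "s q \<in> fib A q" if "s \<in> set ss" for s q using ss(1) that by (auto simp: sections_def)
  have all: "map (\<lambda>s. snd (\<Phi> (q, s q))) ss = map (\<lambda>c. comb c q) cs" for q
    by (rule nth_equalityI) (use ss(2) lc dec in auto)
  have pb: "pullback A \<Phi> \<eta> q (map (\<lambda>s. s q) bs) = \<eta> (f q) (map (\<lambda>s. snd (\<Phi> (q, s q))) bs)"
    if "\<forall>s\<in>set bs. s q \<in> fib A q" for q bs
    using that by (auto simp: pullback_def bm o_def)
  have ev: "eval_form (pullback A \<Phi> \<eta>) (omit i ss) = (\<lambda>q. \<eta> (f q) (map (\<lambda>c. comb c q) (omit i cs)))"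
    for i
  proof
    fix q
    have "\<forall>s\<in>set (omit i ss). s q \<in> fib A q" using set_omit[of i ss] ssm by blast
    from pb[where bs = "omit i ss" and q = q, OF this] have "eval_form (pullback A \<Phi> \<eta>) (omit i ss)
      q
        = \<eta> (f q) (omit i (map (\<lambda>s. snd (\<Phi> (q, s q))) ss))"
      by (simp add: eval_form_def map_omit)
    then show "eval_form (pullback A \<Phi> \<eta>) (omit i ss) q = \<eta> (f q) (map (\<lambda>c. comb c q) (omit i cs))"
      unfolding all by (simp add: map_omit)
  qed
  have frv: "frozen p (cs ! i) (f p) = snd (\<Phi> (p, (ss ! i) p))" if "i < Suc n" for i
    using dec[OF that, of p] by (simp add: frozen_apply)
  let ?N = "\<lambda>i. tangent_apply N (f p) (anchor B (f p) (frozen p (cs ! i) (f p))) (eval_form \<eta>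
    (omit i (map (frozen p) cs)))"
  have X: "X i (eval_form (pullback A \<Phi> \<eta>) (omit i ss)) = ?N i +
    (\<Sum>j<n. F ((omit i vals)[j := t i (omit i [0..<Suc n] ! j)]))"
    if i: "i < Suc n" for i
  proof -
    have oc: "omit i cs = map ((!) cs) (omit i [0..<Suc n])"
      by (simp only: map_omit map_nth[of cs, unfolded lc])
    have lo: "length (omit i cs) = n" using i lc by (simp add: length_omit)
    have lo': "length (omit i [0..<Suc n]) = n" using i by (simp add: length_omit)
    have so: "set (omit i cs) \<subseteq> set cs" by (rule set_omit)
    have "X i (eval_form (pullback A \<Phi> \<eta>) (omit i ss))
        = X i (\<lambda>q. \<eta> (f q) (map (\<lambda>s. s (f q)) (map (frozen p) (omit i cs))))
          + (\<Sum>j<n. \<eta> (f p) ((map (\<lambda>c. comb c p) (omit i cs))[j := \<Sum>l<r. X i ((omit i cs ! j) l) *\<^sub>R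
            \<epsilon> l (f p)]))"
      unfolding ev X_def
      using leibniz_frozen[OF \<eta>, of "[]" "omit i cs" p "anchor A p ((ss ! i) p)"] cs so lo
        by (auto simp: subset_iff)
    also have "X i (\<lambda>q. \<eta> (f q) (map (\<lambda>s. s (f q)) (map (frozen p) (omit i cs)))) = ?N i"
    proof -
      have "set (omit i (map (frozen p) cs)) \<subseteq> sections N B"
        using set_omit[of i "map (frozen p) cs"] frozen_section by auto
      from smooth_eval_form[OF N B \<eta> this]
      have sg: "smooth_fun_on N UNIV (eval_form \<eta> (omit i (map (frozen p) cs)))"
        by (simp add: smooth_functions_iff)
      have "?N i = X i (\<lambda>q. eval_form \<eta> (omit i (map (frozen p) cs)) (f q))"
        unfolding frv[OF i] X_def using anc[OF ssm[of "ss ! i" p]] i ss(2)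
          tangent_apply_map[OF P N f sg open_UNIV UNIV_I] by simp
      then show ?thesis by (simp add: eval_form_def map_omit)
    qed
    also have "(\<Sum>j<n. \<eta> (f p) ((map (\<lambda>c. comb c p) (omit i cs))[j := \<Sum>l<r. X i ((omit i cs ! j) l)
      *\<^sub>R \<epsilon> l (f p)]))
        = (\<Sum>j<n. F ((omit i vals)[j := t i (omit i [0..<Suc n] ! j)]))"
      by (rule sum.cong) (simp_all add: F_def vals_def map_omit[symmetric] t_def oc lo' del:
        upt_Suc)
    finally show ?thesis .
  qed
  have Y: "eval_form (pullback A \<Phi> \<eta>) (brk A (ss ! i) (ss ! k) # omit i (omit k ss)) p
      = eval_form \<eta> (brk B (map (frozen p) cs ! i) (map (frozen p) cs ! k) # omit i
        (omit k (map (frozen p) cs))) (f p)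
        + (F (t i k # omit i (omit k vals)) - F (t k i # omit i (omit k vals)))"
    if ik: "i < k" "k < Suc n" for i k
  proof -
    let ?R = "omit i (omit k vals)"
    have i: "i < Suc n" using ik by simp
    have mem: "ss ! i \<in> set ss" "ss ! k \<in> set ss" "cs ! i \<in> set cs" "cs ! k \<in> set cs" using ik i
      ss(2) lc by auto
    have "set (omit i (omit k ss)) \<subseteq> set ss" by (rule subset_trans[OF set_omit set_omit])
    then have "\<forall>s\<in>set (brk A (ss ! i) (ss ! k) # omit i (omit k ss)). s p \<in> fib A p"
      using ssm br[OF mem(1,2)] by auto
    from pb[where bs = "brk A (ss ! i) (ss ! k) # omit i (omit k ss)" and q = p, OF this]
    have "eval_form (pullback A \<Phi> \<eta>) (brk A (ss ! i) (ss ! k) # omit i (omit k ss)) p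
        = F (snd (\<Phi> (p, brk A (ss ! i) (ss ! k) p)) # omit i (omit k (map (\<lambda>s. snd (\<Phi> (p, s p)))
          ss)))"
      by (simp add: eval_form_def map_omit F_def)
    also have "\<dots> = F (snd (\<Phi> (p, brk A (ss ! i) (ss ! k) p)) # ?R)" unfolding all vals_def ..
    also have "snd (\<Phi> (p, brk A (ss ! i) (ss ! k) p)) = brk B (frozen p (cs ! i))
      (frozen p (cs ! k)) (f p) + t i k - t k i"
      unfolding brk_frozen t_def X_def
      by (rule hom) (use mem ss(1) cs \<epsilon> dec[OF i] dec[OF ik(2)] in auto)
    also have "F ((brk B (frozen p (cs ! i)) (frozen p (cs ! k)) (f p) + t i k - t k i) # ?R)
        = F (brk B (frozen p (cs ! i)) (frozen p (cs ! k)) (f p) # ?R) + (F (t i k # ?R) - F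
          (t k i # ?R))"
    proof -
      have "set ?R \<subseteq> set vals" by (rule subset_trans[OF set_omit set_omit])
      then have "linear_on_subspace (fib B (f p)) (\<lambda>v. F ([] @ v # ?R))"
        using ik vals by (intro alt_on_linear[OF F]) (auto simp: length_omit)
      then have l: "linear_on_subspace (fib B (f p)) (\<lambda>v. F (v # ?R))" by simp
      have b: "brk B (frozen p (cs ! i)) (frozen p (cs ! k)) (f p) \<in> fib B (f p)"
        by (rule section_mem_B[OF brk_section[OF N B frozen_section frozen_section]])
      have add: "F ((v + w) # ?R) = F (v # ?R) + F (w # ?R)" if "v \<in> fib B (f p)" "w \<in> fib B (f p)"
        for v w
        using l that unfolding linear_on_subspace_def by blast
      have "F (((-1) *\<^sub>R t k i) # ?R) = (-1) *\<^sub>R F (t k i # ?R)"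
        using l t unfolding linear_on_subspace_def by blast
      moreover have "F ((brk B (frozen p (cs ! i)) (frozen p (cs ! k)) (f p) + t i k + (-1) *\<^sub>R t k
        i) # ?R)
          = F (brk B (frozen p (cs ! i)) (frozen p (cs ! k)) (f p) # ?R) + F (t i k # ?R) + F
            (((-1) *\<^sub>R t k i) # ?R)"
        unfolding add[OF subspace_add[OF S b t] subspace_scale[OF S t]] add[OF b t] ..
      ultimately show ?thesis by simp
    qed
    also have "F (brk B (frozen p (cs ! i)) (frozen p (cs ! k)) (f p) # ?R)
        = eval_form \<eta> (brk B (map (frozen p) cs ! i) (map (frozen p) cs ! k) # omit i
          (omit k (map (frozen p) cs))) (f p)"
    proof -
      have "map (\<lambda>s. s (f p)) (map (frozen p) cs) = vals" by (simp add: vals_def frozen_apply)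
      then have "map (\<lambda>s. s (f p)) (omit i (omit k (map (frozen p) cs))) = ?R"
        by (simp only: map_omit)
      then show ?thesis using ik i lc by (simp add: eval_form_def F_def)
    qed
    finally show ?thesis .
  qed
  let ?Y = "\<lambda>i k. eval_form \<eta> (brk B (map (frozen p) cs ! i) (map (frozen p) cs ! k) # omit i
    (omit k (map (frozen p) cs))) (f p)"
  have "koszul P A (pullback A \<Phi> \<eta>) ss p = (\<Sum>i<Suc n. (-1) ^ i * X i (eval_form (pullback A \<Phi> \<eta>)
    (omit i ss)))
      + (\<Sum>k<Suc n. \<Sum>i<k. (-1) ^ (i + k) * eval_form (pullback A \<Phi> \<eta>) (brk A (ss ! i) (ss ! k) # omit
        i (omit k ss)) p)"
    by (simp only: koszul_def ss(2) X_def)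
  also have "(\<Sum>i<Suc n. (-1) ^ i * X i (eval_form (pullback A \<Phi> \<eta>) (omit i ss)))
      = (\<Sum>i<Suc n. (-1) ^ i * ?N i) + (\<Sum>i<Suc n. (-1) ^ i *
        (\<Sum>j<n. F ((omit i vals)[j := t i (omit i [0..<Suc n] ! j)])))"
    by (subst sum.distrib[symmetric], rule sum.cong) (simp_all only: lessThan_iff X distrib_left)
  also have "(\<Sum>i<Suc n. (-1) ^ i * (\<Sum>j<n. F ((omit i vals)[j := t i (omit i [0..<Suc n] ! j)])))
      = (\<Sum>k<Suc n. \<Sum>i<k. (-1) ^ (i + k) * (F (t k i # omit i (omit k vals)) - F (t i k # omit i
        (omit k vals))))"
    by (rule alternating_pairs[OF F S vals t])
  also have "(\<Sum>k<Suc n. \<Sum>i<k. (-1) ^ (i + k) * eval_form (pullback A \<Phi> \<eta>) (brk A (ss ! i) (ss ! k) #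
    omit i (omit k ss)) p)
      = (\<Sum>k<Suc n. \<Sum>i<k. (-1) ^ (i + k) * ?Y i k)
        - (\<Sum>k<Suc n. \<Sum>i<k. (-1) ^ (i + k) * (F (t k i # omit i (omit k vals)) - F (t i k # omit i
          (omit k vals))))"
    unfolding sum_subtractf[symmetric]
    by (intro sum.cong refl) (simp_all only: lessThan_iff Y right_diff_distrib distrib_left; simp)
  finally have "koszul P A (pullback A \<Phi> \<eta>) ss p
      = (\<Sum>i<Suc n. (-1) ^ i * ?N i) + (\<Sum>k<Suc n. \<Sum>i<k. (-1) ^ (i + k) * ?Y i k)" by simp
  moreover have "(\<Sum>i<Suc n. (-1) ^ i * ?N i) = (\<Sum>i<Suc n. (-1) ^ i * tangent_apply N (f p)
      (anchor B (f p) ((map (frozen p) cs ! i) (f p))) (eval_form \<eta> (omit i (map (frozen p) cs))))"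
    by (rule sum.cong) (simp_all only: lessThan_iff nth_map lc)
  ultimately show ?thesis by (simp only: koszul_def length_map lc)
qed

end

text \<open>Derivatives see only germs, and the other terms only values at \<open>p\<close>. As
  \<open>A\<close> is here a bundle with some bracket operation, the agreement of the brackets at
  \<open>p\<close> is supplied as an assumption.\<close>

lemma koszul_local_cong:
  fixes P :: "('p::{t2_space, second_countable_topology}, 'e::real_normed_vector) chart set"
    and A :: "('p, 'v::real_vector, 'f::real_normed_vector, 'e) lie_algebroid"
  assumes P: "smooth_manifold P" and A: "smooth_vector_bundle P A" and \<omega>: "\<omega> \<in> Omega_n P A n"
    and ss: "set ss \<subseteq> sections P A" and len: "length ss' = length ss"
    and V: "open V" "p \<in> V" "\<And>i q. i < length ss \<Longrightarrow> q \<in> V \<Longrightarrow> (ss' ! i) q = (ss ! i) q"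
    and br: "\<And>i j. i < j \<Longrightarrow> j < length ss \<Longrightarrow> brk A (ss' ! i) (ss' ! j) p = brk A (ss ! i) (ss ! j) p"
  shows "koszul P A \<omega> ss' p = koszul P A \<omega> ss p"
proof -
  have m: "map (\<lambda>s. s q) ss' = map (\<lambda>s. s q) ss" if "q \<in> V" for q
    by (rule nth_equalityI) (use len V(3) that in auto)
  have ev: "eval_form \<omega> (omit i ss) q = eval_form \<omega> (omit i ss') q" if "q \<in> V" for i q
    unfolding eval_form_def map_omit m[OF that] ..
  have "tangent_apply P p \<xi> (eval_form \<omega> (omit i ss)) = tangent_apply P p \<xi> (eval_form \<omega>
    (omit i ss'))" for \<xi> i
  proof (rule tangent_apply_cong[OF P V(1,2) _ ev])
    have "smooth_fun_on P UNIV (\<lambda>q. \<omega> (id q) (map (\<lambda>a. a q) (omit i ss)))"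
      by (rule smooth_form_eval[OF P P smooth_map_id[OF P] A \<omega> open_UNIV])
        (use ss set_omit[of i ss] in \<open>auto simp: sections_iff[symmetric]\<close>)
    then show "smooth_fun_on P V (eval_form \<omega> (omit i ss))"
      unfolding eval_form_def[abs_def] id_apply by (rule smooth_fun_on_subset) simp
  qed
  moreover have "eval_form \<omega> (brk A (ss' ! i) (ss' ! j) # omit i (omit j ss')) p
      = eval_form \<omega> (brk A (ss ! i) (ss ! j) # omit i (omit j ss)) p" if "i < j" "j < length
        ss" for i j
    using br[OF that] by (simp add: eval_form_def map_omit m[OF V(2)])
  ultimately show ?thesis
    unfolding koszul_def len by (simp add: V(2,3))
qed

text \<open>The bracket condition replaces the axioms of a Lie algebroid for \<open>A\<close>: it lets the sections be
  cut off by a bump function.\<close>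

lemma pullback_ext_deriv:
  fixes P :: "('p::{t2_space, second_countable_topology}, 'e::real_normed_vector) chart set"
    and A :: "('p, 'v::real_vector, 'f::real_normed_vector, 'e) lie_algebroid"
    and N :: "('n::{t2_space, second_countable_topology}, 'd::real_normed_vector) chart set"
    and B :: "('n, 'w::real_vector, 'g::real_normed_vector, 'd) lie_algebroid"
  assumes P: "smooth_manifold P" and N: "smooth_manifold N" and A: "smooth_vector_bundle P A"
    and B: "is_lie_algebroid N B" and \<Phi>: "lie_algebroid_hom P A N B \<Phi>" and \<eta>: "\<eta> \<in> Omega N B"
    and ss: "ss \<noteq> []" "set ss \<subseteq> sections P A"
    and br: "\<And>\<theta> V s s'. \<theta> \<in> smooth_functions P \<Longrightarrow> open V \<Longrightarrow> p \<in> V \<Longrightarrow> (\<And>q. q \<in> V \<Longrightarrow> \<theta> q = 1) \<Longrightarrow>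
      s \<in> set ss \<Longrightarrow> s' \<in> set ss \<Longrightarrow>
      brk A (\<lambda>q. \<theta> q *\<^sub>R s q) (\<lambda>q. \<theta> q *\<^sub>R s' q) p = brk A s s' p \<and> brk A s s' p \<in> fib A p"
  shows "pullback A \<Phi> (ext_deriv N B \<eta>) p (map (\<lambda>s. s p) ss) = koszul P A (pullback A \<Phi> \<eta>) ss p"
proof -
  obtain n where n: "length ss = Suc n" using ss(1) by (cases ss) auto
  define f where "f = base_map \<Phi>"
  have vbh: "vb_hom P A N B f \<Phi>" using \<Phi> unfolding lie_algebroid_hom_def Let_def f_def by blast
  note f = vb_homD(1)[OF vbh]
  note vbB = lie_algebroidD(1)[OF B]
  obtain \<theta> V and r :: nat and \<epsilon> where \<theta>: "\<theta> \<in> smooth_functions P" and V: "open V" "p \<in> V"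
    "\<And>q. q \<in> V \<Longrightarrow> \<theta> q = 1"
    and \<epsilon>: "\<And>i. i < r \<Longrightarrow> \<epsilon> i \<in> sections N B"
    and dec: "\<And>a. local_section P UNIV B f a \<Longrightarrow> \<exists>c. (\<forall>i<r. c i \<in> smooth_functions P) \<and>
      (\<forall>q. \<theta> q *\<^sub>R a q = (\<Sum>i<r. c i q *\<^sub>R \<epsilon> i (f q))) \<and> (\<forall>q. a q = 0 \<longrightarrow> (\<forall>i<r. c i q = 0))"
    by (rule decomposition_along[OF P N f vbB, of p]) blast
  have ssm: "s q \<in> fib A q" if "s \<in> set ss" for s q using ss(2) that by (auto simp: sections_def)
  \<comment> \<open>It is the images of the cut-off sections, not those of the \<open>s\<close>
    themselves, for which a global decomposition over the \<open>\<epsilon> i\<close> is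
    obtained.\<close>
  have "\<exists>c. (\<forall>i<r. c i \<in> smooth_functions P) \<and> (\<forall>q. snd (\<Phi> (q, \<theta> q *\<^sub>R s q)) = (\<Sum>i<r. c i q *\<^sub>R \<epsilon> i
    (f q)))"
    if s: "s \<in> set ss" for s
  proof -
    have "local_section P UNIV A id s" using ss(2) s by (auto simp: sections_iff)
    from local_section_hom[OF P A vbh open_triv[OF vbB] triv_linear[OF vbB] subspace_fib[OF vbB]
      open_UNIV this]
    have "local_section P UNIV B f (\<lambda>q. snd (\<Phi> (q, s q)))" by simp
    from dec[OF this] obtain c where "\<forall>i<r. c i \<in> smooth_functions P"
      "\<And>q. \<theta> q *\<^sub>R snd (\<Phi> (q, s q)) = (\<Sum>i<r. c i q *\<^sub>R \<epsilon> i (f q))" by blast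
    moreover have "snd (\<Phi> (q, \<theta> q *\<^sub>R s q)) = \<theta> q *\<^sub>R snd (\<Phi> (q, s q))" for q
      using vb_homD(4)[OF vbh, of q] ssm[OF s, of q] unfolding linear_on_subspace_def by blast
    ultimately show ?thesis by auto
  qed
  then obtain C where C: "\<And>s i. s \<in> set ss \<Longrightarrow> i < r \<Longrightarrow> C s i \<in> smooth_functions P"
    "\<And>s q. s \<in> set ss \<Longrightarrow> snd (\<Phi> (q, \<theta> q *\<^sub>R s q)) = (\<Sum>i<r. C s i q *\<^sub>R \<epsilon> i (f q))"
    by metis
  define ss' where "ss' = map (\<lambda>s q. \<theta> q *\<^sub>R s q) ss"
  define cs where "cs = map C ss"
  \<comment> \<open>On \<open>n + 1\<close> sections the Koszul expression sees only the component
    of degree \<open>n\<close>, to which the results on homogeneous forms apply.\<close>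
  let ?\<eta> = "component n \<eta>"
  note \<eta>n = component_Omega[OF \<eta>, of n]
  have ss': "set ss' \<subseteq> sections P A" "length ss' = Suc n"
    using ss(2) n local_section_scale[OF P P smooth_map_id[OF P] A open_UNIV] \<theta>
    by (auto simp: ss'_def sections_iff smooth_functions_iff subset_iff)
  have cs: "length cs = Suc n" "\<And>c i. c \<in> set cs \<Longrightarrow> i < r \<Longrightarrow> c i \<in> smooth_functions P"
    using n C(1) by (auto simp: cs_def)
  have snd': "snd (\<Phi> (q, (ss' ! j) q)) = (\<Sum>i<r. (cs ! j) i q *\<^sub>R \<epsilon> i (f q))" if "j < Suc n" for j q
    using that n C(2)[of "ss ! j" q] by (simp add: ss'_def cs_def)
  have br': "brk A s s' p \<in> fib A p" if "s \<in> set ss'" "s' \<in> set ss'" for s s'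
    using that br[OF \<theta> V(1,2,3)] by (auto simp: ss'_def)
  have 1: "koszul N B ?\<eta> (map (\<lambda>c. \<Sum>i<r. c i p *\<^sub>R \<epsilon> i) cs) (f p) = koszul P A (pullback A \<Phi> ?\<eta>) ss'
    p"
  proof (rule koszul_pullback[OF P N f B _ \<eta>n A \<Phi> f_def[symmetric] ss' cs(1)])
    show "\<epsilon> i \<in> sections N B" if "i < r" for i by (rule \<epsilon>[OF that])
    show "c i \<in> smooth_functions P" if "c \<in> set cs" "i < r" for c i by (rule cs(2)[OF that])
    show "snd (\<Phi> (q, (ss' ! j) q)) = (\<Sum>i<r. (cs ! j) i q *\<^sub>R \<epsilon> i (f q))" if "j < Suc n" for j q
      by (rule snd'[OF that])
    show "brk A s s' p \<in> fib A p" if "s \<in> set ss'" "s' \<in> set ss'" for s s' by (rule br'[OF that])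
  qed
  \<comment> \<open>Near \<open>p\<close> the cut-off sections are the original ones; their brackets
    at \<open>p\<close> agree by the assumption on brackets.\<close>
  have 2: "koszul P A (pullback A \<Phi> ?\<eta>) ss' p = koszul P A (pullback A \<Phi> ?\<eta>) ss p"
  proof (rule koszul_local_cong[OF P A pullback_Omega_n[OF P N A vbB vbh \<eta>n] ss(2) _ V(1,2)])
    show "length ss' = length ss" by (simp add: ss'_def)
    show "(ss' ! i) q = (ss ! i) q" if "i < length ss" "q \<in> V" for i q
      using that V(3) by (simp add: ss'_def)
    show "brk A (ss' ! i) (ss' ! j) p = brk A (ss ! i) (ss ! j) p" if "i < j" "j < length ss" for i
      j
    proof -
      have "ss ! i \<in> set ss" "ss ! j \<in> set ss" using that by auto
      from br[OF \<theta> V(1,2,3) this] show ?thesis using that by (simp add: ss'_def)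
    qed
  qed
  have 3: "koszul P A (pullback A \<Phi> ?\<eta>) ss p = koszul P A (pullback A \<Phi> \<eta>) ss p"
  proof -
    have "component n (pullback A \<Phi> \<eta>) = pullback A \<Phi> ?\<eta>"
      by (auto simp: component_def pullback_def fun_eq_iff)
    then show ?thesis using koszul_component[OF n, of P A "pullback A \<Phi> \<eta>"] by simp
  qed
  let ?\<sigma> = "map (\<lambda>c. \<Sum>i<r. c i p *\<^sub>R \<epsilon> i) cs"
  have \<sigma>: "?\<sigma> \<noteq> []" "set ?\<sigma> \<subseteq> sections N B" "length ?\<sigma> = Suc n"
    using cs(1) frozen_section[OF P N f B \<epsilon>] by auto
  have "map (\<lambda>s. s (f p)) ?\<sigma> = map (\<lambda>v. snd (\<Phi> (p, v))) (map (\<lambda>s. s p) ss)"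
  proof (rule nth_equalityI)
    show "length (map (\<lambda>s. s (f p)) ?\<sigma>) = length (map (\<lambda>v. snd (\<Phi> (p, v))) (map (\<lambda>s. s p) ss))"
      using cs(1) n by simp
    fix j assume "j < length (map (\<lambda>s. s (f p)) ?\<sigma>)"
    then have j: "j < Suc n" using cs(1) by simp
    show "map (\<lambda>s. s (f p)) ?\<sigma> ! j = map (\<lambda>v. snd (\<Phi> (p, v))) (map (\<lambda>s. s p) ss) ! j"
      using snd'[OF j, of p] j cs(1) n V(2,3) by (simp add: ss'_def sum_fun_apply scaleR_fun_def)
  qed
  then have "pullback A \<Phi> (ext_deriv N B \<eta>) p (map (\<lambda>s. s p) ss) = eval_form (ext_deriv N B \<eta>) ?\<sigma>
    (f p)"
    using ssm by (auto simp: pullback_def f_def[symmetric] eval_form_def)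
  also have "\<dots> = koszul N B \<eta> ?\<sigma> (f p)" using ext_deriv(3)[OF N B \<eta> \<sigma>(1,2)] by simp
  also have "\<dots> = koszul N B ?\<eta> ?\<sigma> (f p)" using koszul_component[OF \<sigma>(3), of N B \<eta>] by simp
  finally show ?thesis using 1 2 3 by simp
qed

section \<open>The Lie algebroid \<open>T\<real> \<times> A\<close>\<close>

lemma fib_TR [simp]: "fib (TR_times M A) (t, x) = UNIV \<times> fib A x"
  and trivs_TR: "trivs (TR_times M A) = (\<lambda>u. (UNIV \<times> fst u, \<lambda>(t, x) (s, v). (s, snd u x v))) ` trivs
    A"
  and anchor_TR: "anchor (TR_times M A) (t, x) (s, v) =
    tangent_of_coords (line_times M) (t, x) (line_times_chart (chart_at M x)) (s, anchor A x v
      (chart_at M x))"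
  by (simp_all add: TR_times_def Let_def)

lemma brk_TR:
  "brk (TR_times M A) \<sigma> \<eta> (t, x) =
    (fst (\<sigma> (t, x)) * deriv (\<lambda>s. fst (\<eta> (s, x))) t - fst (\<eta> (t, x)) * deriv (\<lambda>s. fst (\<sigma> (s, x))) t
       + tangent_apply M x (anchor A x (snd (\<sigma> (t, x)))) (\<lambda>y. fst (\<eta> (t, y)))
       - tangent_apply M x (anchor A x (snd (\<eta> (t, x)))) (\<lambda>y. fst (\<sigma> (t, y))),
     brk A (\<lambda>y. snd (\<sigma> (t, y))) (\<lambda>y. snd (\<eta> (t, y))) x
       + fst (\<sigma> (t, x)) *\<^sub>R fibre_derivative A x (\<lambda>s. snd (\<eta> (s, x))) t
       - fst (\<eta> (t, x)) *\<^sub>R fibre_derivative A x (\<lambda>s. snd (\<sigma> (s, x))) t)"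
  by (simp add: TR_times_def Let_def)

lemma smooth_fun_on_Pair:
  assumes M: "smooth_manifold M" and W: "open W" and "smooth_fun_on M W f" "smooth_fun_on M W g"
  shows "smooth_fun_on M W (\<lambda>x. (f x, g x))"
  by (rule smooth_fun_onI)
    (rule smooth_on_Pair[OF open_chart_image[OF smooth_manifoldD(3)[OF M] W] smooth_fun_onD[OF
      assms(3)] smooth_fun_onD[OF assms(4)]])

context
  fixes M :: "('m::{t2_space, second_countable_topology}, 'e::real_normed_vector) chart set"
    and A :: "('m, 'v::real_vector, 'f::real_normed_vector, 'e) lie_algebroid"
  assumes M: "smooth_manifold M" and A: "smooth_vector_bundle M A"
begin

lemma triv_inv_TR:
  assumes "u \<in> trivs A" "x \<in> fst u"
  shows "triv_inv (TR_times M A) (UNIV \<times> fst u, \<lambda>(t, x) (s, v). (s, snd u x v)) (t, x) (s, y) =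
    (s, triv_inv A u x y)"
proof -
  let ?g = "\<lambda>(s::real, v). (s, snd u x v)"
  have "inj_on ?g (UNIV \<times> fib A x)"
    using bij_betw_imp_inj_on[OF triv_bij[OF A assms]] by (auto simp: inj_on_def)
  then have "inv_into (UNIV \<times> fib A x) ?g (?g (s, triv_inv A u x y)) = (s, triv_inv A u x y)"
    by (rule inv_into_f_f) (simp add: triv_inv_fib[OF A assms])
  then show ?thesis by (simp add: triv_inv_def[of "TR_times M A"] triv_triv_inv[OF A assms])
qed

lemma smooth_vector_bundle_TR: "smooth_vector_bundle (line_times M) (TR_times M A)"
  unfolding smooth_vector_bundle_def
proof (intro conjI allI ballI)
  note L = smooth_manifold_line_times[OF M]
  show "finite_dim TYPE(real \<times> 'f)" by (rule finite_dim_prod[OF finite_dim_real finite_dim_fibre[OF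
    A]])
  show "subspace (fib (TR_times M A) p)" for p
    using subspace_Times[OF subspace_UNIV subspace_fib[OF A, of "snd p"]] by (cases p) simp
  show "(\<Union>u\<in>trivs (TR_times M A). fst u) = UNIV"
  proof -
    have "(t, x) \<in> (\<Union>u\<in>trivs (TR_times M A). fst u)" for t x
      using triv_exists[OF A, of x] by (auto simp: trivs_TR)
    then show ?thesis by auto
  qed
  fix u' assume "u' \<in> trivs (TR_times M A)"
  then obtain u where u: "u \<in> trivs A" "u' = (UNIV \<times> fst u, \<lambda>(t, x) (s, v). (s, snd u x v))"
    unfolding trivs_TR by blast
  show "open (fst u')" using open_triv[OF A u(1)] by (simp add: u(2) open_Times)
  show "linear_on_subspace (fib (TR_times M A) p) (snd u' p)" if "p \<in> fst u'" for p
    using triv_linear[OF A u(1), of "snd p"] that by (cases p) (auto simp: u(2)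
      linear_on_subspace_def)
  show "bij_betw (snd u' p) (fib (TR_times M A) p) UNIV" if "p \<in> fst u'" for p
  proof -
    obtain t x where p: "p = (t, x)" by (cases p)
    have x: "x \<in> fst u" using that by (simp add: u(2) p)
    have "(s, y) \<in> (\<lambda>(s, v). (s, snd u x v)) ` (UNIV \<times> fib A x)" for s :: real and y
      by (rule image_eqI[of _ _ "(s, triv_inv A u x y)"]) (simp_all add: triv_triv_inv[OF A u(1) x]
        triv_inv_fib[OF A u(1) x])
    then show ?thesis
      using bij_betw_imp_inj_on[OF triv_bij[OF A u(1) x]] by (auto simp: bij_betw_def inj_on_def p
        u(2))
  qed
  fix w' and y :: "real \<times> 'f" assume "w' \<in> trivs (TR_times M A)"
  then obtain w where w: "w \<in> trivs A" "w' = (UNIV \<times> fst w, \<lambda>(t, x) (s, v). (s, snd w x v))"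
    unfolding trivs_TR by blast
  have o: "open (fst u \<inter> fst w)" using open_triv[OF A u(1)] open_triv[OF A w(1)] by blast
  then have oL: "open (UNIV \<times> (fst u \<inter> fst w))" by (simp add: open_Times)
  have e: "fst u' \<inter> fst w' = UNIV \<times> (fst u \<inter> fst w)" by (auto simp: u(2) w(2))
  have "smooth_fun_on (line_times M) (UNIV \<times> (fst u \<inter> fst w)) (\<lambda>p. (fst y, snd w (snd p)
    (triv_inv A u (snd p) (snd y))))"
    by (rule smooth_fun_on_Pair[OF L oL smooth_fun_on_const[OF L]
          smooth_fun_on_line_snd[OF M o triv_transition[OF A u(1) w(1)]]])
  then show "smooth_fun_on (line_times M) (fst u' \<inter> fst w') (\<lambda>p. snd w' p (triv_inv (TR_times M A)
    u' p y))"
    unfolding e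
  proof (rule smooth_fun_on_cong[OF L oL, rotated])
    fix p assume p: "p \<in> (UNIV :: real set) \<times> (fst u \<inter> fst w)"
    show "(fst y, snd w (snd p) (triv_inv A u (snd p) (snd y))) = snd w' p (triv_inv (TR_times M A)
      u' p y)"
      using p triv_inv_TR[OF u(1), of "snd p" "fst p" "fst y" "snd y"] by (cases p; cases y)
        (auto simp: u(2) w(2))
  qed
qed

lemma local_section_lift:
  assumes W: "open W" and a: "local_section M W A id a"
  shows "local_section (line_times M) (UNIV \<times> W) (TR_times M A) id (\<lambda>p. (k, a (snd p)))"
  unfolding local_section_def
proof (intro conjI ballI)
  note L = smooth_manifold_line_times[OF M]
  show "(k, a (snd p)) \<in> fib (TR_times M A) (id p)" if "p \<in> UNIV \<times> W" for p
    using a that by (cases p) (simp add: local_section_def)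
  fix u' assume "u' \<in> trivs (TR_times M A)"
  then obtain u where u: "u \<in> trivs A" "u' = (UNIV \<times> fst u, \<lambda>(t, x) (s, v). (s, snd u x v))"
    unfolding trivs_TR by blast
  have o: "open (W \<inter> fst u)" using W open_triv[OF A u(1)] by blast
  then have oL: "open (UNIV \<times> (W \<inter> fst u))" by (simp add: open_Times)
  have e: "(UNIV \<times> W) \<inter> id -` fst u' = UNIV \<times> (W \<inter> fst u)" by (auto simp: u(2))
  have "smooth_fun_on M (W \<inter> fst u) (\<lambda>x. snd u x (a x))" using a u(1)
    by (simp add: local_section_def)
  from smooth_fun_on_Pair[OF L oL smooth_fun_on_const[OF L] smooth_fun_on_line_snd[OF M o this], of
    k]
  show "smooth_fun_on (line_times M) ((UNIV \<times> W) \<inter> id -` fst u') (\<lambda>p. snd u' (id p) (k, a (snd p)))"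
    unfolding e by (simp add: u(2) split_beta)
qed

end

lemma section_lift:
  assumes "smooth_manifold M" "smooth_vector_bundle M A" "a \<in> sections M A"
  shows "(\<lambda>p. (k, a (snd p))) \<in> sections (line_times M) (TR_times M A)"
  using local_section_lift[OF assms(1,2) open_UNIV, of a k] assms(3) by (simp add: sections_iff)

section \<open>Locally constant coefficients and brackets of lifted sections\<close>

lemma tangent_apply_zero:
  assumes "smooth_manifold M" "g \<in> smooth_functions M"
  shows "tangent_apply M x 0 g = 0"
  using tangent_apply_scaleR[OF assms(1) open_UNIV UNIV_I, of g x 0 0] assms(2)
    by (simp add: smooth_functions_iff)

lemma tangent_apply_locally_const:
  assumes "smooth_manifold M" "open V" "x \<in> V" "\<And>y. y \<in> V \<Longrightarrow> g y = k"
  shows "tangent_apply M x \<xi> g = 0"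
  using tangent_apply_cong[OF assms(1-3) smooth_fun_on_const[OF assms(1)], of k g \<xi>] assms(4)
  by (simp add: tangent_apply_const)

lemma deriv_locally_const:
  fixes g :: "real \<Rightarrow> real"
  assumes "open V" "t \<in> V" "\<And>s. s \<in> V \<Longrightarrow> g s = k"
  shows "deriv g t = 0"
proof -
  have "((\<lambda>s. k) has_real_derivative 0) (at t)" by simp
  then have "(g has_real_derivative 0) (at t)"
    by (rule has_field_derivative_transform_within_open[OF _ assms(1,2)]) (simp add: assms(3))
  then show ?thesis by (rule DERIV_imp_deriv)
qed

lemma vector_derivative_locally_const:
  fixes g :: "real \<Rightarrow> 'a::real_normed_vector"
  assumes "open V" "t \<in> V" "\<And>s. s \<in> V \<Longrightarrow> g s = k"
  shows "vector_derivative g (at t) = 0"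
proof -
  have "((\<lambda>s. k) has_vector_derivative 0) (at t)" by (rule has_vector_derivative_const)
  then have "(g has_vector_derivative 0) (at t)"
    by (rule has_vector_derivative_transform_within_open[OF _ assms(1,2)]) (simp add: assms(3))
  then show ?thesis by (rule vector_derivative_at)
qed

context
  fixes M :: "('m::{t2_space, second_countable_topology}, 'e::real_normed_vector) chart set"
    and A :: "('m, 'v::real_vector, 'f::real_normed_vector, 'e) lie_algebroid"
  assumes M: "smooth_manifold M" and A: "is_lie_algebroid M A"
begin

text \<open>Near the point the cut-off is 1 and the real components are constant, so every
  derivative outside the bracket of \<open>A\<close> vanishes. Inside it the Leibniz rule for
  \<open>\<lambda>y. \<theta> (t, y)\<close> gives no extra term, for the same reason. The time
  direction is the case \<open>k = 1\<close>, \<open>a = 0\<close>.\<close>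

lemma brk_TR_lift:
  assumes \<theta>: "\<theta> \<in> smooth_functions (line_times M)" and V: "open V" "(t, x) \<in> V" "\<And>q. q \<in> V \<Longrightarrow> \<theta> q =
    1"
    and a: "a \<in> sections M A" and b: "b \<in> sections M A"
  shows "brk (TR_times M A) (\<lambda>q. \<theta> q *\<^sub>R (k, a (snd q))) (\<lambda>q. \<theta> q *\<^sub>R (l, b (snd q))) (t, x) =
    (0, brk A a b x)"
proof -
  note vb = lie_algebroidD(1)[OF A]
  \<comment> \<open>The bracket differentiates along the line and along \<open>M\<close> separately;
    a product neighbourhood serves both.\<close>
  obtain V1 V2 where VV: "open V1" "open V2" "t \<in> V1" "x \<in> V2" "V1 \<times> V2 \<subseteq> V"
    using open_prod_elim[OF V(1,2)] by (metis SigmaE2)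
  have \<theta>1: "\<theta> (s, x) = 1" if "s \<in> V1" for s using V(3) VV that by blast
  have \<theta>2: "\<theta> (t, y) = 1" if "y \<in> V2" for y using V(3) VV that by blast
  have tx: "\<theta> (t, x) = 1" by (rule V(3)[OF V(2)])
  have d: "deriv (\<lambda>s. \<theta> (s, x) * c) t = 0" for c
    by (rule deriv_locally_const[OF VV(1,3)]) (simp add: \<theta>1)
  have ta: "tangent_apply M x \<xi> (\<lambda>y. \<theta> (t, y) * c) = 0" for \<xi> c
    by (rule tangent_apply_locally_const[OF M VV(2,4)]) (simp add: \<theta>2)
  have ta1: "tangent_apply M x \<xi> (\<lambda>y. \<theta> (t, y)) = 0" for \<xi>
    using ta[of \<xi> 1] by simp
  have fd: "fibre_derivative A x (\<lambda>s. \<theta> (s, x) *\<^sub>R c) t = 0" for c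
  proof -
    note u = triv_at[OF vb, of x]
    have "vector_derivative (\<lambda>s. snd (triv_at A x) x (\<theta> (s, x) *\<^sub>R c)) (at t) = 0"
      by (rule vector_derivative_locally_const[OF VV(1,3)]) (simp add: \<theta>1)
    then show ?thesis
      using linear_0[OF triv_inv_linear[OF vb u]] by (simp add: fibre_derivative_def Let_def)
  qed
  have \<theta>t: "(\<lambda>y. \<theta> (t, y)) \<in> smooth_functions M"
    using smooth_fun_on_slice[OF M open_UNIV, of \<theta> t] \<theta> by (simp add: smooth_functions_iff)
  have scale: "(\<lambda>y. \<theta> (t, y) *\<^sub>R c y) \<in> sections M A" if "c \<in> sections M A" for c
    using section_lincomb[OF M A \<theta>t that zero_section[OF M A]] by simp
  have br: "brk A c (\<lambda>y. \<theta> (t, y) *\<^sub>R c' y) x = brk A c c' x" if "c \<in> sections M A" "c' \<in> sections M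
    A" for c c'
    using lie_algebroidD(4)[OF A that \<theta>t, of x] by (simp add: ta1 tx)
  have "brk A (\<lambda>y. \<theta> (t, y) *\<^sub>R a y) (\<lambda>y. \<theta> (t, y) *\<^sub>R b y) x = brk A (\<lambda>y. \<theta> (t, y) *\<^sub>R a y) b x"
    by (rule br[OF scale[OF a] b])
  also have "\<dots> = - brk A b (\<lambda>y. \<theta> (t, y) *\<^sub>R a y) x"
    using brk_antisym[OF M A b scale[OF a]] by simp
  also have "\<dots> = - brk A b a x" by (simp add: br[OF b a])
  also have "\<dots> = brk A a b x" using brk_antisym[OF M A a b] by simp
  finally have "brk A (\<lambda>y. \<theta> (t, y) *\<^sub>R a y) (\<lambda>y. \<theta> (t, y) *\<^sub>R b y) x = brk A a b x" .
  then show ?thesis by (simp add: brk_TR d ta fd)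
qed

lemma brk_TR_lift_const:
  assumes "a \<in> sections M A" "b \<in> sections M A"
  shows "brk (TR_times M A) (\<lambda>q. (k, a (snd q))) (\<lambda>q. (l, b (snd q))) p = (0, brk A a b (snd p))"
proof -
  have "(\<lambda>q. 1) \<in> smooth_functions (line_times M)"
    using smooth_fun_on_const[OF smooth_manifold_line_times[OF M]]
      by (simp add: smooth_functions_iff)
  from brk_TR_lift[OF this open_UNIV UNIV_I refl assms, where t = "fst p" and x = "snd p" and k = k
    and l = l]
  show ?thesis by simp
qed

end

section \<open>The homotopy formula\<close>

text \<open>The contraction with the time direction, restricted to time \<open>t\<close> and to
  arguments from \<open>A\<close>. It is the integrand of \<open>integrate_interval\<close>.\<close>

definition slice :: "(real \<times> 'm, real \<times> 'v::zero) form \<Rightarrow> real \<Rightarrow> ('m, 'v) form"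
  where "slice \<omega> t = (\<lambda>x vs. \<omega> (t, x) ((1, 0) # map (\<lambda>v. (0, v)) vs))"

lemma eval_slice:
  "eval_form (slice \<omega> t) as x = eval_form \<omega> ((\<lambda>p. (1, 0)) # map (\<lambda>a p. (0, a (snd p))) as) (t, x)"
  by (simp add: eval_form_def slice_def o_def)

lemma linear_on_subspace_integral:
  fixes g :: "real \<Rightarrow> 'v::real_vector \<Rightarrow> real"
  assumes "\<And>t. linear_on_subspace S (g t)" "\<And>v. v \<in> S \<Longrightarrow> continuous_on {0..1} (\<lambda>t. g t v)"
  shows "linear_on_subspace S (\<lambda>v. integral {0..1} (\<lambda>t. g t v))"
  unfolding linear_on_subspace_def
proof (intro conjI ballI allI)
  note int = integrable_continuous_interval[OF assms(2)]
  show "integral {0..1} (\<lambda>t. g t (u + v)) = integral {0..1} (\<lambda>t. g t u) + integral {0..1}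
    (\<lambda>t. g t v)"
    if "u \<in> S" "v \<in> S" for u v
    using assms(1) that unfolding linear_on_subspace_def by (simp add: integral_add[OF int int])
  show "integral {0..1} (\<lambda>t. g t (c *\<^sub>R v)) = c *\<^sub>R integral {0..1} (\<lambda>t. g t v)" if "v \<in> S" for c v
    using assms(1) that unfolding linear_on_subspace_def by simp
qed

section \<open>Integration over the interval and the Koszul expression\<close>

context
  fixes M :: "('m::{t2_space, second_countable_topology}, 'e::real_normed_vector) chart set"
    and A :: "('m, 'v::real_vector, 'f::real_normed_vector, 'e) lie_algebroid"
  assumes M: "smooth_manifold M" and A: "is_lie_algebroid M A"
begin

private lemmas L = smooth_manifold_line_times[OF M]
  and vbA' = lie_algebroidD(1)[OF A]
  and vbTR = smooth_vector_bundle_TR[OF M lie_algebroidD(1)[OF A]]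

private abbreviation lft :: "('m \<Rightarrow> 'v) \<Rightarrow> real \<times> 'm \<Rightarrow> real \<times> 'v"
  where "lft a \<equiv> (\<lambda>p. (0, a (snd p)))"

private abbreviation dt :: "real \<times> 'm \<Rightarrow> real \<times> 'v"
  where "dt \<equiv> (\<lambda>p. (1, 0))"

lemma dt_section: "dt \<in> sections (line_times M) (TR_times M A)"
  using section_lift[OF M vbA' zero_section[OF M A], of 1] by simp

lemma lft_sections: "set as \<subseteq> sections M A \<Longrightarrow> set (map lft as) \<subseteq> sections (line_times M)
  (TR_times M A)"
  using section_lift[OF M vbA', of _ 0] by auto

lemma smooth_eval_TR:
  assumes "\<omega> \<in> Omega (line_times M) (TR_times M A)" "set bs \<subseteq> sections (line_times M)
    (TR_times M A)"
  shows "smooth_fun_on (line_times M) (UNIV \<times> UNIV) (eval_form \<omega> bs)"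
proof -
  have "smooth_fun_on (line_times M) UNIV (\<lambda>q. component (length bs) \<omega> (id q) (map (\<lambda>a. a q) bs))"
    by (rule smooth_form_eval[OF L L smooth_map_id[OF L] vbTR component_Omega[OF assms(1)]
      open_UNIV])
      (use assms(2) in \<open>auto simp: sections_iff[symmetric]\<close>)
  then show ?thesis unfolding eval_form_def[abs_def] by (simp add: component_def)
qed

lemma smooth_eval_slice:
  assumes "\<omega> \<in> Omega (line_times M) (TR_times M A)" "set as \<subseteq> sections M A"
  shows "smooth_fun_on (line_times M) (UNIV \<times> UNIV) (\<lambda>p. eval_form (slice \<omega> (fst p)) as (snd p))"
proof -
  have "set (dt # map lft as) \<subseteq> sections (line_times M) (TR_times M A)"
    using dt_section lft_sections[OF assms(2)] by simp
  from smooth_eval_TR[OF assms(1) this] show ?thesis unfolding eval_slice prod.collapse .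
qed

text \<open>Fibre elements are extended to sections of \<open>A\<close>, on which the slice depends
  smoothly on time and point together.\<close>

lemma continuous_slice:
  assumes \<omega>: "\<omega> \<in> Omega (line_times M) (TR_times M A)" and vs: "set vs \<subseteq> fib A x"
  shows "continuous_on S (\<lambda>t. slice \<omega> t x vs)"
proof -
  let ?as = "map (section_ext M A x) vs"
  have "set ?as \<subseteq> sections M A" using vs section_ext(1)[OF M A] by auto
  from curve_continuous[OF M open_UNIV smooth_eval_slice[OF \<omega> this] UNIV_I]
  have "continuous_on S (\<lambda>t. eval_form (slice \<omega> t) ?as x)" by simp
  moreover have "map (\<lambda>a. a x) ?as = vs" using vs section_ext(2)[OF M A] by (induction vs) auto
  ultimately show ?thesis unfolding eval_form_def by simp
qed

lemma slice_alt_on: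
  assumes "\<omega> \<in> Omega (line_times M) (TR_times M A)"
  shows "alt_on (fib A x) n (slice \<omega> t x)"
proof -
  have "alt_on (UNIV \<times> fib A x) n (\<lambda>vs. \<omega> (t, x) ((1, 0) # vs))"
    using Omega_alt_on[OF L vbTR assms, of "(t, x)" "Suc n"] subspace_0[OF subspace_fib[OF vbA'], of
      x]
    by (intro alt_on_Cons) auto
  then show ?thesis unfolding slice_def
    by (rule alt_on_compose) (auto simp: linear_on_subspace_def subspace_fib[OF vbA'])
qed

lemma integrate_interval_slice:
  "integrate_interval A \<omega> x vs = (if set vs \<subseteq> fib A x then integral {0..1} (\<lambda>t. slice \<omega> t x vs) else
    0)"
  by (simp add: integrate_interval_def slice_def)

lemma integrate_Omega:
  assumes \<omega>: "\<omega> \<in> Omega (line_times M) (TR_times M A)"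
  shows "integrate_interval A \<omega> \<in> Omega M A"
proof -
  let ?h = "integrate_interval A \<omega>"
  have "component n ?h \<in> Omega_n M A n" for n
  proof (rule Omega_nI[OF vbA'])
    show "component n ?h x vs = 0" if "\<not> (length vs = n \<and> set vs \<subseteq> fib A x)" for x vs
      using that by (auto simp: component_def integrate_interval_slice)
    show "alt_on (fib A x) n (component n ?h x)" for x
    proof (rule alt_on_cong[OF _ _ subspace_fib[OF vbA']])
      show "alt_on (fib A x) n (\<lambda>vs. integral {0..1} (\<lambda>t. slice \<omega> t x vs))"
        unfolding alt_on_def
      proof (intro conjI allI impI)
        fix us ws assume h: "length us + Suc (length ws) = n \<and> set us \<subseteq> fib A x \<and> set ws \<subseteq> fib A x"
        show "linear_on_subspace (fib A x) (\<lambda>v. integral {0..1} (\<lambda>t. slice \<omega> t x (us @ v # ws)))"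
        proof (rule linear_on_subspace_integral)
          show "linear_on_subspace (fib A x) (\<lambda>v. slice \<omega> t x (us @ v # ws))" for t
            by (rule alt_on_linear[OF slice_alt_on[OF \<omega>, where n = n]]) (use h in auto)
          show "continuous_on {0..1} (\<lambda>t. slice \<omega> t x (us @ v # ws))" if "v \<in> fib A x" for v
            by (rule continuous_slice[OF \<omega>]) (use h that in auto)
        qed
      next
        fix vs i j assume ij: "i < n" "j < n" "length vs = n \<and> set vs \<subseteq> fib A x \<and> i \<noteq> j \<and> vs ! i =
          vs ! j"
        have "slice \<omega> t x vs = 0" for t
          by (rule alt_on_eq_zero[OF slice_alt_on[OF \<omega>, where n = n], of vs _ i j]) (use ij in auto)
        then show "integral {0..1} (\<lambda>t. slice \<omega> t x vs) = 0" by simp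
      qed
    qed (simp add: component_def integrate_interval_slice)
    fix u and ys :: "'f list" assume u: "u \<in> trivs A" and ys: "length ys = n"
    note ou = open_triv[OF vbA' u]
    have oL: "open ((UNIV :: real set) \<times> fst u)" using ou by (simp add: open_Times)
    let ?bs = "dt # map (\<lambda>y. lft (\<lambda>x. triv_inv A u x y)) ys"
    have "smooth_fun_on (line_times M) (UNIV \<times> fst u) (\<lambda>q. component (length ?bs) \<omega> (id q)
      (map (\<lambda>a. a q) ?bs))"
    proof (rule smooth_form_eval[OF L L smooth_map_id[OF L] vbTR component_Omega[OF \<omega>] oL])
      fix b assume "b \<in> set ?bs"
      then consider "b = dt" | y where "b = lft (\<lambda>x. triv_inv A u x y)" by auto
      then show "local_section (line_times M) (UNIV \<times> fst u) (TR_times M A) id b"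
      proof cases
        case 1
        then show ?thesis using dt_section local_section_subset by (metis sections_iff subset_UNIV)
      next
        case 2
        then show ?thesis using local_section_lift[OF M vbA' ou local_section_triv_inv[OF M vbA' u]]
          by simp
      qed
    qed
    then have "smooth_fun_on (line_times M) (UNIV \<times> fst u) (\<lambda>q. slice \<omega> (fst q) (snd q)
      (map (triv_inv A u (snd q)) ys))"
      by (simp add: component_def slice_def o_def)
    from smooth_fun_on_integral[OF M ou this]
    have "smooth_fun_on M (fst u) (\<lambda>x. integral {0..1} (\<lambda>t. slice \<omega> t x (map (triv_inv A u x) ys)))"
      by simp
    then show "smooth_fun_on M (fst u) (\<lambda>x. component n ?h x (map (triv_inv A u x) ys))"
    proof (rule smooth_fun_on_cong[OF M ou, rotated])
      fix x assume x: "x \<in> fst u"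
      have "set (map (triv_inv A u x) ys) \<subseteq> fib A x" using triv_inv_fib[OF vbA' u x] by auto
      then show "integral {0..1} (\<lambda>t. slice \<omega> t x (map (triv_inv A u x) ys)) = component n ?h x
        (map (triv_inv A u x) ys)"
        using ys by (simp add: component_def integrate_interval_slice)
    qed
  qed
  moreover have "finite {n. component n ?h \<noteq> 0}"
  proof -
    have "component n ?h = 0" if "component (Suc n) \<omega> = 0" for n
    proof (intro ext)
      fix x vs
      have "slice \<omega> t x vs = 0" if "length vs = n" for t
        using fun_cong[OF fun_cong[OF \<open>component (Suc n) \<omega> = 0\<close>, of "(t, x)"], of "(1, 0) # map
          (\<lambda>v. (0, v)) vs"] that
        by (simp add: component_def slice_def)
      then show "component n ?h x vs = 0 x vs" by (simp add: component_def integrate_interval_slice)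
    qed
    \<comment> \<open>Integration lowers the degree by one; injectivity of \<open>Suc\<close>
      carries finiteness back.\<close>
    then have "Suc ` {n. component n ?h \<noteq> 0} \<subseteq> {n. component n \<omega> \<noteq> 0}" by auto
    moreover have "finite {n. component n \<omega> \<noteq> 0}" using \<omega> unfolding Omega_def by simp
    ultimately show ?thesis by (meson finite_imageD finite_subset inj_Suc inj_on_subset subset_UNIV)
  qed
  ultimately show ?thesis unfolding Omega_def by blast
qed

lemma eval_integrate:
  assumes "set as \<subseteq> sections M A"
  shows "eval_form (integrate_interval A \<omega>) as x = integral {0..1} (\<lambda>t. eval_form (slice \<omega> t) as x)"
proof -
  have "set (map (\<lambda>a. a x) as) \<subseteq> fib A x" using assms section_mem[OF M A] by auto
  then show ?thesis by (simp add: eval_form_def integrate_interval_slice)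
qed

text \<open>All differentiations are along \<open>M\<close>, so they pass under the integral, and
  what remains are finite sums. The continuity ensures that the right-hand side is a genuine
  integral and not the default value of \<open>integral\<close>.\<close>

lemma koszul_integrate:
  assumes \<omega>: "\<omega> \<in> Omega (line_times M) (TR_times M A)" and as: "set as \<subseteq> sections M A"
  shows "koszul M A (integrate_interval A \<omega>) as x = integral {0..1} (\<lambda>t. koszul M A (slice \<omega> t) as
    x)"
    and "continuous_on {0..1} (\<lambda>t. koszul M A (slice \<omega> t) as x)"
proof -
  have o: "set (omit i as) \<subseteq> sections M A" for i by (rule subset_trans[OF set_omit as])
  let ?T = "\<lambda>i t. tangent_apply M x (anchor A x ((as ! i) x)) (eval_form (slice \<omega> t) (omit i as))"
  let ?U = "\<lambda>i j t. eval_form (slice \<omega> t) (brk A (as ! i) (as ! j) # omit i (omit j as)) x"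
  have T: "tangent_apply M x \<xi> (eval_form (integrate_interval A \<omega>) (omit i as))
      = integral {0..1} (\<lambda>t. tangent_apply M x \<xi> (eval_form (slice \<omega> t) (omit i as)))"
    "continuous_on {0..1} (\<lambda>t. tangent_apply M x \<xi> (eval_form (slice \<omega> t) (omit i as)))" for \<xi> i
    using tangent_apply_integral[OF M open_UNIV smooth_eval_slice[OF \<omega> o] UNIV_I, of x \<xi> i]
    unfolding eval_integrate[OF o, abs_def] by simp_all
  have U: "set (brk A (as ! i) (as ! j) # omit i (omit j as)) \<subseteq> sections M A" if "i < j"
    "j < length as" for i j
  proof -
    have "as ! i \<in> sections M A" "as ! j \<in> sections M A" using that as by auto
    then show ?thesis using brk_section[OF M A] subset_trans[OF set_omit o] by simp
  qed
  have cU: "continuous_on {0..1} (?U i j)" if "i < j" "j < length as" for i j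
    using curve_continuous[OF M open_UNIV smooth_eval_slice[OF \<omega> U[OF that]] UNIV_I, of _ x] by simp
  show c: "continuous_on {0..1} (\<lambda>t. koszul M A (slice \<omega> t) as x)"
    unfolding koszul_def using T(2) cU by (intro continuous_intros) auto
  have c1: "continuous_on {0..1} (\<lambda>t. \<Sum>i<length as. (-1) ^ i * ?T i t)"
    and c2: "continuous_on {0..1} (\<lambda>t. \<Sum>j<length as. \<Sum>i<j. (-1) ^ (i + j) * ?U i j t)"
    and c3: "\<And>j. j < length as \<Longrightarrow> continuous_on {0..1} (\<lambda>t. \<Sum>i<j. (-1) ^ (i + j) * ?U i j t)"
    using T(2) cU by (auto intro!: continuous_intros)
  note int = integrable_continuous_interval
  have "integral {0..1} (\<lambda>t. koszul M A (slice \<omega> t) as x)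
      = integral {0..1} (\<lambda>t. \<Sum>i<length as. (-1) ^ i * ?T i t)
        + integral {0..1} (\<lambda>t. \<Sum>j<length as. \<Sum>i<j. (-1) ^ (i + j) * ?U i j t)"
    unfolding koszul_def by (rule integral_add[OF int[OF c1] int[OF c2]])
  also have "integral {0..1} (\<lambda>t. \<Sum>i<length as. (-1) ^ i * ?T i t) = (\<Sum>i<length as. (-1) ^ i *
    integral {0..1} (?T i))"
    using T(2) by (subst integral_sum) (auto intro!: int continuous_intros)
  also have "integral {0..1} (\<lambda>t. \<Sum>j<length as. \<Sum>i<j. (-1) ^ (i + j) * ?U i j t)
      = (\<Sum>j<length as. integral {0..1} (\<lambda>t. \<Sum>i<j. (-1) ^ (i + j) * ?U i j t))"
    by (rule integral_sum) (auto intro!: int c3)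
  also have "\<dots> = (\<Sum>j<length as. \<Sum>i<j. (-1) ^ (i + j) * integral {0..1} (?U i j))"
  proof (intro sum.cong refl)
    fix j assume "j \<in> {..<length as}"
    then show "integral {0..1} (\<lambda>t. \<Sum>i<j. (-1) ^ (i + j) * ?U i j t) = (\<Sum>i<j. (-1) ^ (i + j) *
      integral {0..1} (?U i j))"
      using cU by (subst integral_sum) (auto intro!: int continuous_intros)
  qed
  also have "\<dots> = (\<Sum>j<length as. \<Sum>i<j. (-1) ^ (i + j) *
      eval_form (integrate_interval A \<omega>) (brk A (as ! i) (as ! j) # omit i (omit j as)) x)"
  proof (intro sum.cong refl)
    fix j i assume "j \<in> {..<length as}" "i \<in> {..<j}"
    then show "(-1) ^ (i + j) * integral {0..1} (?U i j) = (-1) ^ (i + j) *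
        eval_form (integrate_interval A \<omega>) (brk A (as ! i) (as ! j) # omit i (omit j as)) x"
      using eval_integrate[OF U] by simp
  qed
  finally show "koszul M A (integrate_interval A \<omega>) as x = integral {0..1} (\<lambda>t. koszul M A
    (slice \<omega> t) as x)"
    unfolding koszul_def T(1) by simp
qed

lemma tangent_apply_lift:
  assumes "smooth_fun_on (line_times M) (UNIV \<times> UNIV) F"
  shows "tangent_apply (line_times M) (t, x) (anchor (TR_times M A) (t, x) (s, v)) F
    = s * deriv (\<lambda>u. F (u, x)) t + tangent_apply M x (anchor A x v) (\<lambda>y. F (t, y))"
  unfolding anchor_TR by (rule tangent_apply_line_times[OF M open_UNIV assms UNIV_I])

text \<open>The anchor of \<open>dt\<close> differentiates in time, and the bracket of
  \<open>dt\<close> with a lift is a bracket with the zero section, so the Lie derivative is the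
  time derivative. The anchors of the lifts have no time part, so the contracted term can be
  computed at fixed \<open>t\<close>, where it is the Koszul expression of \<open>A\<close> on the
  slice.\<close>

lemma koszul_TR:
  assumes \<omega>: "\<omega> \<in> Omega (line_times M) (TR_times M A)" and as: "set as \<subseteq> sections M A"
  shows "koszul (line_times M) (TR_times M A) \<omega> (dt # map lft as) (t, x)
    = deriv (\<lambda>u. eval_form \<omega> (map lft as) (u, x)) t - koszul M A (slice \<omega> t) as x"
proof -
  let ?P = "line_times M" and ?TR = "TR_times M A"
  have z: "0 \<in> sections M A" by (rule zero_section[OF M A])
  have mem: "b (t, x) \<in> fib ?TR (t, x)" if "b \<in> set (dt # map lft as)" for b
    using that as section_mem[OF M A] subspace_0[OF subspace_fib[OF vbA']] by auto
  \<comment> \<open>The time direction is a lift of the zero section with constant real component 1,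
    hence a case of the bracket lemma for lifts.\<close>
  have dtl: "dt = (\<lambda>p. (1, 0 (snd p)))" by simp
  have br: "brk ?TR b c (t, x) \<in> fib ?TR (t, x)" if "b \<in> set (dt # map lft as)"
    "c \<in> set (dt # map lft as)" for b c
  proof -
    have "\<exists>k a. a \<in> sections M A \<and> b = (\<lambda>p. (k, a (snd p)))" if "b \<in> set (dt # map lft as)" for b
    proof (cases "b = dt")
      case True
      then show ?thesis using z dtl by blast
    next
      case False
      then show ?thesis using that as by auto
    qed
    from this[OF that(1)] this[OF that(2)] show ?thesis
      using brk_TR_lift_const[OF M A] section_mem[OF M A brk_section[OF M A]] by fastforce
  qed
  have K: "koszul ?P ?TR \<omega> (dt # map lft as) (t, x)
      = lie_form ?P ?TR dt \<omega> (map lft as) (t, x) - koszul ?P ?TR (contract dt \<omega>) (map lft as)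
        (t, x)"
  proof (rule koszul_Cons[OF subspace_fib[OF vbTR] Omega_alt_on[OF L vbTR \<omega>]])
    show "b (t, x) \<in> fib ?TR (t, x)" if "b \<in> set (dt # map lft as)" for b by (rule mem[OF that])
    show "brk ?TR b c (t, x) \<in> fib ?TR (t, x)"
      if "b \<in> set (dt # map lft as)" "c \<in> set (dt # map lft as)" for b c by (rule br[OF that])
  qed
  have a0: "anchor A x 0 = 0" using linear_on_subspace_zero[OF anchor_linear[OF M A] subspace_0[OF
    subspace_fib[OF vbA']]] .
  have sm: "smooth_fun_on ?P (UNIV \<times> UNIV) (eval_form \<omega> (map lft as))"
    by (rule smooth_eval_TR[OF \<omega> lft_sections[OF as]])
  have "(\<lambda>y. eval_form \<omega> (map lft as) (t, y)) \<in> smooth_functions M"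
    using smooth_fun_on_slice[OF M open_UNIV sm] by (simp add: smooth_functions_iff)
  then have 1: "tangent_apply ?P (t, x) (anchor ?TR (t, x) (dt (t, x))) (eval_form \<omega> (map lft as))
      = deriv (\<lambda>u. eval_form \<omega> (map lft as) (u, x)) t"
    using tangent_apply_lift[OF sm, of t x 1 0] tangent_apply_zero[OF M] by (simp add: a0)
  \<comment> \<open>The bracket in slot \<open>i\<close> is the zero vector at this point, and a
    form vanishes on a list with a zero entry.\<close>
  have 2: "eval_form \<omega> ((map lft as)[i := brk ?TR dt (map lft as ! i)]) (t, x) = 0" if i:
    "i < length as" for i
  proof -
    have ai: "as ! i \<in> sections M A" using as i by auto
    have "brk A 0 (as ! i) = 0"
      using lie_algebroidD(3)[OF A] ai linear_on_subspace_zero[of "sections M A" "\<lambda>b. brk A b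
        (as ! i)" "as ! i"]
      unfolding lie_bracket_on_def by blast
    then have "brk ?TR dt (lft (as ! i)) (t, x) = (0, 0)"
      using brk_TR_lift_const[OF M A z ai, of 1 0 "(t, x)"] by simp
    then have v: "brk ?TR dt (map lft as ! i) (t, x) = 0" using i by (simp add: zero_prod_def)
    have "set (map (\<lambda>a. a (t, x)) (map lft as)) \<subseteq> fib ?TR (t, x)"
      using as section_mem[OF M A] by auto
    then have "linear_on_subspace (fib ?TR (t, x)) (\<lambda>v. \<omega> (t, x)
      ((map (\<lambda>a. a (t, x)) (map lft as))[i := v]))"
      by (intro alt_on_update_linear[OF Omega_alt_on[OF L vbTR \<omega>]]) (use i in auto)
    from linear_on_subspace_zero[OF this subspace_0[OF subspace_fib[OF vbTR]]]
    show ?thesis by (simp only: eval_form_def map_update v)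
  qed
  have lf: "lie_form ?P ?TR dt \<omega> (map lft as) (t, x) = deriv (\<lambda>u. eval_form \<omega> (map lft as) (u, x))
    t"
    unfolding lie_form_def 1 using 2 by simp
  have ev: "eval_form (contract dt \<omega>) (map lft bs) (t, y) = eval_form (slice \<omega> t) bs y" for bs y
    by (simp add: eval_slice eval_form_Cons)
  have o: "set (omit i as) \<subseteq> sections M A" for i by (rule subset_trans[OF set_omit as])
  have T: "tangent_apply ?P (t, x) (anchor ?TR (t, x) (lft a (t, x))) (eval_form (contract dt \<omega>)
    (map lft (omit i as)))
      = tangent_apply M x (anchor A x (a x)) (eval_form (slice \<omega> t) (omit i as))" for a i
  proof -
    have "smooth_fun_on ?P (UNIV \<times> UNIV) (eval_form (contract dt \<omega>) (map lft (omit i as)))"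
      using smooth_eval_TR[OF \<omega>, of "dt # map lft (omit i as)"] dt_section lft_sections[OF o]
      by (simp add: eval_form_Cons)
    from tangent_apply_lift[OF this, of t x 0 "a x"] show ?thesis by (simp add: ev)
  qed
  have U: "eval_form (contract dt \<omega>) (brk ?TR (lft (as ! i)) (lft (as ! j)) # map lft bs) (t, x)
      = eval_form (slice \<omega> t) (brk A (as ! i) (as ! j) # bs) x" if "i < j" "j < length
        as" for i j bs
  proof -
    have "as ! i \<in> sections M A" "as ! j \<in> sections M A" using that as by auto
    from brk_TR_lift_const[OF M A this, of 0 0 "(t, x)"]
    have "brk ?TR (lft (as ! i)) (lft (as ! j)) (t, x) = lft (brk A (as ! i) (as ! j)) (t, x)"
      by simp
    then have "eval_form (contract dt \<omega>) (brk ?TR (lft (as ! i)) (lft (as ! j)) # map lft bs) (t, x)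
        = eval_form (contract dt \<omega>) (map lft (brk A (as ! i) (as ! j) # bs)) (t, x)"
      by (simp only: eval_form_def list.map)
    then show ?thesis by (simp only: ev)
  qed
  have "koszul ?P ?TR (contract dt \<omega>) (map lft as) (t, x) = koszul M A (slice \<omega> t) as x"
    unfolding koszul_def length_map map_omit[symmetric]
  proof (intro arg_cong2[of _ _ _ _ "(+)"] sum.cong refl)
    fix i assume "i \<in> {..<length as}"
    then show "(-1) ^ i * tangent_apply ?P (t, x) (anchor ?TR (t, x) ((map lft as ! i) (t, x)))
          (eval_form (contract dt \<omega>) (map lft (omit i as)))
        = (-1) ^ i * tangent_apply M x (anchor A x ((as ! i) x)) (eval_form (slice \<omega> t)
          (omit i as))"
      using T[of "as ! i" i] by simp
  next
    fix j i assume "j \<in> {..<length as}" "i \<in> {..<j}"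
    then show "(-1) ^ (i + j) * eval_form (contract dt \<omega>)
          (brk ?TR (map lft as ! i) (map lft as ! j) # map lft (omit i (omit j as))) (t, x)
        = (-1) ^ (i + j) * eval_form (slice \<omega> t) (brk A (as ! i) (as ! j) # omit i (omit j as)) x"
      using U[of i j] by simp
  qed
  then show ?thesis unfolding K lf by simp
qed

end

theorem theorem11:
  fixes M :: "('m::{t2_space, second_countable_topology}, 'e::real_normed_vector) chart set"
    and A :: "('m, 'v::real_vector, 'f::real_normed_vector, 'e) lie_algebroid"
    and B :: "('m, 'w::real_vector, 'g::real_normed_vector, 'e) lie_algebroid"
    and \<Phi>0 \<Phi>1 :: "'m \<times> 'v \<Rightarrow> 'm \<times> 'w"
    and \<Phi> :: "(real \<times> 'm) \<times> (real \<times> 'v) \<Rightarrow> 'm \<times> 'w"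
  assumes "smooth_manifold M"
    and "is_lie_algebroid M A" and "is_lie_algebroid M B"
    and "lie_algebroid_hom M A M B \<Phi>0" and "lie_algebroid_hom M A M B \<Phi>1"
    and "lie_homotopy M A M B \<Phi>0 \<Phi>1 \<Phi>"
  shows "chain_operator (Omega M B) (ext_deriv M B) (Omega M A) (ext_deriv M A)
    (pullback A \<Phi>0) (pullback A \<Phi>1)
    (integrate_interval A \<circ> pullback (TR_times M A) \<Phi>)"
proof -
  note M = assms(1) and A = assms(2) and B = assms(3)
  let ?P = "line_times M" and ?TR = "TR_times M A"
  let ?pb = "pullback ?TR \<Phi>" and ?int = "integrate_interval A"
  note vbA = lie_algebroidD(1)[OF A] and vbB = lie_algebroidD(1)[OF B]
  note L = smooth_manifold_line_times[OF M] and vbTR = smooth_vector_bundle_TR[OF M vbA]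
  have hom: "lie_algebroid_hom ?P ?TR M B \<Phi>"
    and ends: "\<And>x v. v \<in> fib A x \<Longrightarrow> \<Phi> ((0, x), (0, v)) = \<Phi>0 (x, v)"
      "\<And>x v. v \<in> fib A x \<Longrightarrow> \<Phi> ((1, x), (0, v)) = \<Phi>1 (x, v)"
    using assms(6) unfolding lie_homotopy_def total_space_def by auto
  have vbh: "vb_hom ?P ?TR M B (base_map \<Phi>) \<Phi>"
    and vbh0: "vb_hom M A M B (base_map \<Phi>0) \<Phi>0" and vbh1: "vb_hom M A M B (base_map \<Phi>1) \<Phi>1"
    using hom assms(4,5) unfolding lie_algebroid_hom_def Let_def by blast+
  have pbO: "?pb \<eta> \<in> Omega ?P ?TR" if "\<eta> \<in> Omega M B" for \<eta>
    by (rule pullback_Omega[OF L M vbTR vbB vbh that])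
  have hO: "?int (?pb \<eta>) \<in> Omega M A" if "\<eta> \<in> Omega M B" for \<eta>
    by (rule integrate_Omega[OF M A pbO[OF that]])
  have "linear_on_subspace (Omega M B) (?int \<circ> ?pb)"
    unfolding linear_on_subspace_def
  proof (intro conjI ballI allI)
    fix \<eta> \<zeta> assume h: "\<eta> \<in> Omega M B" "\<zeta> \<in> Omega M B"
    show "(?int \<circ> ?pb) (\<eta> + \<zeta>) = (?int \<circ> ?pb) \<eta> + (?int \<circ> ?pb) \<zeta>"
    proof (intro ext)
      fix x vs
      have "slice (?pb (\<eta> + \<zeta>)) t x vs = slice (?pb \<eta>) t x vs + slice (?pb \<zeta>) t x vs" for t
        by (simp add: slice_def pullback_def)
      then show "(?int \<circ> ?pb) (\<eta> + \<zeta>) x vs = ((?int \<circ> ?pb) \<eta> + (?int \<circ> ?pb) \<zeta>) x vs"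
        using integrable_continuous_interval[OF continuous_slice[OF M A pbO[OF h(1)]]]
          integrable_continuous_interval[OF continuous_slice[OF M A pbO[OF h(2)]]]
        by (simp add: integrate_interval_slice[OF M A] integral_add)
    qed
  next
    fix c \<eta> assume h: "\<eta> \<in> Omega M B"
    show "(?int \<circ> ?pb) (c *\<^sub>R \<eta>) = c *\<^sub>R (?int \<circ> ?pb) \<eta>"
    proof (intro ext)
      fix x vs
      have "slice (?pb (c *\<^sub>R \<eta>)) t x vs = c * slice (?pb \<eta>) t x vs" for t
        by (simp add: slice_def pullback_def scaleR_fun_def)
      then show "(?int \<circ> ?pb) (c *\<^sub>R \<eta>) x vs = (c *\<^sub>R (?int \<circ> ?pb) \<eta>) x vs"
        by (simp add: integrate_interval_slice[OF M A] scaleR_fun_def)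
    qed
  qed
  moreover have "?int (?pb (ext_deriv M B \<eta>)) + ext_deriv M A (?int (?pb \<eta>)) = pullback A \<Phi>1 \<eta> -
    pullback A \<Phi>0 \<eta>"
    if \<eta>: "\<eta> \<in> Omega M B" for \<eta>
  proof -
    let ?\<omega> = "?pb \<eta>" and ?d = "?pb (ext_deriv M B \<eta>)"
    note \<omega> = pbO[OF \<eta>]
    \<comment> \<open>Both ends are treated at once, with \<open>\<theta>\<close> the time and
      \<open>\<Psi>\<close> the homomorphism there. Lifted arguments have the null vector as real
      part, and the base maps agree because \<open>base_map\<close> evaluates at the zero
      vector.\<close>
    have endpoint: "eval_form ?\<omega> (map (\<lambda>a p. (0, a (snd p))) as) (\<theta>, x) = eval_form (pullback A \<Psi> \<eta>)
      as x"
      if as: "set as \<subseteq> sections M A" and \<Psi>: "\<And>x v. v \<in> fib A x \<Longrightarrow> \<Phi> ((\<theta>, x), (0, v)) = \<Psi> (x, v)" for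
        as \<theta> \<Psi> x
    proof -
      have m: "a x \<in> fib A x" if "a \<in> set as" for a using as that section_mem[OF M A] by blast
      have "base_map \<Phi> (\<theta>, x) = base_map \<Psi> x"
        using \<Psi>[OF subspace_0[OF subspace_fib[OF vbA]], of x] by (simp add: base_map_def
          zero_prod_def)
      moreover have "map (\<lambda>v. snd (\<Phi> ((\<theta>, x), v))) (map (\<lambda>b. b (\<theta>, x)) (map (\<lambda>a p. (0, a (snd p)))
        as))
          = map (\<lambda>v. snd (\<Psi> (x, v))) (map (\<lambda>a. a x) as)"
        using \<Psi> m by simp
      moreover have "set (map (\<lambda>b. b (\<theta>, x)) (map (\<lambda>a p. (0, a (snd p))) as)) \<subseteq> fib ?TR (\<theta>, x)"
        "set (map (\<lambda>a. a x) as) \<subseteq> fib A x" using m by auto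
      ultimately show ?thesis by (simp only: eval_form_def pullback_def if_True)
    qed
    \<comment> \<open>The homotopy formula on sections, before its last term is known to be a
      differential. The empty list is included: there the Koszul expression is 0, and the formula
      reduces to the fundamental theorem of calculus along \<open>t\<close>.\<close>
    have star: "eval_form (?int ?d) as x = eval_form (pullback A \<Phi>1 \<eta>) as x - eval_form
      (pullback A \<Phi>0 \<eta>) as x
        - koszul M A (?int ?\<omega>) as x" if as: "set as \<subseteq> sections M A" for as x
    proof -
      let ?as = "map (\<lambda>a p. (0, a (snd p))) as"
      let ?ss = "(\<lambda>p. (1, 0)) # ?as"
      let ?F = "\<lambda>u. eval_form ?\<omega> ?as (u, x)"
      have ss: "?ss \<noteq> []" "set ?ss \<subseteq> sections ?P ?TR"
        using dt_section[OF M A] lft_sections[OF M A as] by auto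
      have "eval_form (slice ?d t) as x = koszul ?P ?TR ?\<omega> ?ss (t, x)" for t
      proof -
        have "?d (t, x) (map (\<lambda>s. s (t, x)) ?ss) = koszul ?P ?TR ?\<omega> ?ss (t, x)"
        proof (rule pullback_ext_deriv[OF L M vbTR B hom \<eta> ss])
          fix \<theta> V and s s' :: "real \<times> 'm \<Rightarrow> real \<times> 'v" assume \<theta>: "\<theta> \<in> smooth_functions ?P" "open V"
            "(t, x) \<in> V" "\<And>q. q \<in> V \<Longrightarrow> \<theta> q = 1"
            and s: "s \<in> set ?ss" "s' \<in> set ?ss"
          \<comment> \<open>Every argument is a lift with constant real part, so its brackets are
            known also after multiplication by a cut-off.\<close>
          have lift: "\<exists>k a. a \<in> sections M A \<and> s = (\<lambda>p. (k, a (snd p)))"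
            if "s \<in> set ?ss" for s :: "real \<times> 'm \<Rightarrow> real \<times> 'v"
          proof (cases "s = (\<lambda>p. (1, 0))")
            case True
            then have "s = (\<lambda>p. (1, 0 (snd p)))" by simp
            then show ?thesis using zero_section[OF M A] by blast
          next
            case False
            then show ?thesis using that as by auto
          qed
          obtain k a l b where ab: "a \<in> sections M A" "b \<in> sections M A"
            "s = (\<lambda>p. (k, a (snd p)))" "s' = (\<lambda>p. (l, b (snd p)))"
            using lift[OF s(1)] lift[OF s(2)] by blast
          show "brk ?TR (\<lambda>q. \<theta> q *\<^sub>R s q) (\<lambda>q. \<theta> q *\<^sub>R s' q) (t, x) = brk ?TR s s' (t, x) \<and>
              brk ?TR s s' (t, x) \<in> fib ?TR (t, x)"
            using brk_TR_lift[OF M A \<theta> ab(1,2), of k l] brk_TR_lift_const[OF M A ab(1,2), of k l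
              "(t, x)"]
              section_mem[OF M A brk_section[OF M A ab(1,2)], of x]
            unfolding ab(3,4) by simp
        qed
        then show ?thesis unfolding eval_slice unfolding eval_form_def .
      qed
      then have sl: "eval_form (slice ?d t) as x = deriv ?F t - koszul M A (slice ?\<omega> t) as x" for t
        using koszul_TR[OF M A \<omega> as] by simp
      have "(?F has_vector_derivative deriv ?F t) (at t within {0..1})" for t
      proof -
        have "?F differentiable (at t)"
          by (rule curve_differentiable[OF M open_UNIV smooth_eval_TR[OF M A \<omega> lft_sections[OF M A
            as]] UNIV_I])
        then have "(?F has_real_derivative deriv ?F t) (at t)"
          by (simp add: DERIV_deriv_iff_real_differentiable)
        then show ?thesis
          unfolding has_real_derivative_iff_has_vector_derivative
            by (rule has_vector_derivative_at_within)
      qed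
      then have "((\<lambda>t. deriv ?F t) has_integral (?F 1 - ?F 0)) {0..1}"
        by (intro fundamental_theorem_of_calculus) auto
      moreover have "((\<lambda>t. koszul M A (slice ?\<omega> t) as x) has_integral koszul M A (?int ?\<omega>) as x)
        {0..1}"
        unfolding koszul_integrate(1)[OF M A \<omega> as]
        by (intro integrable_integral integrable_continuous_interval koszul_integrate(2)[OF M A \<omega>
          as])
      ultimately have "((\<lambda>t. eval_form (slice ?d t) as x) has_integral (?F 1 - ?F 0 - koszul M A
        (?int ?\<omega>) as x)) {0..1}"
        unfolding sl by (rule has_integral_diff)
      then have "eval_form (?int ?d) as x = ?F 1 - ?F 0 - koszul M A (?int ?\<omega>) as x"
        unfolding eval_integrate[OF M A as] by (rule integral_unique)
      then show ?thesis using endpoint[OF as ends(1)] endpoint[OF as ends(2)] by simp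
    qed
    let ?D = "pullback A \<Phi>1 \<eta> - pullback A \<Phi>0 \<eta> - ?int ?d"
    note S = subspace_Omega[OF M vbA]
    \<comment> \<open>The claim is solved for the differential on \<open>A\<close>. The form
      \<open>?D\<close> has the values required of it by \<open>star\<close>, so it is this
      differential by uniqueness.\<close>
    have "ext_deriv M A (?int ?\<omega>) = ?D"
    proof (rule ext_deriv_eqI[OF M A])
      show "?D \<in> Omega M A"
        by (rule subspace_diff[OF S subspace_diff[OF S pullback_Omega[OF M M vbA vbB vbh1 \<eta>]
            pullback_Omega[OF M M vbA vbB vbh0 \<eta>]] hO[OF ext_deriv(1)[OF M B \<eta>]]])
      \<comment> \<open>This is the homotopy formula in degree 0, where the differential on
        \<open>A\<close> contributes nothing.\<close>
      show "component 0 ?D = 0"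
        using star[of "[]"] by (auto simp: component_def fun_eq_iff eval_form_def koszul_Nil)
      show "eval_form ?D as = koszul M A (?int ?\<omega>) as" if "set as \<subseteq> sections M A" for as
      proof
        fix x
        show "eval_form ?D as x = koszul M A (?int ?\<omega>) as x"
          using star[OF that, of x] by (simp add: eval_form_def)
      qed
    qed
    then show ?thesis by simp
  qed
  ultimately show ?thesis
    unfolding chain_operator_def using hO by auto
qed

end
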